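(* Let $\Delta$ be a smooth complete fan in $N_{\mathbb R}$, $N\cong\mathbb Z^n$, with $d$ edges, let $\mathcal A_\Delta\subset\mathbb R^d$ be the associated coordinate subspace arrangement and $\mathcal C_\Delta=\mathbb R^d-\mathcal A_\Delta$ its complement. Then $\pi_1(\mathcal C_\Delta)$ is isomorphic to the commutator subgroup $[W(\Delta),W(\Delta)]$ of the right-angled Coxeter group $W(\Delta)$. Further, $\mathcal C_\Delta$ is aspherical if and only if $\mathcal A_\Delta$ is a union of subspaces of codimension precisely $2$ in $\mathbb R^d$.
   Context: A smooth complete fan is a finite fan of strongly convex rational polyhedral cones, each generated by part of a $\mathbb Z$-basis of $N$, whose union is $N_{\mathbb R}=N\otimes\mathbb R$. Its edges (one-dimensional cones) are $\rho_1,\dots,\rho_d$, with primitive lattice vectors $v_1,\dots,v_d$. A set $\mathcal P=\{\rho_{i_1},\dots,\rho_{i_k}\}$ of edges is a primitive collection if it does not span (generate) a cone of $\Delta$ but every proper subcollection does. For such $\mathcal P$ put $\mathcal A(\mathcal P)=\{x\in\mathbb R^d: x_{i_1}=\dots=x_{i_k}=0\}$. Then $\mathcal A_\Delta=\bigcup_{\mathcal P}\mathcal A(\mathcal P)$, the union over all primitive collections, and $\mathcal C_\Delta=\mathbb R^d-\mathcal A_\Delta$. The right-angled Coxeter group is $W(\Delta)=\langle s_1,\dots,s_d\mid s_j^2\ (1\le j\le d),\ (s_is_j)^2 \text{ whenever } \{v_i,v_j\}\text{ spans a cone in }\Delta\rangle$. A connected space is aspherical ($K(\pi,1)$) if its universal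 cover is contractible. *)

theory Defs
  imports "HOL-Analysis.Analysis" "HOL-Algebra.Generated_Groups"
begin

section \<open>Lattices and fans\<close>

text \<open>
  The whole type \<open>'v\<close> plays the role of \<open>N\<^sub>\<real> = N \<otimes> \<real>\<close>, so that \<open>n = DIM('v)\<close>.
  A \<open>\<int>\<close>-basis of a full-rank lattice is the same as a set that is linearly independent over
  \<open>\<real>\<close> and whose integer span is the lattice.
\<close>

definition lattice_basis :: "'v::euclidean_space set \<Rightarrow> 'v set \<Rightarrow> bool" where
  "lattice_basis N B \<longleftrightarrow>
     independent B \<and> N = range (\<lambda>c :: 'v \<Rightarrow> int. \<Sum>b\<in>B. of_int (c b) *\<^sub>R b)"

definition full_lattice :: "'v::euclidean_space set \<Rightarrow> bool" where
  "full_lattice N \<longleftrightarrow> (\<exists>B. lattice_basis N B \<and> span B = UNIV)"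

definition strongly_convex_rational_cone :: "'v::euclidean_space set \<Rightarrow> 'v set \<Rightarrow> bool" where
  "strongly_convex_rational_cone N \<sigma> \<longleftrightarrow>
     (\<exists>S. finite S \<and> S \<subseteq> N \<and> \<sigma> = convex_cone hull S) \<and> \<sigma> \<inter> uminus ` \<sigma> = {0}"

text \<open>The library relation \<open>face_of\<close> also counts the empty set as a face, hence \<open>\<tau> \<noteq> {}\<close>.\<close>

definition fan :: "'v::euclidean_space set \<Rightarrow> 'v set set \<Rightarrow> bool" where
  "fan N \<Delta> \<longleftrightarrow>
     finite \<Delta> \<and> \<Delta> \<noteq> {} \<and>
     (\<forall>\<sigma>\<in>\<Delta>. strongly_convex_rational_cone N \<sigma>) \<and>
     (\<forall>\<sigma>\<in>\<Delta>. \<forall>\<tau>. \<tau> face_of \<sigma> \<and> \<tau> \<noteq> {} \<longrightarrow> \<tau> \<in> \<Delta>) \<and>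
     (\<forall>\<sigma>\<in>\<Delta>. \<forall>\<tau>\<in>\<Delta>. (\<sigma> \<inter> \<tau>) face_of \<sigma> \<and> (\<sigma> \<inter> \<tau>) face_of \<tau>)"

definition smooth_complete_fan :: "'v::euclidean_space set \<Rightarrow> 'v set set \<Rightarrow> bool" where
  "smooth_complete_fan N \<Delta> \<longleftrightarrow>
     fan N \<Delta> \<and>
     (\<forall>\<sigma>\<in>\<Delta>. \<exists>B S. lattice_basis N B \<and> S \<subseteq> B \<and> \<sigma> = convex_cone hull S) \<and>
     \<Union>\<Delta> = UNIV"

definition fan_edges :: "'v::euclidean_space set set \<Rightarrow> 'v set set" where
  "fan_edges \<Delta> = {\<rho> \<in> \<Delta>. dim \<rho> = 1}"

definition primitive_vector :: "'v::euclidean_space set \<Rightarrow> 'v \<Rightarrow> bool" where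
  "primitive_vector N v \<longleftrightarrow>
     v \<in> N \<and> v \<noteq> 0 \<and> (\<forall>w\<in>N. \<forall>k::nat. v = real k *\<^sub>R w \<longrightarrow> k = 1)"

section \<open>The coordinate subspace arrangement\<close>

text \<open>
  Below, \<open>v i\<close> is the primitive vector on the edge \<open>\<rho>\<^sub>i\<close>; a collection of edges is represented by
  its set \<open>P\<close> of indices, and the cone it generates is the cone generated by the vectors \<open>v i\<close>.
\<close>

definition generates_cone :: "'v::euclidean_space set set \<Rightarrow> ('d \<Rightarrow> 'v) \<Rightarrow> 'd set \<Rightarrow> bool" where
  "generates_cone \<Delta> v P \<longleftrightarrow> convex_cone hull (v ` P) \<in> \<Delta>"

definition primitive_collection :: "'v::euclidean_space set set \<Rightarrow> ('d \<Rightarrow> 'v) \<Rightarrow> 'd set \<Rightarrow> bool" where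
  "primitive_collection \<Delta> v P \<longleftrightarrow>
     \<not> generates_cone \<Delta> v P \<and> (\<forall>Q. Q \<subset> P \<longrightarrow> generates_cone \<Delta> v Q)"

definition coordinate_subspace :: "'d set \<Rightarrow> (real^'d) set" where
  "coordinate_subspace P = {x. \<forall>i\<in>P. x $ i = 0}"

definition arrangement :: "'v::euclidean_space set set \<Rightarrow> ('d \<Rightarrow> 'v) \<Rightarrow> (real^'d) set" where
  "arrangement \<Delta> v = (\<Union>P \<in> {P. primitive_collection \<Delta> v P}. coordinate_subspace P)"

definition arrangement_complement :: "'v::euclidean_space set set \<Rightarrow> ('d \<Rightarrow> 'v) \<Rightarrow> (real^'d) set" where
  "arrangement_complement \<Delta> v = - arrangement \<Delta> v"

section \<open>Group presentations and the right-angled Coxeter group\<close>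

text \<open>
  Words in the generators and their formal inverses: \<open>(a, True)\<close> stands for \<open>a\<close> and \<open>(a, False)\<close>
  for its inverse. The group presented by a set \<open>R\<close> of relators, with all elements of the type
  \<open>'a\<close> as generators, consists of the words modulo insertion and deletion of relators and of
  cancelling pairs.
\<close>

inductive word_equiv :: "('a \<times> bool) list set \<Rightarrow> ('a \<times> bool) list \<Rightarrow> ('a \<times> bool) list \<Rightarrow> bool"
  for R where
  refl: "word_equiv R x x"
| sym: "word_equiv R x y \<Longrightarrow> word_equiv R y x"
| trans: "word_equiv R x y \<Longrightarrow> word_equiv R y z \<Longrightarrow> word_equiv R x z"
| cancel: "word_equiv R (x @ [(a, e), (a, \<not> e)] @ y) (x @ y)"
| relator: "r \<in> R \<Longrightarrow> word_equiv R (x @ r @ y) (x @ y)"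

definition presented_group :: "('a \<times> bool) list set \<Rightarrow> ('a \<times> bool) list set monoid" where
  "presented_group R =
     \<lparr>carrier = UNIV // {(x, y). word_equiv R x y},
      mult = (\<lambda>A B. {z. \<exists>x\<in>A. \<exists>y\<in>B. word_equiv R (x @ y) z}),
      one = {z. word_equiv R [] z}\<rparr>"

definition coxeter_group_of_fan ::
    "'v::euclidean_space set set \<Rightarrow> ('d \<Rightarrow> 'v) \<Rightarrow> ('d \<times> bool) list set monoid" where
  "coxeter_group_of_fan \<Delta> v =
     (let s = (\<lambda>i. (i, True)) in
      presented_group
        ({[s j, s j] | j. True} \<union> {[s i, s j, s i, s j] | i j. generates_cone \<Delta> v {i, j}}))"

definition commutator_subgroup :: "'a monoid \<Rightarrow> 'a monoid" where
  "commutator_subgroup G = G\<lparr>carrier := derived G (carrier G)\<rparr>"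

section \<open>Fundamental group\<close>

definition loops_at :: "'a::topological_space set \<Rightarrow> 'a \<Rightarrow> (real \<Rightarrow> 'a) set" where
  "loops_at S a = {p. path p \<and> path_image p \<subseteq> S \<and> pathstart p = a \<and> pathfinish p = a}"

definition fundamental_group :: "'a::topological_space set \<Rightarrow> 'a \<Rightarrow> (real \<Rightarrow> 'a) set monoid" where
  "fundamental_group S a =
     \<lparr>carrier = loops_at S a // {(p, q). homotopic_paths S p q},
      mult = (\<lambda>A B. {r. \<exists>p\<in>A. \<exists>q\<in>B. homotopic_paths S (p +++ q) r}),
      one = {r. homotopic_paths S (\<lambda>_. a) r}\<rparr>"

section \<open>Universal covers and asphericity\<close>

text \<open>
  The next two definitions transfer \<open>simply_connected\<close> and \<open>covering_space\<close> from
  subsets of topological types to abstract topologies.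
\<close>

definition simply_connected_space :: "'a topology \<Rightarrow> bool" where
  "simply_connected_space X \<longleftrightarrow>
     (\<forall>p q. pathin X p \<and> p 1 = p 0 \<and> pathin X q \<and> q 1 = q 0
        \<longrightarrow> homotopic_with (\<lambda>r. r 1 = r 0) (top_of_set {0..1::real}) X p q)"

definition covering_map :: "'e topology \<Rightarrow> ('e \<Rightarrow> 'a) \<Rightarrow> 'a topology \<Rightarrow> bool" where
  "covering_map E p X \<longleftrightarrow>
     continuous_map E X p \<and> p ` topspace E = topspace X \<and>
     (\<forall>x \<in> topspace X. \<exists>T. x \<in> T \<and> openin X T \<and>
        (\<exists>\<V>. \<Union>\<V> = topspace E \<inter> p -` T \<and>
             (\<forall>U\<in>\<V>. openin E U) \<and>
             pairwise disjnt \<V> \<and>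
             (\<forall>U\<in>\<V>. homeomorphic_map (subtopology E U) (subtopology X T) p)))"

text \<open>
  HOL cannot quantify over the carrier type of the universal cover. The type of sets of paths in
  \<open>X\<close> is no restriction: the points of a universal cover of \<open>X\<close> correspond to the homotopy classes
  of paths in \<open>X\<close> issuing from a base point, so every universal cover of \<open>X\<close> is homeomorphic over
  \<open>X\<close> to one carried by this type.
\<close>

definition aspherical_space :: "'a topology \<Rightarrow> bool" where
  "aspherical_space X \<longleftrightarrow>
     connected_space X \<and>
     (\<exists>(E :: (real \<Rightarrow> 'a) set topology) p.
        covering_map E p X \<and> simply_connected_space E \<and> contractible_space E)"

text \<open>Agreement of the abstract notions with the library notions for subsets.\<close>

lemma simply_connected_space_top_of_set:
  "simply_connected_space (top_of_set S) \<longleftrightarrow> simply_connected S"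
  unfolding simply_connected_space_def simply_connected_def homotopic_loops_def
  by (auto simp: pathin_def path_def pathstart_def pathfinish_def path_image_def
        image_subset_iff Pi_iff)

lemma covering_map_top_of_set:
  "covering_map (top_of_set C) p (top_of_set S) \<longleftrightarrow> covering_space C p S"
proof -
  have hom: "homeomorphic_map (top_of_set U) (top_of_set T) p \<longleftrightarrow> (\<exists>q. homeomorphism U T p q)"
    for U T
  proof
    assume "homeomorphic_map (top_of_set U) (top_of_set T) p"
    then obtain q where "homeomorphic_maps (top_of_set U) (top_of_set T) p q"
      by (auto simp: homeomorphic_map_maps)
    then show "\<exists>q. homeomorphism U T p q"
      by (intro exI[of _ q] homeomorphismI) (auto simp: homeomorphic_maps_def)
  next
    assume "\<exists>q. homeomorphism U T p q"
    then show "homeomorphic_map (top_of_set U) (top_of_set T) p"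
      by (auto simp: homeomorphic_map_maps homeomorphic_maps_def homeomorphism_def)
  qed
  have sub: "subtopology (top_of_set C) U = top_of_set U" if "openin (top_of_set C) U" for U
    using openin_imp_subset[OF that] by (simp add: subtopology_subtopology Int_absorb1)
  have subS: "subtopology (top_of_set S) U = top_of_set U" if "openin (top_of_set S) U" for U
    using openin_imp_subset[OF that] by (simp add: subtopology_subtopology Int_absorb1)
  have inner: "(\<forall>U\<in>\<V>. openin (top_of_set C) U) \<and> pairwise disjnt \<V> \<and>
        (\<forall>U\<in>\<V>. homeomorphic_map (subtopology (top_of_set C) U) (subtopology (top_of_set S) T) p)
     \<longleftrightarrow> (\<forall>U\<in>\<V>. openin (top_of_set C) U) \<and> pairwise disjnt \<V> \<and>
        (\<forall>U\<in>\<V>. \<exists>q. homeomorphism U T p q)" if "openin (top_of_set S) T" for T \<V>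
    using sub subS[OF that] by (simp add: hom cong: conj_cong)
  show ?thesis
    unfolding covering_map_def covering_space_def
    using inner by (simp cong: conj_cong) (auto simp: image_subset_iff_funcset)
qed

lemma equiv_word_equiv: "equiv UNIV {(x, y). word_equiv R x y}"
proof (rule equivI)
  show "refl {(x, y). word_equiv R x y}"
    by (auto intro: reflI word_equiv.refl)
  show "sym {(x, y). word_equiv R x y}"
    by (auto intro: symI word_equiv.sym)
  show "trans {(x, y). word_equiv R x y}"
    by (auto intro: transI word_equiv.trans)
qed auto

lemma word_equiv_context: "word_equiv R x y \<Longrightarrow> word_equiv R (u @ x @ w) (u @ y @ w)"
proof (induction rule: word_equiv.induct)
  case (cancel x a e y)
  show ?case using word_equiv.cancel[of R "u @ x" a e "y @ w"] by simp
next
  case (relator r x y)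
  show ?case using word_equiv.relator[OF relator, of "u @ x" "y @ w"] by simp
qed (blast intro: word_equiv.intros)+

lemma word_equiv_append:
  assumes "word_equiv R x x'" "word_equiv R y y'"
  shows "word_equiv R (x @ y) (x' @ y')"
  using word_equiv_context[OF assms(1), of "[]" y] word_equiv_context[OF assms(2), of x' "[]"]
  by (auto intro: word_equiv.trans)

lemma word_equiv_inverse: "word_equiv R (rev (map (\<lambda>(a, e). (a, \<not> e)) x) @ x) []"
proof (induction x)
  case Nil
  show ?case by (simp add: word_equiv.refl)
next
  case (Cons l x)
  obtain a e where l: "l = (a, e)" by force
  let ?i = "rev (map (\<lambda>(a, e). (a, \<not> e)) x)"
  have "word_equiv R (?i @ [(a, \<not> e), (a, \<not> \<not> e)] @ x) (?i @ x)"
    by (rule word_equiv.cancel)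
  then show ?case using Cons l by (auto intro: word_equiv.trans)
qed

lemma group_presented_group: "group (presented_group R)"
proof -
  define cl where "cl x = {z. word_equiv R x z}" for x
  have carr: "carrier (presented_group R) = range cl"
    by (auto simp: presented_group_def quotient_def cl_def)
  have cl_eq: "cl x = cl y \<longleftrightarrow> word_equiv R x y" for x y
    unfolding cl_def by (auto intro: word_equiv.intros)
  have mult: "cl x \<otimes>\<^bsub>presented_group R\<^esub> cl y = cl (x @ y)" for x y
    unfolding presented_group_def cl_def
    by (auto intro: word_equiv.intros word_equiv_append)
  have one: "\<one>\<^bsub>presented_group R\<^esub> = cl []"
    by (simp add: presented_group_def cl_def)
  show ?thesis
  proof (rule groupI)
    fix A assume "A \<in> carrier (presented_group R)"
    then obtain x where "A = cl x" by (auto simp: carr)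
    then show "\<exists>B\<in>carrier (presented_group R). B \<otimes>\<^bsub>presented_group R\<^esub> A = \<one>\<^bsub>presented_group R\<^esub>"
      using word_equiv_inverse[of R x]
      by (intro bexI[of _ "cl (rev (map (\<lambda>(a, e). (a, \<not> e)) x))"])
         (simp_all only: carr mult one cl_eq rangeI)
  qed (auto simp: carr mult one)
qed

lemma group_fundamental_group:
  fixes a :: "'a::real_normed_vector"
  assumes "a \<in> S"
  shows "group (fundamental_group S a)"
proof -
  define cl where "cl p = {r. homotopic_paths S p r}" for p
  define G where "G = fundamental_group S a"
  have carr: "carrier G = cl ` loops_at S a"
    by (auto simp: G_def fundamental_group_def quotient_def cl_def)
  have cl_eq: "cl p = cl q \<longleftrightarrow> homotopic_paths S p q" if "p \<in> loops_at S a" for p q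
    using that unfolding cl_def loops_at_def
    by (auto intro: homotopic_paths_trans homotopic_paths_sym)
  have const: "(\<lambda>_. a) \<in> loops_at S a"
    using assms by (auto simp: loops_at_def path_def path_image_def pathstart_def pathfinish_def)
  have join: "p +++ q \<in> loops_at S a" if "p \<in> loops_at S a" "q \<in> loops_at S a" for p q
    using that by (auto simp: loops_at_def path_image_join)
  have mult: "cl p \<otimes>\<^bsub>G\<^esub> cl q = cl (p +++ q)"
    if "p \<in> loops_at S a" "q \<in> loops_at S a" for p q
  proof -
    have hom: "homotopic_paths S (p +++ q) (p' +++ q')"
      if "homotopic_paths S p p'" "homotopic_paths S q q'" for p' q'
      using that \<open>p \<in> _\<close> \<open>q \<in> _\<close> by (intro homotopic_paths_join) (auto simp: loops_at_def)
    have refl: "homotopic_paths S p p" "homotopic_paths S q q"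
      using that by (auto simp: loops_at_def)
    have "r \<in> cl p \<otimes>\<^bsub>G\<^esub> cl q \<longleftrightarrow> r \<in> cl (p +++ q)" for r
    proof
      assume "r \<in> cl p \<otimes>\<^bsub>G\<^esub> cl q"
      then obtain p' q' where *: "homotopic_paths S p p'" "homotopic_paths S q q'"
        "homotopic_paths S (p' +++ q') r"
        by (auto simp: G_def fundamental_group_def cl_def)
      show "r \<in> cl (p +++ q)"
        using homotopic_paths_trans[OF hom[OF *(1,2)] *(3)] by (simp add: cl_def)
    next
      assume "r \<in> cl (p +++ q)"
      then show "r \<in> cl p \<otimes>\<^bsub>G\<^esub> cl q"
        unfolding G_def fundamental_group_def cl_def monoid.simps mem_Collect_eq
        using refl by (intro bexI[of _ p] bexI[of _ q]) simp_all
    qed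
    then show ?thesis by blast
  qed
  have one: "\<one>\<^bsub>G\<^esub> = cl (\<lambda>_. a)"
    by (simp add: G_def fundamental_group_def cl_def)
  have const_eq: "(\<lambda>_. a) = linepath a a"
    by (simp add: linepath_refl)
  have lid: "homotopic_paths S ((\<lambda>_. a) +++ p) p" if "p \<in> loops_at S a" for p
    using that homotopic_paths_lid[of p S] by (auto simp: loops_at_def const_eq)
  have linv: "homotopic_paths S (reversepath p +++ p) (\<lambda>_. a)" if "p \<in> loops_at S a" for p
    using that homotopic_paths_linv[of p S] by (auto simp: loops_at_def const_eq)
  have rev: "reversepath p \<in> loops_at S a" if "p \<in> loops_at S a" for p
    using that by (auto simp: loops_at_def)
  have "group G"
  proof (rule groupI)
    fix A B assume "A \<in> carrier G" "B \<in> carrier G"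
    then show "A \<otimes>\<^bsub>G\<^esub> B \<in> carrier G" by (auto simp: carr mult join)
  next
    show "\<one>\<^bsub>G\<^esub> \<in> carrier G" using const by (auto simp: carr one)
  next
    fix A B C assume "A \<in> carrier G" "B \<in> carrier G" "C \<in> carrier G"
    then obtain p q r where *: "p \<in> loops_at S a" "q \<in> loops_at S a" "r \<in> loops_at S a"
      "A = cl p" "B = cl q" "C = cl r" by (auto simp: carr)
    have "homotopic_paths S ((p +++ q) +++ r) (p +++ (q +++ r))"
      using * by (intro homotopic_paths_sym[OF homotopic_paths_assoc]) (auto simp: loops_at_def)
    then show "A \<otimes>\<^bsub>G\<^esub> B \<otimes>\<^bsub>G\<^esub> C = A \<otimes>\<^bsub>G\<^esub> (B \<otimes>\<^bsub>G\<^esub> C)"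
      using * by (simp add: mult join cl_eq)
  next
    fix A assume "A \<in> carrier G"
    then obtain p where p: "p \<in> loops_at S a" "A = cl p" by (auto simp: carr)
    then show "\<one>\<^bsub>G\<^esub> \<otimes>\<^bsub>G\<^esub> A = A"
      using lid by (simp add: one mult const cl_eq join)
    show "\<exists>B\<in>carrier G. B \<otimes>\<^bsub>G\<^esub> A = \<one>\<^bsub>G\<^esub>"
      using p linv rev by (intro bexI[of _ "cl (reversepath p)"])
        (simp_all add: one mult cl_eq join, simp add: carr)
  qed
  then show ?thesis by (simp add: G_def)
qed

end

theory Submission
  imports Defs
begin

text \<open>
  The cones of the fan form a simplicial complex \<open>K\<close> on the set of edges, and \<open>\<C>\<^sub>\<Delta>\<close> consists
  of the points whose set of vanishing coordinates is a face of \<open>K\<close>. Let \<open>L \<supseteq> K\<close> be the flag complex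
  with the same edges as \<open>K\<close>, so that \<open>W\<close> depends only on \<open>L\<close>, and let \<open>C\<^sub>L \<supseteq> \<C>\<^sub>\<Delta>\<close> be its
  complement. Gluing copies of the chamber \<open>{x \<in> C\<^sub>L. x \<ge> 0}\<close>, one for each element of \<open>W\<close>, along
  their walls (Davis' construction) yields a covering space of \<open>C\<^sub>L\<close> with group
  \<open>ker (W \<rightarrow> (\<int>/2)\<^sup>d) = [W, W]\<close>. It is contractible: the descents of an element \<open>w\<close> of \<open>W\<close> are a
  clique, that is a face of \<open>L\<close>, so the chamber of \<open>w\<close> can be pushed onto its walls towards shorter
  elements.

  The set \<open>C\<^sub>L - \<C>\<^sub>\<Delta>\<close> is a union of coordinate subspaces of codimension at least three, so by
  general position a loop of \<open>\<C>\<^sub>\<Delta>\<close> that is null-homotopic in \<open>C\<^sub>L\<close> is so in \<open>\<C>\<^sub>\<Delta>\<close>; this gives the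
  fundamental group. If all minimal non-faces of \<open>K\<close> have two elements, then \<open>K = L\<close> and \<open>\<C>\<^sub>\<Delta>\<close> is
  aspherical. Otherwise a minimal non-face with \<open>k \<ge> 3\<close> elements gives a sphere of dimension \<open>k - 1\<close>
  that is a retract of \<open>\<C>\<^sub>\<Delta>\<close> up to homotopy. Being simply connected it lifts to every cover, so it
  would be null-homotopic if the universal cover were contractible.
\<close>

section \<open>Smooth fans as simplicial complexes\<close>

text \<open>Two data of \<open>W\<close> drive the proof: how often a letter occurs in a reduced
  word, and which letters can stand last. Parities of the counts give the map to (Z/2)^d, hence the
  orthant under a chamber and, as the kernel, the commutator subgroup; the descents give the
  contraction. The cover of \<open>\<C>\<^sub>\<Delta>\<close> itself is never shown to be simply
  connected: homotopies are taken in the contractible cover of \<open>C\<^sub>L\<close>, projected,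
  and only then moved off the subspaces. The bound three is one more than the dimension of a disc
  spanned by a loop. Asphericity speaks of an arbitrary abstract covering map. For existence, the
  cover is built in a normed space and transported; for non-existence, spheres have to be lifted
  through a covering map about which nothing else is known.\<close>

lemma convex_cone_hull_finite:
  assumes "finite S"
  shows "convex_cone hull S = {\<Sum>s\<in>S. c s *\<^sub>R s | c. \<forall>s\<in>S. 0 \<le> c s}" (is "_ = ?R")
proof
  show "convex_cone hull S \<subseteq> ?R"
  proof (rule hull_minimal)
    show "S \<subseteq> ?R"
    proof
      fix x assume "x \<in> S"
      then have "x = (\<Sum>s\<in>S. (if s = x then 1 else 0) *\<^sub>R s)"
        using assms by (simp add: if_distrib[of "\<lambda>c. c *\<^sub>R _"] cong: if_cong)
      then show "x \<in> ?R" by (intro CollectI exI[of _ "\<lambda>s. if s = x then 1 else 0"]) auto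
    qed
    have "0 \<in> ?R" by (intro CollectI exI[of _ "\<lambda>_. 0"]) auto
    moreover have "x + y \<in> ?R" if xy: "x \<in> ?R" "y \<in> ?R" for x y
    proof -
      obtain c c' where "x = (\<Sum>s\<in>S. c s *\<^sub>R s)" "\<forall>s\<in>S. 0 \<le> c s" "y = (\<Sum>s\<in>S. c' s *\<^sub>R s)" "\<forall>s\<in>S. 0 \<le> c' s"
        using xy by blast
      then show ?thesis by (intro CollectI exI[of _ "\<lambda>s. c s + c' s"]) (auto simp: scaleR_left_distrib sum.distrib)
    qed
    moreover have "a *\<^sub>R x \<in> ?R" if x: "x \<in> ?R" "0 \<le> a" for x a
    proof -
      obtain c where "x = (\<Sum>s\<in>S. c s *\<^sub>R s)" "\<forall>s\<in>S. 0 \<le> c s" using x by blast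
      then show ?thesis using x(2) by (intro CollectI exI[of _ "\<lambda>s. a * c s"]) (auto simp: scaleR_sum_right)
    qed
    ultimately show "convex_cone ?R" unfolding convex_cone_iff by blast
  qed
  have "(\<Sum>s\<in>T. c s *\<^sub>R s) \<in> convex_cone hull S" if "T \<subseteq> S" "\<forall>s\<in>T. 0 \<le> c s" for T c
    using finite_subset[OF that(1) assms] that
  proof (induction T rule: finite_induct)
    case empty
    then show ?case by (simp add: convex_cone_hull_contains_0)
  next
    case (insert x T)
    then have "c x *\<^sub>R x \<in> convex_cone hull S"
      by (intro convex_cone_hull_mul hull_inc) auto
    then show ?case using insert by (auto intro: convex_cone_hull_add)
  qed
  then show "?R \<subseteq> convex_cone hull S" by blast
qed

text \<open>Coefficients over the independent set \<open>S\<close> are unique. If a point strictly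
  between two points of the cone has no coefficient outside \<open>T\<close>, the two nonnegative
  contributions there add up to zero, so both vanish.\<close>

lemma face_of_simplicial_cone:
  assumes S: "independent S" "finite S" and T: "T \<subseteq> S"
  shows "convex_cone hull T face_of convex_cone hull S"
proof -
  have fT: "finite T" using S T finite_subset by blast
  have ab: "a \<in> convex_cone hull T"
    if a: "a = (\<Sum>s\<in>S. \<alpha> s *\<^sub>R s)" "\<forall>s\<in>S. 0 \<le> \<alpha> s" and b: "b = (\<Sum>s\<in>S. \<beta> s *\<^sub>R s)" "\<forall>s\<in>S. 0 \<le> \<beta> s"
      and x: "x = (\<Sum>s\<in>T. \<gamma> s *\<^sub>R s)" and xab: "x = (1 - u) *\<^sub>R a + u *\<^sub>R b" "0 < u" "u < 1"
    for a b x \<alpha> \<beta> \<gamma> u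
  proof -
    have x': "x = (\<Sum>s\<in>S. (if s \<in> T then \<gamma> s else 0) *\<^sub>R s)"
      unfolding x using S T by (intro sum.mono_neutral_cong_left) auto
    define e where "e s = (1 - u) * \<alpha> s + u * \<beta> s - (if s \<in> T then \<gamma> s else 0)" for s
    have "(\<Sum>s\<in>S. e s *\<^sub>R s) = 0"
      unfolding e_def using xab(1) unfolding x' a(1) b(1)
      by (simp add: algebra_simps sum.distrib sum_subtractf scaleR_sum_right)
    then have e0: "e s = 0" if "s \<in> S" for s
      using independentD[OF S(1,2) order_refl] that by blast
    have "(1 - u) * \<alpha> s + u * \<beta> s = 0" if "s \<in> S - T" for s
      using e0[of s] that by (simp add: e_def)
    then have "\<alpha> s = 0" if "s \<in> S - T" for s
      using that a(2) b(2) xab(2,3) add_nonneg_eq_0_iff[of "(1 - u) * \<alpha> s" "u * \<beta> s"] by force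
    then have "a = (\<Sum>s\<in>T. \<alpha> s *\<^sub>R s)"
      unfolding a(1) using S T by (intro sum.mono_neutral_right) auto
    then show ?thesis using a(2) T unfolding convex_cone_hull_finite[OF fT] by blast
  qed
  show ?thesis
    unfolding face_of_def
  proof (intro conjI ballI impI)
    show "convex_cone hull T \<subseteq> convex_cone hull S" using T by (rule hull_mono)
    show "convex (convex_cone hull T)" by (rule convex_convex_cone_hull)
    fix a b x assume a: "a \<in> convex_cone hull S" and b: "b \<in> convex_cone hull S"
      and x: "x \<in> convex_cone hull T" and xab: "x \<in> open_segment a b"
    obtain \<alpha> where \<alpha>: "a = (\<Sum>s\<in>S. \<alpha> s *\<^sub>R s)" "\<forall>s\<in>S. 0 \<le> \<alpha> s"
      using a unfolding convex_cone_hull_finite[OF S(2)] by blast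
    obtain \<beta> where \<beta>: "b = (\<Sum>s\<in>S. \<beta> s *\<^sub>R s)" "\<forall>s\<in>S. 0 \<le> \<beta> s"
      using b unfolding convex_cone_hull_finite[OF S(2)] by blast
    obtain \<gamma> where \<gamma>: "x = (\<Sum>s\<in>T. \<gamma> s *\<^sub>R s)"
      using x unfolding convex_cone_hull_finite[OF fT] by blast
    obtain u where u: "0 < u" "u < 1" "x = (1 - u) *\<^sub>R a + u *\<^sub>R b"
      using xab by (auto simp: in_segment)
    show "a \<in> convex_cone hull T" by (rule ab[OF \<alpha> \<beta> \<gamma> u(3,1,2)])
    show "b \<in> convex_cone hull T"
      by (rule ab[OF \<beta> \<alpha> \<gamma>, of "1 - u"]) (use u in auto)
  qed
qed

lemma smooth_cone:
  assumes "smooth_complete_fan N \<Delta>" "\<sigma> \<in> \<Delta>"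
  obtains S where "independent S" "finite S" "\<sigma> = convex_cone hull S"
proof -
  obtain B S where "lattice_basis N B" "S \<subseteq> B" "\<sigma> = convex_cone hull S"
    using assms unfolding smooth_complete_fan_def by blast
  then have "independent S" using independent_mono by (auto simp: lattice_basis_def)
  then show ?thesis using that finiteI_independent \<open>\<sigma> = _\<close> by blast
qed

lemma convex_cone_hull_singleton: "convex_cone hull {u} = {c *\<^sub>R u | c. 0 \<le> c}"
  unfolding convex_cone_hull_finite[OF finite.insertI[OF finite.emptyI]] by auto

text \<open>The generators of a smooth cone are independent, so dimension one leaves a single
  generator, and every nonzero point of the cone is a positive multiple of it.\<close>

lemma edge_eq_ray:
  assumes fan: "smooth_complete_fan N \<Delta>" and \<rho>: "\<rho> \<in> fan_edges \<Delta>" and u: "u \<in> \<rho>" "u \<noteq> 0"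
  shows "\<rho> = convex_cone hull {u}"
proof -
  have "\<rho> \<in> \<Delta>" "dim \<rho> = 1" using \<rho> by (auto simp: fan_edges_def)
  then obtain S where S: "independent S" "finite S" "\<rho> = convex_cone hull S"
    using smooth_cone[OF fan] by blast
  have "convex_cone hull S \<subseteq> span S"
    unfolding convex_cone_hull_finite[OF S(2)] by (auto intro!: span_sum intro: span_scale span_base)
  then have "dim \<rho> = card S"
    using S by (intro dim_unique[of S]) (auto simp: hull_subset)
  then obtain b where b: "S = {b}" using \<open>dim \<rho> = 1\<close> card_1_singletonE by metis
  then obtain c where c: "u = c *\<^sub>R b" "0 \<le> c" using u S convex_cone_hull_singleton[of b] by auto
  then have "c > 0" using u by (cases "c = 0") auto
  have "convex_cone hull {b} = convex_cone hull {u}"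
    unfolding convex_cone_hull_singleton
  proof (intro equalityI subsetI; clarify)
    fix k :: real assume "0 \<le> k"
    then show "\<exists>l. k *\<^sub>R b = l *\<^sub>R u \<and> 0 \<le> l"
      using c \<open>c > 0\<close> by (intro exI[of _ "k / c"]) auto
  next
    fix k :: real assume "0 \<le> k"
    then show "\<exists>l. k *\<^sub>R u = l *\<^sub>R b \<and> 0 \<le> l" using c \<open>c > 0\<close> by (intro exI[of _ "k * c"]) auto
  qed
  then show ?thesis using S b by simp
qed

text \<open>The ray is its own intersection with the larger cone and therefore, by the fan axioms, a
  face of it. Split \<open>u\<close> into one term of its expansion and the remaining terms: a face
  containing \<open>u\<close> contains that term, so one generator lies on the ray.\<close>

lemma edge_in_cone:
  assumes fan: "smooth_complete_fan N \<Delta>" and \<rho>: "convex_cone hull {u} \<in> \<Delta>" "u \<noteq> 0"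
    and \<sigma>: "convex_cone hull S \<in> \<Delta>" "independent S" "finite S" and u: "u \<in> convex_cone hull S"
  shows "\<exists>s\<in>S. \<exists>c>0. s = c *\<^sub>R u"
proof -
  let ?\<rho> = "convex_cone hull {u}" and ?\<sigma> = "convex_cone hull S"
  have "?\<rho> \<subseteq> ?\<sigma>" using u by (intro hull_minimal) (auto simp: convex_cone_convex_cone_hull)
  then have "?\<rho> \<inter> ?\<sigma> = ?\<rho>" by blast
  moreover have "(?\<rho> \<inter> ?\<sigma>) face_of ?\<sigma>"
    using fan \<rho>(1) \<sigma>(1) unfolding smooth_complete_fan_def fan_def by blast
  ultimately have face: "?\<rho> face_of ?\<sigma>" by simp
  obtain c where c: "u = (\<Sum>s\<in>S. c s *\<^sub>R s)" "\<forall>s\<in>S. 0 \<le> c s"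
    using u unfolding convex_cone_hull_finite[OF \<sigma>(3)] by blast
  have "\<exists>t\<in>S. c t \<noteq> 0"
  proof (rule ccontr)
    assume "\<not> ?thesis"
    then have "u = 0" unfolding c(1) by (intro sum.neutral) simp
    then show False using \<rho>(2) by simp
  qed
  then obtain t where t: "t \<in> S" "c t \<noteq> 0" by blast
  then have ct: "c t > 0" using c(2) by force
  have t0: "t \<noteq> 0" using t \<sigma>(2) dependent_zero by blast
  \<comment> \<open>The factor two makes \<open>u\<close> the midpoint of these two points of the
    cone, as the definition of a face requires.\<close>
  let ?a = "(2 * c t) *\<^sub>R t" and ?b = "\<Sum>s\<in>S. (2 * (if s = t then 0 else c s)) *\<^sub>R s"
  have "?a \<in> ?\<sigma>" using t ct by (intro convex_cone_hull_mul hull_inc) auto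
  moreover have "?b \<in> ?\<sigma>"
    unfolding convex_cone_hull_finite[OF \<sigma>(3)] using c(2)
    by (intro CollectI exI[of _ "\<lambda>s. 2 * (if s = t then 0 else c s)"] conjI refl) auto
  moreover have mid: "u = (1 / 2) *\<^sub>R ?a + (1 / 2) *\<^sub>R ?b"
  proof -
    have "u = c t *\<^sub>R t + (\<Sum>s\<in>S - {t}. c s *\<^sub>R s)" unfolding c(1) using t \<sigma>(3) by (simp add: sum.remove)
    also have "(\<Sum>s\<in>S - {t}. c s *\<^sub>R s) = (\<Sum>s\<in>S. (if s = t then 0 else c s) *\<^sub>R s)"
      using \<sigma>(3) t by (intro sum.mono_neutral_cong_left) auto
    finally show ?thesis by (simp add: scaleR_sum_right)
  qed
  moreover have u\<rho>: "u \<in> ?\<rho>" by (simp add: hull_inc)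
  ultimately have "?a \<in> ?\<rho>"
  proof (cases "?a = ?b")
    case True
    then have "u = ?a" using mid by (simp add: scaleR_left_distrib[symmetric])
    then show ?thesis using u\<rho> by simp
  next
    case False
    then have "u \<in> open_segment ?a ?b"
      unfolding in_segment using mid by (intro conjI exI[of _ "1 / 2"]) auto
    then show ?thesis using face_ofD[OF face] \<open>?a \<in> ?\<sigma>\<close> \<open>?b \<in> ?\<sigma>\<close> u\<rho> by blast
  qed
  then obtain k where k: "?a = k *\<^sub>R u" "0 \<le> k" unfolding convex_cone_hull_singleton by blast
  then have "k > 0" using t0 ct by (cases "k = 0") auto
  have "t = (k / (2 * c t)) *\<^sub>R u"
  proof -
    have "t = (1 / (2 * c t)) *\<^sub>R ?a" using ct by simp
    then show ?thesis unfolding k(1) by simp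
  qed
  then show ?thesis using t ct \<open>k > 0\<close> by (intro bexI[of _ t] exI[of _ "k / (2 * c t)"]) auto
qed

context
  fixes N :: "'v::euclidean_space set" and \<Delta> :: "'v set set"
    and \<rho> :: "'d::finite \<Rightarrow> 'v set" and v :: "'d \<Rightarrow> 'v"
  assumes fan: "smooth_complete_fan N \<Delta>"
    and edges: "bij_betw \<rho> UNIV (fan_edges \<Delta>)"
    and v: "\<And>i. v i \<in> \<rho> i" "\<And>i. primitive_vector N (v i)"
begin

lemma generates_cone_singleton: "generates_cone \<Delta> v {i}"
proof -
  have "\<rho> i \<in> fan_edges \<Delta>" using edges bij_betwE by blast
  then have "\<rho> i = convex_cone hull {v i}" "\<rho> i \<in> \<Delta>"
    using edge_eq_ray[OF fan _ v(1)] v(2)[of i] by (auto simp: primitive_vector_def fan_edges_def)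
  then show ?thesis by (simp add: generates_cone_def)
qed

text \<open>The vectors \<open>v i\<close> need not be the chosen generators \<open>S\<close> of the
  cone, but each spans an edge and so is a positive multiple of one of them
  (\<open>edge_in_cone\<close>). Hence \<open>Q\<close> generates the same cone as a subset of
  \<open>S\<close>, which is a face and belongs to the fan.\<close>

lemma generates_cone_subset:
  assumes "generates_cone \<Delta> v P" "Q \<subseteq> P"
  shows "generates_cone \<Delta> v Q"
proof -
  have \<sigma>: "convex_cone hull (v ` P) \<in> \<Delta>" using assms by (simp add: generates_cone_def)
  then obtain S where S: "independent S" "finite S" "convex_cone hull (v ` P) = convex_cone hull S"
    using smooth_cone[OF fan] by metis
  have "\<exists>s\<in>S. \<exists>c>0. s = c *\<^sub>R v i" if "i \<in> P" for i
  proof (rule edge_in_cone[OF fan _ _ _ S(1,2)])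
    show "convex_cone hull {v i} \<in> \<Delta>" using generates_cone_singleton[of i] by (simp add: generates_cone_def)
    show "v i \<noteq> 0" using v(2)[of i] by (simp add: primitive_vector_def)
    show "convex_cone hull S \<in> \<Delta>" using \<sigma> S by simp
    show "v i \<in> convex_cone hull S" unfolding S(3)[symmetric] using that by (intro hull_inc) auto
  qed
  then obtain f c where fc: "\<And>i. i \<in> P \<Longrightarrow> f i \<in> S" "\<And>i. i \<in> P \<Longrightarrow> c i > 0" "\<And>i. i \<in> P \<Longrightarrow> f i = c i *\<^sub>R v i"
    by metis
  have "convex_cone hull (v ` Q) = convex_cone hull (f ` Q)"
  proof (intro equalityI hull_minimal)
    have "v i = (1 / c i) *\<^sub>R f i" if "i \<in> Q" for i using fc that assms(2) by force
    moreover have "(1 / c i) *\<^sub>R f i \<in> convex_cone hull (f ` Q)" if "i \<in> Q" for i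
      using fc(2)[of i] that assms(2) by (intro convex_cone_hull_mul hull_inc) (auto simp: less_imp_le)
    ultimately show "v ` Q \<subseteq> convex_cone hull (f ` Q)" by force
    show "f ` Q \<subseteq> convex_cone hull (v ` Q)"
    proof
      fix x assume "x \<in> f ` Q"
      then obtain i where i: "i \<in> Q" "x = f i" by blast
      then have "x = c i *\<^sub>R v i" "0 \<le> c i" using fc assms(2) by (auto simp: less_imp_le)
      then show "x \<in> convex_cone hull (v ` Q)" using i by (auto intro: convex_cone_hull_mul hull_inc)
    qed
  qed (auto simp: convex_cone_convex_cone_hull)
  moreover have "f ` Q \<subseteq> S" using fc assms(2) by auto
  then have "convex_cone hull (f ` Q) face_of convex_cone hull S" by (rule face_of_simplicial_cone[OF S(1,2)])
  moreover have "convex_cone hull (f ` Q) \<noteq> {}" by (rule convex_cone_hull_nonempty)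
  ultimately have "convex_cone hull (v ` Q) \<in> \<Delta>"
    using fan \<sigma> S(3) unfolding smooth_complete_fan_def fan_def by metis
  then show ?thesis by (simp add: generates_cone_def)
qed

end

section \<open>Right-angled Coxeter groups\<close>

text \<open>An axiomatic stand-in for reduced words: \<open>cnt w i\<close> is the number of letters
  \<open>i\<close> in a reduced word of \<open>w\<close>, and \<open>des w\<close> is the set of
  letters that can stand last in one. The presented group is shown to satisfy the axioms in
  \<open>coxeter_presentation\<close>.\<close>

locale racg = group G for G (structure) +
  fixes s :: "'d::finite \<Rightarrow> 'a"
    and adj :: "'d \<Rightarrow> 'd \<Rightarrow> bool"
    and cnt :: "'a \<Rightarrow> 'd \<Rightarrow> nat"
    and des :: "'a \<Rightarrow> 'd set"
  assumes s_closed [simp, intro]: "s i \<in> carrier G"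
    and s_sq: "s i \<otimes> s i = \<one>"
    and adj_sym: "adj i j \<Longrightarrow> adj j i"
    and cnt_one [simp]: "cnt \<one> i = 0"
    and cnt_des: "w \<in> carrier G \<Longrightarrow> i \<in> des w \<Longrightarrow>
                    cnt w j = cnt (w \<otimes> s i) j + (if i = j then 1 else 0)"
    and des_flip: "w \<in> carrier G \<Longrightarrow> i \<in> des (w \<otimes> s i) \<longleftrightarrow> i \<notin> des w"
    and des_comm: "w \<in> carrier G \<Longrightarrow> adj i j \<Longrightarrow> i \<noteq> j \<Longrightarrow> j \<in> des (w \<otimes> s i) \<longleftrightarrow> j \<in> des w"
    and des_clique: "w \<in> carrier G \<Longrightarrow> i \<in> des w \<Longrightarrow> j \<in> des w \<Longrightarrow> i \<noteq> j \<Longrightarrow> adj i j"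
    and des_nonempty: "w \<in> carrier G \<Longrightarrow> w \<noteq> \<one> \<Longrightarrow> des w \<noteq> {}"
begin

definition len :: "'a \<Rightarrow> nat" where
  "len w = (\<Sum>i\<in>UNIV. cnt w i)"

definition clique :: "'d set \<Rightarrow> bool" where
  "clique \<sigma> \<longleftrightarrow> (\<forall>i\<in>\<sigma>. \<forall>j\<in>\<sigma>. i \<noteq> j \<longrightarrow> adj i j)"

text \<open>For a clique \<open>\<sigma>\<close> this is the subgroup generated by the \<open>s i\<close> with \<open>i \<in> \<sigma>\<close>.\<close>
definition par :: "'d set \<Rightarrow> 'a set" where
  "par \<sigma> = {h \<in> carrier G. \<forall>i. i \<notin> \<sigma> \<longrightarrow> cnt h i = 0}"

text \<open>The component at \<open>i\<close> of the homomorphism to (Z/2)^d, written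
  multiplicatively; these signs pick the orthant onto which the chamber of \<open>w\<close>
  projects.\<close>

definition sg :: "'a \<Rightarrow> 'd \<Rightarrow> real" where
  "sg w i = (- 1) ^ cnt w i"

lemma s_s [simp]: "w \<in> carrier G \<Longrightarrow> w \<otimes> s i \<otimes> s i = w"
  by (simp add: m_assoc s_sq)

lemma inv_s [simp]: "inv (s i) = s i"
  by (simp add: inv_equality s_sq)

lemma cnt_nondes:
  assumes "w \<in> carrier G" "i \<notin> des w"
  shows "cnt (w \<otimes> s i) j = cnt w j + (if i = j then 1 else 0)"
  using cnt_des[of "w \<otimes> s i" i j] des_flip[of w i] assms by simp

lemma len_des: "w \<in> carrier G \<Longrightarrow> i \<in> des w \<Longrightarrow> len w = Suc (len (w \<otimes> s i))"
  unfolding len_def by (simp add: cnt_des[of w i] sum.distrib)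

lemma len_nondes: "w \<in> carrier G \<Longrightarrow> i \<notin> des w \<Longrightarrow> len (w \<otimes> s i) = Suc (len w)"
  using len_des[of "w \<otimes> s i" i] des_flip[of w i] by simp

lemma len_mult_s: "w \<in> carrier G \<Longrightarrow> len (w \<otimes> s i) \<le> Suc (len w)"
  using len_des[of w i] len_nondes[of w i] by (cases "i \<in> des w") auto

lemma len_one [simp]: "len \<one> = 0"
  by (simp add: len_def)

lemma len_pos: "w \<in> carrier G \<Longrightarrow> w \<noteq> \<one> \<Longrightarrow> 0 < len w"
  using des_nonempty len_des by fastforce

lemma cnt_other: "w \<in> carrier G \<Longrightarrow> i \<noteq> j \<Longrightarrow> cnt (w \<otimes> s i) j = cnt w j"
  using cnt_des[of w i j] cnt_nondes[of w i j] by (cases "i \<in> des w") auto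

lemma even_cnt_same: "w \<in> carrier G \<Longrightarrow> even (cnt (w \<otimes> s i) i) \<longleftrightarrow> odd (cnt w i)"
  using cnt_des[of w i i] cnt_nondes[of w i i] by (cases "i \<in> des w") auto

lemma des_cnt: "w \<in> carrier G \<Longrightarrow> i \<in> des w \<Longrightarrow> cnt w i > 0"
  using cnt_des[of w i i] by simp

lemma des_one: "des \<one> = {}"
  using des_cnt[of \<one>] by auto

text \<open>Replaces induction along a reduced word: an element other than the unit has a descent,
  and removing it shortens the element.\<close>

lemma len_induct [consumes 1, case_names one step]:
  assumes "w \<in> carrier G" "P \<one>"
    and "\<And>w i. w \<in> carrier G \<Longrightarrow> i \<notin> des w \<Longrightarrow> P w \<Longrightarrow> P (w \<otimes> s i)"
  shows "P w"
  using assms(1)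
proof (induction "len w" arbitrary: w rule: less_induct)
  case less
  show ?case
  proof (cases "w = \<one>")
    case True
    then show ?thesis using assms(2) by simp
  next
    case False
    then obtain i where i: "i \<in> des w" using des_nonempty less.prems by blast
    have "P (w \<otimes> s i)"
      using less.hyps[of "w \<otimes> s i"] len_des[OF less.prems i] less.prems by simp
    moreover have "i \<notin> des (w \<otimes> s i)" using des_flip[of w i] less.prems i by simp
    ultimately have "P (w \<otimes> s i \<otimes> s i)" using assms(3)[of "w \<otimes> s i" i] less.prems by blast
    then show ?thesis using less.prems by simp
  qed
qed

text \<open>Counts are not additive, because letters cancel in a product, but they cancel in equal
  pairs.\<close>

lemma even_cnt_mult:
  assumes "u \<in> carrier G" "w \<in> carrier G"
  shows "even (cnt (u \<otimes> w) i) \<longleftrightarrow> (even (cnt u i) \<longleftrightarrow> even (cnt w i))"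
  using assms(2)
proof (induction rule: len_induct)
  case one
  then show ?case using assms by simp
next
  case (step w j)
  have "u \<otimes> (w \<otimes> s j) = u \<otimes> w \<otimes> s j" using step assms by (simp add: m_assoc)
  then show ?case
    using step assms even_cnt_same[of "u \<otimes> w" j] even_cnt_same[of w j] cnt_other[of "u \<otimes> w" j i] cnt_other[of w j i]
    by (cases "i = j") auto
qed

lemma sg_mult: "u \<in> carrier G \<Longrightarrow> w \<in> carrier G \<Longrightarrow> sg (u \<otimes> w) i = sg u i * sg w i"
  using even_cnt_mult[of u w i] by (auto simp: sg_def minus_one_power_iff)

lemma sg_cases: "sg w i = 1 \<or> sg w i = - 1"
  by (simp add: sg_def minus_one_power_iff)

lemma sg_sq [simp]: "sg w i * sg w i = 1"
  using sg_cases[of w i] by auto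

lemma sg_one [simp]: "sg \<one> i = 1"
  by (simp add: sg_def)

lemma sg_inv: "w \<in> carrier G \<Longrightarrow> sg (inv w) i = sg w i"
  using sg_mult[of "inv w" w i] sg_cases[of w i] sg_cases[of "inv w" i] by auto

lemma len_mult:
  assumes "u \<in> carrier G" "w \<in> carrier G"
  shows "len (u \<otimes> w) \<le> len u + len w"
  using assms(2)
proof (induction rule: len_induct)
  case one
  then show ?case using assms by simp
next
  case (step w j)
  have "u \<otimes> (w \<otimes> s j) = u \<otimes> w \<otimes> s j" using step assms by (simp add: m_assoc)
  then show ?case using step assms len_mult_s[of "u \<otimes> w" j] len_nondes[of w j] by simp
qed

text \<open>Appending a letter changes only its own count, by one. The bound does not depend on
  \<open>u\<close>, which is what later makes \<open>position\<close> a bounded function.\<close>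

lemma cnt_mult_bound:
  assumes "u \<in> carrier G" "w \<in> carrier G"
  shows "\<bar>real (cnt (u \<otimes> w) i) - real (cnt u i)\<bar> \<le> cnt w i"
  using assms(2)
proof (induction rule: len_induct)
  case one
  then show ?case using assms by simp
next
  case (step w j)
  have "u \<otimes> (w \<otimes> s j) = u \<otimes> w \<otimes> s j" using step assms by (simp add: m_assoc)
  then show ?case
    using step assms cnt_nondes[of w j i] cnt_des[of "u \<otimes> w" j i] cnt_nondes[of "u \<otimes> w" j i]
    by (cases "j \<in> des (u \<otimes> w)") auto
qed

lemma par_subset: "par \<sigma> \<subseteq> carrier G"
  by (auto simp: par_def)

lemma par_mono: "\<sigma> \<subseteq> \<tau> \<Longrightarrow> par \<sigma> \<subseteq> par \<tau>"
  by (auto simp: par_def)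

lemma one_in_par [simp]: "\<one> \<in> par \<sigma>"
  by (simp add: par_def)

lemma par_induct [consumes 1, case_names one step]:
  assumes "h \<in> par \<sigma>" "P \<one>"
    and "\<And>h i. h \<in> par \<sigma> \<Longrightarrow> i \<in> \<sigma> \<Longrightarrow> i \<notin> des h \<Longrightarrow> P h \<Longrightarrow> P (h \<otimes> s i)"
  shows "P h"
proof -
  have "h \<in> carrier G" using assms(1) by (simp add: par_def)
  then have "h \<in> par \<sigma> \<longrightarrow> P h"
  proof (induction rule: len_induct)
    case one
    then show ?case using assms by simp
  next
    case (step w i)
    show ?case
    proof
      assume *: "w \<otimes> s i \<in> par \<sigma>"
      have "i \<in> \<sigma>"
        using * cnt_nondes[OF step(1,2), of i] by (auto simp: par_def)
      moreover have "w \<in> par \<sigma>"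
        using * cnt_nondes[OF step(1,2)] step(1) by (auto simp: par_def)
      ultimately show "P (w \<otimes> s i)" using step assms(3) by blast
    qed
  qed
  then show ?thesis using assms by blast
qed

lemma cnt_mult_par:
  assumes "w \<in> carrier G" "h \<in> par \<sigma>" "i \<notin> \<sigma>"
  shows "cnt (w \<otimes> h) i = cnt w i"
  using assms(2)
proof (induction rule: par_induct)
  case one
  then show ?case using assms by simp
next
  case (step h j)
  have "h \<in> carrier G" using step by (simp add: par_def)
  then have "w \<otimes> (h \<otimes> s j) = w \<otimes> h \<otimes> s j" using assms by (simp add: m_assoc)
  then show ?case
    using step assms cnt_other[of "w \<otimes> h" j i] \<open>h \<in> carrier G\<close> by auto
qed

lemma par_mult: "g \<in> par \<sigma> \<Longrightarrow> h \<in> par \<sigma> \<Longrightarrow> g \<otimes> h \<in> par \<sigma>"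
  using cnt_mult_par by (auto simp: par_def)

lemma par_inv:
  assumes "h \<in> par \<sigma>" shows "inv h \<in> par \<sigma>"
proof -
  have h: "h \<in> carrier G" using assms by (simp add: par_def)
  have "cnt (inv h) i = 0" if "i \<notin> \<sigma>" for i
    using cnt_mult_par[of "inv h" h \<sigma> i] that assms h by simp
  then show ?thesis using h by (simp add: par_def)
qed

lemma s_in_par: "i \<in> \<sigma> \<Longrightarrow> s i \<in> par \<sigma>"
  using cnt_other[of \<one> i] by (fastforce simp: par_def)

text \<open>Commuting involutions need no repetition: along a reduced word of an element of
  \<open>par \<sigma>\<close> every new letter is a non-descent and so has not occurred yet. In
  effect \<open>par \<sigma>\<close> is the group (Z/2)^\<sigma>.\<close>

lemma par_clique:
  assumes "h \<in> par \<sigma>" "clique \<sigma>"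
  shows "cnt h i \<le> 1 \<and> (i \<in> des h \<longleftrightarrow> cnt h i = 1)"
  using assms(1)
proof (induction arbitrary: i rule: par_induct)
  case one
  then show ?case by (simp add: des_one)
next
  case (step h j)
  have h: "h \<in> carrier G" using step by (simp add: par_def)
  consider "i = j" | "i \<noteq> j" "i \<in> \<sigma>" | "i \<noteq> j" "i \<notin> \<sigma>" by blast
  then show ?case
  proof cases
    case 1
    have "cnt h j = 0" using step.IH[of j] \<open>j \<notin> des h\<close> by linarith
    then show ?thesis
      using cnt_nondes[OF h \<open>j \<notin> des h\<close>, of j] des_flip[OF h, of j] \<open>j \<notin> des h\<close> 1 by simp
  next
    case 2
    then have "adj j i" using assms step(2) by (auto simp: clique_def)
    then show ?thesis
      using step.IH[of i] cnt_other[OF h, of j i] des_comm[OF h, of j i] 2(1) by metis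
  next
    case 3
    have "cnt (h \<otimes> s j) i = 0"
      using 3(2) par_mult[OF step(1) s_in_par[OF step(2)]] by (simp add: par_def)
    then show ?thesis using des_cnt[of "h \<otimes> s j" i] h by auto
  qed
qed

text \<open>The signs are faithful on the finite group \<open>par \<sigma>\<close>. Conjugates of
  such groups are the point stabilisers on the cover, so this is what makes the commutator subgroup
  act freely.\<close>

lemma par_even_one:
  assumes "h \<in> par \<sigma>" "clique \<sigma>" "\<And>i. even (cnt h i)"
  shows "h = \<one>"
proof (rule ccontr)
  assume "h \<noteq> \<one>"
  then obtain i where "i \<in> des h" using des_nonempty assms(1) by (auto simp: par_def)
  then have "cnt h i = 1" using par_clique[OF assms(1,2)] by blast
  then show False using assms(3)[of i] by simp
qed

lemma par_exists:
  assumes "\<tau> \<subseteq> \<sigma>"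
  obtains h where "h \<in> par \<sigma>" "\<And>i. cnt h i = (if i \<in> \<tau> then 1 else 0)"
proof -
  have "finite \<tau>" by simp
  then have "\<exists>h\<in>par \<tau>. \<forall>i. cnt h i = (if i \<in> \<tau> then 1 else 0)"
  proof (induction \<tau>)
    case empty
    then show ?case by (intro bexI[of _ \<one>]) auto
  next
    case (insert j \<tau>)
    then obtain h where h: "h \<in> par \<tau>" "\<forall>i. cnt h i = (if i \<in> \<tau> then 1 else 0)" by blast
    have c: "h \<in> carrier G" using h by (simp add: par_def)
    have "j \<notin> des h" using h insert des_cnt[OF c, of j] by auto
    then have *: "cnt (h \<otimes> s j) i = (if i \<in> insert j \<tau> then 1 else 0)" for i
      using h(2) cnt_nondes[OF c, of j i] insert(2) by auto
    then have "h \<otimes> s j \<in> par (insert j \<tau>)" using c by (simp add: par_def)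
    then show ?case using * by blast
  qed
  then show ?thesis using that par_mono[OF assms] by blast
qed

text \<open>An element without descents in \<sigma> is the shortest in its coset of
  \<open>par \<sigma>\<close>; this will single out the shortest chamber at a point of the
  cover.\<close>

lemma len_mult_par:
  assumes "w \<in> carrier G" "h \<in> par \<sigma>" "clique \<sigma>" "des w \<inter> \<sigma> = {}"
  shows "len (w \<otimes> h) = len w + len h"
proof -
  \<comment> \<open>The length formula alone is not inductive: to append the next letter one must
    know that the descents of the product inside \<sigma> are those of \<open>h\<close>.\<close>
  have "len (w \<otimes> h) = len w + len h \<and> des (w \<otimes> h) \<inter> \<sigma> = des h"
    using assms(2)
  proof (induction rule: par_induct)
    case one
    then show ?case using assms by (simp add: des_one)
  next
    case (step h j)
    have h: "h \<in> carrier G" using step by (simp add: par_def)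
    have eq: "w \<otimes> (h \<otimes> s j) = w \<otimes> h \<otimes> s j" using h assms by (simp add: m_assoc)
    have wh: "w \<otimes> h \<in> carrier G" using h assms by simp
    have hj: "h \<otimes> s j \<in> par \<sigma>" using par_mult[OF step(1) s_in_par[OF step(2)]] .
    have "j \<notin> des (w \<otimes> h)" using step by auto
    then have 1: "len (w \<otimes> (h \<otimes> s j)) = len w + len (h \<otimes> s j)"
      using step len_nondes[OF wh, of j] len_nondes[OF h, of j] eq by auto
    have "i \<in> des (w \<otimes> h \<otimes> s j) \<inter> \<sigma> \<longleftrightarrow> i \<in> des (h \<otimes> s j)" for i
    proof (cases "i \<in> \<sigma>")
      case False
      then have "cnt (h \<otimes> s j) i = 0" using hj by (simp add: par_def)
      then show ?thesis using False des_cnt[of "h \<otimes> s j" i] h by auto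
    next
      case True
      show ?thesis
      proof (cases "i = j")
        case True
        then show ?thesis using des_flip[OF wh, of j] des_flip[OF h, of j] step by auto
      next
        case False
        then have "adj j i" using assms step True by (auto simp: clique_def)
        then show ?thesis using des_comm[OF wh, of j i] des_comm[OF h, of j i] False True step by auto
      qed
    qed
    then show ?case using 1 eq by auto
  qed
  then show ?thesis by blast
qed

lemma finite_len_le: "finite {w \<in> carrier G. len w \<le> k}"
proof (induction k)
  case 0
  have "{w \<in> carrier G. len w \<le> 0} \<subseteq> {\<one>}" using len_pos by force
  then show ?case using finite_subset by blast
next
  case (Suc k)
  have "{w \<in> carrier G. len w \<le> Suc k} \<subseteq>
      insert \<one> (\<Union>i. (\<lambda>w. w \<otimes> s i) ` {w \<in> carrier G. len w \<le> k})"
  proof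
    fix w assume "w \<in> {w \<in> carrier G. len w \<le> Suc k}"
    then have w: "w \<in> carrier G" "len w \<le> Suc k" by auto
    show "w \<in> insert \<one> (\<Union>i. (\<lambda>w. w \<otimes> s i) ` {w \<in> carrier G. len w \<le> k})"
    proof (cases "w = \<one>")
      case False
      then obtain i where i: "i \<in> des w" using des_nonempty w by blast
      have "w = (w \<otimes> s i) \<otimes> s i" using w by simp
      moreover have "len (w \<otimes> s i) \<le> k" using len_des[OF w(1) i] w by simp
      ultimately show ?thesis using w by blast
    qed simp
  qed
  then show ?case using Suc by (auto intro: finite_subset)
qed

text \<open>Locates an occurrence of \<open>i\<close> in a reduced word; it supplies the second copy
  of a letter in \<open>derived_iff\<close>.\<close>

lemma cnt_split:
  assumes "w \<in> carrier G" "cnt w i > 0"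
  shows "\<exists>a\<in>carrier G. \<exists>b\<in>carrier G. w = a \<otimes> s i \<otimes> b \<and> Suc (len a + len b) \<le> len w"
  using assms
proof (induction rule: len_induct)
  case one
  then show ?case by simp
next
  case (step w j)
  show ?case
  proof (cases "i = j")
    case True
    then show ?thesis using step len_nondes[of w j] by (intro bexI[of _ w] bexI[of _ \<one>]) auto
  next
    case False
    then have "cnt w i > 0" using step cnt_other[of w j i] by simp
    then obtain a b where ab: "a \<in> carrier G" "b \<in> carrier G" "w = a \<otimes> s i \<otimes> b"
      "Suc (len a + len b) \<le> len w" using step by blast
    show ?thesis
      using ab len_mult_s[of b j] len_nondes[of w j] step(1,2)
      by (intro bexI[of _ a] bexI[of _ "b \<otimes> s j"]) (auto simp: m_assoc)
  qed
qed

lemma even_cnt_inv: "w \<in> carrier G \<Longrightarrow> even (cnt (inv w) i) \<longleftrightarrow> even (cnt w i)"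
  using even_cnt_mult[of "inv w" w i] by simp

text \<open>Commutators have even counts. Conversely, a nontrivial even element ends in a letter
  that occurs once more; moving the last copy next to the earlier one cancels both at the cost of a
  commutator and leaves a shorter even element.\<close>

lemma derived_iff:
  "w \<in> derived G (carrier G) \<longleftrightarrow> w \<in> carrier G \<and> (\<forall>i. even (cnt w i))"
proof
  have *: "h \<in> carrier G \<and> (\<forall>i. even (cnt h i))"
    if "h \<in> (\<Union>h1\<in>carrier G. \<Union>h2\<in>carrier G. {h1 \<otimes> h2 \<otimes> inv h1 \<otimes> inv h2})" for h
    using that by (auto simp: even_cnt_mult even_cnt_inv)
  assume "w \<in> derived G (carrier G)"
  then show "w \<in> carrier G \<and> (\<forall>i. even (cnt w i))"
    unfolding derived_def
  proof (induction rule: generate.induct)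
    case one
    then show ?case by simp
  next
    case (incl h)
    then show ?case by (rule *)
  next
    case (inv h)
    then show ?case using *[OF inv] by (simp add: even_cnt_inv)
  next
    case (eng h1 h2)
    then show ?case by (auto simp: even_cnt_mult)
  qed
next
  assume "w \<in> carrier G \<and> (\<forall>i. even (cnt w i))"
  then show "w \<in> derived G (carrier G)"
  proof (induction "len w" arbitrary: w rule: less_induct)
    case less
    then have w: "w \<in> carrier G" "\<And>i. even (cnt w i)" by auto
    interpret D: subgroup "derived G (carrier G)" G
      by (rule derived_is_subgroup) simp
    show ?case
    proof (cases "w = \<one>")
      case False
      then obtain i where i: "i \<in> des w" using des_nonempty w by blast
      define u where "u = w \<otimes> s i"
      have u: "u \<in> carrier G" "w = u \<otimes> s i" using w by (auto simp: u_def)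
      have "odd (cnt u i)" using even_cnt_same[OF w(1), of i] w(2)[of i] by (auto simp: u_def)
      then have "cnt u i > 0" by (cases "cnt u i") auto
      then obtain a b where ab: "a \<in> carrier G" "b \<in> carrier G" "u = a \<otimes> s i \<otimes> b"
        "Suc (len a + len b) \<le> len u" using cnt_split u by blast
      \<comment> \<open>With \<open>s = s i\<close> one has
        \<open>w = a s b s = (a b) (inv b s b s)\<close>; the inverses are written out to match the
        generators of the derived subgroup.\<close>
      define c where "c = inv b \<otimes> s i \<otimes> inv (inv b) \<otimes> inv (s i)"
      have c: "c \<in> derived G (carrier G)"
        unfolding derived_def c_def using ab by (intro generate.incl) (rule UN_I[of "inv b"], simp, rule UN_I[of "s i"], simp_all del: inv_s inv_inv)
      have bb: "b \<otimes> (inv b \<otimes> x) = x" if "x \<in> carrier G" for x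
        using ab that by (simp add: m_assoc[symmetric])
      then have eq: "w = (a \<otimes> b) \<otimes> c"
        unfolding u(2) ab(3) c_def using ab(1,2) by (simp add: m_assoc bb)
      have cC: "c \<in> carrier G" using ab(1,2) by (simp add: c_def)
      have "len (a \<otimes> b) < len w"
        using len_mult[OF ab(1,2)] ab(4) len_des[OF w(1) i] by (simp add: u_def)
      moreover have "even (cnt (a \<otimes> b) j)" for j
      proof -
        have "even (cnt c j)" using ab(1,2) by (auto simp: c_def even_cnt_mult even_cnt_inv)
        moreover have "even (cnt (a \<otimes> b \<otimes> c) j)" using w(2)[of j] eq by simp
        ultimately show ?thesis using even_cnt_mult[of "a \<otimes> b" c j] ab(1,2) cC by simp
      qed
      ultimately have "a \<otimes> b \<in> derived G (carrier G)" using less.hyps[of "a \<otimes> b"] ab(1,2) by simp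
      then show ?thesis using c D.m_closed eq by simp
    qed (use D.one_closed in simp)
  qed
qed

end

text \<open>
  A reduced word is recorded by the family of its subwords on the sets of pairwise non-commuting
  letters (the last letter comes first); this determines the word up to commutations, and a letter
  can be cancelled at the end of the word iff it heads every subword in which it may occur.
\<close>

definition nc_sets :: "('d \<Rightarrow> 'd \<Rightarrow> bool) \<Rightarrow> 'd set set" where
  "nc_sets adj = {A. \<forall>a\<in>A. \<forall>b\<in>A. a \<noteq> b \<longrightarrow> \<not> adj a b}"

definition heads :: "('d \<Rightarrow> 'd \<Rightarrow> bool) \<Rightarrow> 'd \<Rightarrow> ('d set \<Rightarrow> 'd list) \<Rightarrow> bool" where
  "heads adj i F \<longleftrightarrow> (\<forall>A\<in>nc_sets adj. i \<in> A \<longrightarrow> F A \<noteq> [] \<and> hd (F A) = i)"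

definition push :: "('d \<Rightarrow> 'd \<Rightarrow> bool) \<Rightarrow> 'd \<Rightarrow> ('d set \<Rightarrow> 'd list) \<Rightarrow> 'd set \<Rightarrow> 'd list" where
  "push adj i F A = (if i \<in> A \<and> A \<in> nc_sets adj then i # F A else F A)"

definition pop :: "('d \<Rightarrow> 'd \<Rightarrow> bool) \<Rightarrow> 'd \<Rightarrow> ('d set \<Rightarrow> 'd list) \<Rightarrow> 'd set \<Rightarrow> 'd list" where
  "pop adj i F A = (if i \<in> A \<and> A \<in> nc_sets adj then tl (F A) else F A)"

text \<open>Right multiplication by the letter \<open>i\<close> on recorded words: cancel it if it
  can stand last, append it otherwise.\<close>

definition act :: "('d \<Rightarrow> 'd \<Rightarrow> bool) \<Rightarrow> 'd \<Rightarrow> ('d set \<Rightarrow> 'd list) \<Rightarrow> 'd set \<Rightarrow> 'd list" where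
  "act adj i F = (if heads adj i F then pop adj i F else push adj i F)"

lemma pop_push [simp]: "pop adj i (push adj i F) = F"
  by (auto simp: pop_def push_def)

lemma heads_push [simp]: "heads adj i (push adj i F)"
  by (auto simp: heads_def push_def)

lemma nc_sets_disjoint: "adj i j \<Longrightarrow> i \<noteq> j \<Longrightarrow> A \<in> nc_sets adj \<Longrightarrow> j \<in> A \<Longrightarrow> i \<notin> A"
  unfolding nc_sets_def by blast

lemma singleton_nc_sets [simp]: "{i} \<in> nc_sets adj"
  by (simp add: nc_sets_def)

lemma heads_push_comm:
  assumes "adj i j" "i \<noteq> j" shows "heads adj j (push adj i F) \<longleftrightarrow> heads adj j F"
  unfolding heads_def push_def using nc_sets_disjoint[of adj i j, OF assms] by simp

lemma heads_pop_comm: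
  assumes "adj i j" "i \<noteq> j" shows "heads adj j (pop adj i F) \<longleftrightarrow> heads adj j F"
  unfolding heads_def pop_def using nc_sets_disjoint[of adj i j, OF assms] by simp

lemma heads_act_comm: "adj i j \<Longrightarrow> i \<noteq> j \<Longrightarrow> heads adj j (act adj i F) \<longleftrightarrow> heads adj j F"
  by (simp add: act_def heads_push_comm heads_pop_comm)

text \<open>Two letters that do not commute form a set in \<open>nc_sets\<close>, and its one
  subword cannot begin with both.\<close>

lemma heads_clique:
  assumes "\<And>i j. adj i j \<Longrightarrow> adj j i" "heads adj i F" "heads adj j F" "i \<noteq> j"
  shows "adj i j"
proof (rule ccontr)
  assume "\<not> adj i j"
  then have "{i, j} \<in> nc_sets adj" unfolding nc_sets_def using assms(1) by blast
  then show False using assms(2-4) by (auto simp: heads_def)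
qed

lemma push_comm:
  assumes "adj i j" "i \<noteq> j" shows "push adj i (push adj j F) = push adj j (push adj i F)"
  using nc_sets_disjoint[of adj i j, OF assms] by (intro ext) (auto simp: push_def)

text \<open>No set of pairwise non-commuting letters contains both \<open>i\<close> and
  \<open>j\<close> when they differ, so the two operations change different subwords and leave each
  other's heading condition alone.\<close>

lemma act_comm:
  assumes "adj i j" "adj j i"
  shows "act adj i (act adj j F) = act adj j (act adj i F)"
proof (cases "i = j")
  case False
  have "\<not> (i \<in> A \<and> j \<in> A \<and> A \<in> nc_sets adj)" for A
    using nc_sets_disjoint[of adj i j, OF assms(1) False] by blast
  then show ?thesis
    unfolding act_def[of adj i "act adj j F"] act_def[of adj j "act adj i F"]
    using heads_act_comm[of adj i j F] heads_act_comm[of adj j i F] assms False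
    by (intro ext) (auto simp: act_def pop_def push_def)
qed simp

section \<open>The group of the Coxeter presentation and its action on families of subwords\<close>

locale coxeter_presentation =
  fixes adj :: "'d::finite \<Rightarrow> 'd \<Rightarrow> bool"
  assumes adj_sym: "adj i j \<Longrightarrow> adj j i"
begin

definition rels :: "('d \<times> bool) list set" where
  "rels = {[(j, True), (j, True)] | j. True} \<union>
          {[(i, True), (j, True), (i, True), (j, True)] | i j. adj i j}"

abbreviation W :: "('d \<times> bool) list set monoid" where
  "W \<equiv> presented_group rels"

definition cl :: "('d \<times> bool) list \<Rightarrow> ('d \<times> bool) list set" where
  "cl x = {z. word_equiv rels x z}"

definition gen :: "'d \<Rightarrow> ('d \<times> bool) list set" where
  "gen i = cl [(i, True)]"

lemma carrier_W: "carrier W = range cl"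
  by (auto simp: presented_group_def quotient_def cl_def)

lemma cl_eq: "cl x = cl y \<longleftrightarrow> word_equiv rels x y"
  unfolding cl_def by (auto intro: word_equiv.intros)

lemma mult_cl: "cl x \<otimes>\<^bsub>W\<^esub> cl y = cl (x @ y)"
  unfolding presented_group_def cl_def
  by (auto intro: word_equiv.intros word_equiv_append)

lemma one_W: "\<one>\<^bsub>W\<^esub> = cl []"
  by (simp add: presented_group_def cl_def)

sublocale grp: group W by (rule group_presented_group)

lemma gen_closed [simp]: "gen i \<in> carrier W"
  by (simp add: gen_def carrier_W)

lemma gen_sq: "gen i \<otimes>\<^bsub>W\<^esub> gen i = \<one>\<^bsub>W\<^esub>"
  using word_equiv.relator[of "[(i, True), (i, True)]" rels "[]" "[]"]
  by (simp add: gen_def mult_cl one_W cl_eq) (simp add: rels_def)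

lemma gen_gen [simp]: "w \<in> carrier W \<Longrightarrow> w \<otimes>\<^bsub>W\<^esub> gen i \<otimes>\<^bsub>W\<^esub> gen i = w"
  by (simp add: grp.m_assoc gen_sq)

lemma gen_comm:
  assumes "adj i j" shows "gen i \<otimes>\<^bsub>W\<^esub> gen j = gen j \<otimes>\<^bsub>W\<^esub> gen i"
proof -
  have "gen i \<otimes>\<^bsub>W\<^esub> gen j \<otimes>\<^bsub>W\<^esub> gen i \<otimes>\<^bsub>W\<^esub> gen j = \<one>\<^bsub>W\<^esub>"
    using word_equiv.relator[of "[(i, True), (j, True), (i, True), (j, True)]" rels "[]" "[]"] assms
    by (simp add: gen_def mult_cl one_W cl_eq) (auto simp: rels_def)
  then have "gen i \<otimes>\<^bsub>W\<^esub> gen j \<otimes>\<^bsub>W\<^esub> gen i \<otimes>\<^bsub>W\<^esub> gen j \<otimes>\<^bsub>W\<^esub> gen j \<otimes>\<^bsub>W\<^esub> gen i = gen j \<otimes>\<^bsub>W\<^esub> gen i"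
    by simp
  then show ?thesis by simp
qed

text \<open>A generator is its own inverse, so the exponent \<open>e\<close> of a letter makes no
  difference.\<close>

lemma cl_snoc: "cl (x @ [(i, e)]) = cl x \<otimes>\<^bsub>W\<^esub> gen i"
proof -
  have "word_equiv rels ([] @ [(i, False), (i, \<not> False)] @ []) ([] @ [])"
    by (rule word_equiv.cancel)
  then have "cl [(i, False)] \<otimes>\<^bsub>W\<^esub> gen i = \<one>\<^bsub>W\<^esub>"
    by (simp add: gen_def mult_cl one_W cl_eq)
  then have "cl [(i, False)] = gen i"
    using gen_gen[of "cl [(i, False)]" i] grp.l_one[OF gen_closed] by (simp add: carrier_W)
  then show ?thesis by (cases e) (simp_all add: gen_def mult_cl[symmetric])
qed

text \<open>Families that come from reduced words, paired with the element spelled. On arbitrary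
  families \<open>act adj i\<close> need not be an involution, since a family may still be headed by
  \<open>i\<close> after a \<open>pop\<close>; on these it is.\<close>

inductive st :: "('d \<times> bool) list set \<Rightarrow> ('d set \<Rightarrow> 'd list) \<Rightarrow> bool" where
  st_one: "st \<one>\<^bsub>W\<^esub> (\<lambda>_. [])"
| st_push: "st w F \<Longrightarrow> \<not> heads adj i F \<Longrightarrow> st (w \<otimes>\<^bsub>W\<^esub> gen i) (push adj i F)"

lemma st_cases: "st w F \<Longrightarrow> w = \<one>\<^bsub>W\<^esub> \<or> (\<exists>i E. F = push adj i E)"
  by (erule st.cases) blast+

lemma st_carrier: "st w F \<Longrightarrow> w \<in> carrier W"
  by (induction rule: st.induct) auto

lemma not_heads_Nil: "\<not> heads adj i (\<lambda>_. [])"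
  unfolding heads_def using singleton_nc_sets[of i adj] by blast

text \<open>If the last letter \<open>j\<close> differs from the heading letter \<open>i\<close>,
  both head the family and hence commute, so by induction \<open>i\<close> can be moved past
  \<open>j\<close> to the end of the reduced word.\<close>

lemma st_pop:
  assumes "st w F" "heads adj i F"
  shows "\<exists>u E. st u E \<and> \<not> heads adj i E \<and> F = push adj i E \<and> w = u \<otimes>\<^bsub>W\<^esub> gen i"
  using assms
proof (induction rule: st.induct)
  case st_one
  then show ?case using not_heads_Nil by blast
next
  case (st_push w F j)
  show ?case
  proof (cases "i = j")
    case True
    then show ?thesis using st_push by blast
  next
    case False
    have ij: "adj i j" using heads_clique[of adj i "push adj j F" j, OF adj_sym] False st_push(4) by simp
    then have ji: "adj j i" by (rule adj_sym)
    have "heads adj i F" using st_push heads_push_comm[of adj j i F] ji False by auto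
    then obtain u E where E: "st u E" "\<not> heads adj i E" "F = push adj i E" "w = u \<otimes>\<^bsub>W\<^esub> gen i"
      using st_push by blast
    have "\<not> heads adj j E" using E st_push heads_push_comm[of adj i j E] ij False by auto
    then have "st (u \<otimes>\<^bsub>W\<^esub> gen j) (push adj j E)" using E st.st_push by blast
    moreover have "\<not> heads adj i (push adj j E)" using E heads_push_comm[of adj j i E] ji False by auto
    moreover have "push adj j F = push adj i (push adj j E)"
      using push_comm[of adj i j E] ij False E by simp
    moreover have "w \<otimes>\<^bsub>W\<^esub> gen j = u \<otimes>\<^bsub>W\<^esub> gen j \<otimes>\<^bsub>W\<^esub> gen i"
      using E st_carrier[OF E(1)] gen_comm[OF ij] by (simp add: grp.m_assoc)
    ultimately show ?thesis by blast
  qed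
qed

lemma st_act:
  assumes "st w F"
  shows "st (w \<otimes>\<^bsub>W\<^esub> gen i) (act adj i F)"
proof (cases "heads adj i F")
  case True
  then obtain u E where E: "st u E" "F = push adj i E" "w = u \<otimes>\<^bsub>W\<^esub> gen i"
    using st_pop assms by blast
  then show ?thesis using True st_carrier[OF E(1)] by (simp add: act_def)
next
  case False
  then show ?thesis using assms by (simp add: act_def st_push)
qed

lemma act_act: "st w F \<Longrightarrow> act adj i (act adj i F) = F"
  using st_pop[of w F i] by (cases "heads adj i F") (auto simp: act_def)

lemma heads_act: "st w F \<Longrightarrow> heads adj i (act adj i F) \<longleftrightarrow> \<not> heads adj i F"
  using st_pop[of w F i] by (cases "heads adj i F") (auto simp: act_def)

definition run :: "('d \<times> bool) list \<Rightarrow> ('d set \<Rightarrow> 'd list) \<Rightarrow> 'd set \<Rightarrow> 'd list" where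
  "run x F = fold (\<lambda>l. act adj (fst l)) x F"

lemma run_simps [simp]: "run [] F = F" "run (l # x) F = run x (act adj (fst l) F)"
  "run (x @ y) F = run y (run x F)"
  by (simp_all add: run_def)

lemma st_run: "st w F \<Longrightarrow> st (w \<otimes>\<^bsub>W\<^esub> cl x) (run x F)"
proof (induction x rule: rev_induct)
  case Nil
  then show ?case using st_carrier one_W[symmetric] by simp
next
  case (snoc l x)
  then show ?case using st_act[of "w \<otimes>\<^bsub>W\<^esub> cl x" "run x F" "fst l"] st_carrier[of w F]
      grp.m_assoc[of w "cl x" "gen (fst l)"] gen_closed[of "fst l"]
    by (cases l) (simp add: cl_snoc carrier_W)
qed

text \<open>The defining relations hold for the action, so the family reached depends only on the
  group element. This makes \<open>state\<close>, and with it counts and descents, well defined on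
  the presented group.\<close>

lemma run_equiv: "word_equiv rels x y \<Longrightarrow> st w F \<Longrightarrow> run x F = run y F"
proof (induction arbitrary: w F rule: word_equiv.induct)
  case (cancel x a e y)
  then show ?case using act_act[OF st_run] by simp
next
  case (relator r x y)
  note st = st_run[OF relator(2), of x]
  from relator(1) consider j where "r = [(j, True), (j, True)]"
    | i j where "adj i j" "r = [(i, True), (j, True), (i, True), (j, True)]"
    by (auto simp: rels_def)
  then have "run r (run x F) = run x F"
  proof cases
    case 1
    then show ?thesis using act_act[OF st] by simp
  next
    case 2
    let ?E = "run x F"
    have "act adj j (act adj i ?E) = act adj i (act adj j ?E)"
      by (rule act_comm[where adj = adj, OF adj_sym[OF 2(1)] 2(1)])
    then have "run r ?E = act adj j (act adj i (act adj i (act adj j ?E)))"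
      by (simp add: 2(2))
    then show ?thesis using act_act[OF st] act_act[OF st_act[OF st]] by simp
  qed
  then show ?case by simp
next
  case (sym x y)
  show ?case using sym.IH[OF sym.prems] by simp
next
  case (trans x y z)
  show ?case using trans.IH(1)[OF trans.prems] trans.IH(2)[OF trans.prems] by simp
qed simp

definition state :: "('d \<times> bool) list set \<Rightarrow> 'd set \<Rightarrow> 'd list" where
  "state w = run (SOME x. w = cl x) (\<lambda>_. [])"

lemma state_cl: "state (cl x) = run x (\<lambda>_. [])"
proof -
  have "cl x = cl (SOME y. cl x = cl y)" by (rule someI) simp
  then show ?thesis unfolding state_def using run_equiv[OF _ st_one] by (metis cl_eq)
qed

lemma st_state: "w \<in> carrier W \<Longrightarrow> st w (state w)"
  using st_run[OF st_one] grp.l_one by (auto simp: carrier_W state_cl)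

lemma state_gen: "w \<in> carrier W \<Longrightarrow> state (w \<otimes>\<^bsub>W\<^esub> gen i) = act adj i (state w)"
  by (auto simp: carrier_W state_cl cl_snoc[symmetric, of _ i True])

text \<open>A singleton is a set of pairwise non-commuting letters; its subword consists of the
  occurrences of \<open>i\<close>.\<close>

definition letter_count :: "('d \<times> bool) list set \<Rightarrow> 'd \<Rightarrow> nat" where
  "letter_count w i = length (state w {i})"

definition descents :: "('d \<times> bool) list set \<Rightarrow> 'd set" where
  "descents w = {i. heads adj i (state w)}"

lemma racg: "racg W gen adj letter_count descents"
proof unfold_locales
  fix w :: "('d \<times> bool) list set" and i j assume w: "w \<in> carrier W"
  note st = st_state[OF w]
  { assume "i \<in> descents w"
    then obtain E where "state w = push adj i E"
      using st_pop[OF st, of i] by (auto simp: descents_def)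
    then show "letter_count w j = letter_count (w \<otimes>\<^bsub>W\<^esub> gen i) j + (if i = j then 1 else 0)"
      using w by (auto simp: letter_count_def state_gen act_def push_def descents_def) }
  { show "i \<in> descents (w \<otimes>\<^bsub>W\<^esub> gen i) \<longleftrightarrow> i \<notin> descents w"
      using heads_act[OF st] w by (simp add: descents_def state_gen) }
  { assume "adj i j" "i \<noteq> j"
    then show "j \<in> descents (w \<otimes>\<^bsub>W\<^esub> gen i) \<longleftrightarrow> j \<in> descents w"
      using heads_act_comm[of adj i j "state w"] w by (simp add: descents_def state_gen) }
  { assume "i \<in> descents w" "j \<in> descents w" "i \<noteq> j"
    then show "adj i j"
      by (intro heads_clique[of adj i "state w" j, OF adj_sym]) (simp_all add: descents_def) }
  { assume ne: "w \<noteq> \<one>\<^bsub>W\<^esub>"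
    have "\<exists>k. k \<in> descents w"
      using st_cases[OF st] ne heads_push unfolding descents_def by (metis mem_Collect_eq)
    then show "descents w \<noteq> {}" by blast }
next
  fix i show "letter_count \<one>\<^bsub>W\<^esub> i = 0" by (simp add: letter_count_def one_W state_cl)
next
  fix i j assume "adj i j"
  then show "adj j i" by (rule adj_sym)
qed (rule gen_closed, rule gen_sq)

lemma countable_W: "countable (carrier W)"
  by (simp add: carrier_W)

end

section \<open>The universal cover\<close>

type_synonym 'd pos = "(real^'d) \<times> (nat \<Rightarrow>\<^sub>C (real^'d))"

definition zeros :: "real^'d \<Rightarrow> 'd set" where
  "zeros y = {i. y $ i = 0}"

text \<open>In a closed orthant the two contributions to a coordinate of a convex combination have
  the same sign, so a coordinate vanishes in between only if it vanishes at every endpoint of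
  positive weight. Zero sets thus shrink, and \<open>K\<close> is closed under subsets.\<close>

lemma convex_orthant_downclosed:
  assumes K: "\<And>P Q. K P \<Longrightarrow> Q \<subseteq> P \<Longrightarrow> K Q" and c: "\<And>i. c i \<noteq> 0"
  shows "convex {y :: real^'d. K (zeros y) \<and> (\<forall>i. 0 \<le> c i * y $ i)}" (is "convex ?C")
proof (rule convexI)
  fix x y and u v :: real
  assume *: "x \<in> ?C" "y \<in> ?C" "0 \<le> u" "0 \<le> v" "u + v = 1"
  let ?z = "u *\<^sub>R x + v *\<^sub>R y"
  have nn: "0 \<le> c i * x $ i" "0 \<le> c i * y $ i" for i
    using * by auto
  have eq: "c i * ?z $ i = u * (c i * x $ i) + v * (c i * y $ i)" for i
    by (simp add: algebra_simps)
  have "zeros ?z \<subseteq> zeros x \<or> zeros ?z \<subseteq> zeros y"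
  proof (cases "u = 0")
    case True
    then show ?thesis using * by simp
  next
    case False
    have "x $ i = 0" if "?z $ i = 0" for i
    proof -
      have "u * (c i * x $ i) + v * (c i * y $ i) = 0" using eq[of i] that by simp
      then have "u * (c i * x $ i) = 0" using nn[of i] *(3,4) by (simp add: add_nonneg_eq_0_iff)
      then show ?thesis using False c by simp
    qed
    then show ?thesis by (auto simp: zeros_def)
  qed
  then have "K (zeros ?z)" using * K by blast
  then show "?z \<in> ?C" using eq nn *(3,4) by simp
qed

lemma continuous_on_pasting_closed:
  fixes g :: "'a::topological_space \<Rightarrow> 'b::topological_space"
  assumes "finite I" "S \<subseteq> \<Union>(T ` I)"
    and "\<And>i. i \<in> I \<Longrightarrow> closedin (top_of_set S) (T i)"
    and "\<And>i. i \<in> I \<Longrightarrow> continuous_on (T i) (f i)"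
    and "\<And>i x. i \<in> I \<Longrightarrow> x \<in> T i \<Longrightarrow> g x = f i x"
  shows "continuous_on S g"
proof -
  have "continuous_map (top_of_set S) euclidean g"
  proof (rule pasting_lemma_closed[OF assms(1,3)])
    fix i assume i: "i \<in> I"
    then have "T i \<subseteq> S" using assms(3) closedin_imp_subset by blast
    then show "continuous_map (subtopology (top_of_set S) (T i)) euclidean (f i)"
      using assms(4)[OF i] by (simp add: subtopology_subtopology Int_absorb1)
  next
    fix i j x assume "i \<in> I" "j \<in> I" "x \<in> topspace (top_of_set S) \<inter> T i \<inter> T j"
    then show "f i x = f j x" using assms(5)[of i x] assms(5)[of j x] by simp
  next
    fix x assume "x \<in> topspace (top_of_set S)"
    then obtain j where "j \<in> I" "x \<in> T j" using assms(2) by auto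
    then show "\<exists>j. j \<in> I \<and> x \<in> T j \<and> g x = f j x" using assms(5) by blast
  qed
  then show ?thesis by simp
qed

lemma continuous_apply_bcontfun:
  "continuous_on S (\<lambda>f :: 'a::topological_space \<Rightarrow>\<^sub>C 'b::metric_space. apply_bcontfun f x)"
proof (rule lipschitz_on_continuous_on)
  show "1-lipschitz_on S (\<lambda>f :: 'a \<Rightarrow>\<^sub>C 'b. apply_bcontfun f x)"
    by (auto intro!: lipschitz_onI dist_bounded)
qed

section \<open>Davis' construction as a subset of a normed space\<close>

locale countable_racg = racg G s adj cnt des
  for G :: "('w, 'm) monoid_scheme" (structure) and s :: "'d::finite \<Rightarrow> 'w"
    and adj :: "'d \<Rightarrow> 'd \<Rightarrow> bool" and cnt des +
  assumes countable_carrier: "countable (carrier G)"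
begin

definition en :: "nat \<Rightarrow> 'w" where
  "en = from_nat_into (carrier G)"

definition flag_complement :: "(real^'d) set" where
  "flag_complement = {y. clique (zeros y)}"

text \<open>Depends on \<open>w\<close> only through its signs: elements with equal signs have the
  same chamber, and only \<open>lift\<close> tells the copies apart.\<close>

definition chamber :: "'w \<Rightarrow> (real^'d) set" where
  "chamber w = {y \<in> flag_complement. \<forall>i. sg w i * y $ i \<ge> 0}"

text \<open>
  To realise the cover inside a normed space, as the library results on covering spaces require, a
  point is recorded together with its position relative to all group elements \<open>u\<close>: the number \<open>cnt (inv u \<otimes> w) i\<close> counts the walls of
  type \<open>i\<close> between \<open>u\<close> and \<open>w\<close>; subtracting the constant \<open>cnt (inv u) i\<close> makes it bounded in \<open>u\<close>.
\<close>
definition position :: "'w \<Rightarrow> real^'d \<Rightarrow> (nat \<Rightarrow>\<^sub>C (real^'d))" where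
  "position w y = Bcontfun (\<lambda>k. \<chi> i. \<bar>y $ i\<bar> * (real (cnt (inv (en k) \<otimes> w) i) - real (cnt (inv (en k)) i)))"

definition lift :: "'w \<Rightarrow> real^'d \<Rightarrow> 'd pos" where
  "lift w y = (y, position w y)"

definition cover :: "'d pos set" where
  "cover = (\<Union>w\<in>carrier G. lift w ` chamber w)"

lemma en_closed [simp]: "en k \<in> carrier G"
  unfolding en_def by (rule from_nat_into) auto

lemma en_surj: "w \<in> carrier G \<Longrightarrow> \<exists>k. en k = w"
  unfolding en_def using from_nat_into_surj[OF countable_carrier] by blast

lemma position_bound:
  assumes "w \<in> carrier G"
  shows "norm (\<chi> i. \<bar>y $ i\<bar> * (real (cnt (inv (en k) \<otimes> w) i) - real (cnt (inv (en k)) i)) :: real^'d)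
          \<le> (\<Sum>i\<in>UNIV. \<bar>y $ i\<bar> * real (cnt w i))"
proof -
  have "norm (\<chi> i. \<bar>y $ i\<bar> * (real (cnt (inv (en k) \<otimes> w) i) - real (cnt (inv (en k)) i)) :: real^'d)
      \<le> (\<Sum>i\<in>UNIV. \<bar>\<bar>y $ i\<bar> * (real (cnt (inv (en k) \<otimes> w) i) - real (cnt (inv (en k)) i))\<bar>)"
    using norm_le_l1_cart[of "\<chi> i. \<bar>y $ i\<bar> * (real (cnt (inv (en k) \<otimes> w) i) - real (cnt (inv (en k)) i))"] by simp
  also have "\<dots> \<le> (\<Sum>i\<in>UNIV. \<bar>y $ i\<bar> * real (cnt w i))"
    using cnt_mult_bound[of "inv (en k)" w] assms by (intro sum_mono) (auto simp: abs_mult intro!: mult_left_mono)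
  finally show ?thesis .
qed

lemma position_apply:
  assumes "w \<in> carrier G"
  shows "apply_bcontfun (position w y) k $ i = \<bar>y $ i\<bar> * (real (cnt (inv (en k) \<otimes> w) i) - real (cnt (inv (en k)) i))"
proof -
  have "(\<lambda>k. \<chi> i. \<bar>y $ i\<bar> * (real (cnt (inv (en k) \<otimes> w) i) - real (cnt (inv (en k)) i))) \<in> bcontfun"
    unfolding bcontfun_def using position_bound[OF assms, of y]
    by (auto simp: bounded_iff intro!: continuous_on_discrete exI[of _ "\<Sum>i\<in>UNIV. \<bar>y $ i\<bar> * real (cnt w i)"])
  then show ?thesis by (simp add: position_def Bcontfun_inverse)
qed

lemma continuous_position:
  assumes "w \<in> carrier G"
  shows "continuous_on S (position w)"
proof (rule lipschitz_on_continuous_on)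
  show "(real (len w))-lipschitz_on S (position w)"
  proof (rule lipschitz_onI)
    fix y z :: "real^'d"
    show "dist (position w y) (position w z) \<le> real (len w) * dist y z"
    proof (rule dist_bound)
      fix k
      have "norm (apply_bcontfun (position w y) k - apply_bcontfun (position w z) k)
          \<le> (\<Sum>i\<in>UNIV. \<bar>(\<bar>y $ i\<bar> - \<bar>z $ i\<bar>) * (real (cnt (inv (en k) \<otimes> w) i) - real (cnt (inv (en k)) i))\<bar>)"
        using norm_le_l1_cart[of "apply_bcontfun (position w y) k - apply_bcontfun (position w z) k"]
        by (simp add: position_apply assms algebra_simps)
      also have "\<dots> \<le> (\<Sum>i\<in>UNIV. dist y z * real (cnt w i))"
      proof (intro sum_mono)
        fix i
        have "\<bar>\<bar>y $ i\<bar> - \<bar>z $ i\<bar>\<bar> \<le> \<bar>(y - z) $ i\<bar>" by (simp add: abs_triangle_ineq3)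
        also have "\<dots> \<le> dist y z" unfolding dist_norm by (rule component_le_norm_cart)
        finally show "\<bar>(\<bar>y $ i\<bar> - \<bar>z $ i\<bar>) * (real (cnt (inv (en k) \<otimes> w) i) - real (cnt (inv (en k)) i))\<bar>
            \<le> dist y z * real (cnt w i)"
          using cnt_mult_bound[of "inv (en k)" w i] assms by (auto simp: abs_mult intro!: mult_mono)
      qed
      also have "\<dots> = real (len w) * dist y z"
        by (simp add: len_def sum_distrib_left mult.commute)
      finally show "dist (apply_bcontfun (position w y) k) (apply_bcontfun (position w z) k) \<le> real (len w) * dist y z"
        by (simp add: dist_norm)
    qed
  qed simp
qed

lemma continuous_lift: "w \<in> carrier G \<Longrightarrow> continuous_on S (lift w)"
  unfolding lift_def by (intro continuous_intros continuous_position)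

lemma fst_lift [simp]: "fst (lift w y) = y"
  by (simp add: lift_def)

text \<open>This is Davis' gluing relation: two copies of a point are identified when their labels
  differ by reflections in walls through it. Evaluating both positions at an index of
  \<open>w\<close> isolates \<open>cnt (inv w \<otimes> w') i\<close>.\<close>

lemma lift_eq:
  assumes "w \<in> carrier G" "w' \<in> carrier G"
  shows "lift w y = lift w' y' \<longleftrightarrow> y = y' \<and> inv w \<otimes> w' \<in> par (zeros y)"
proof
  assume eq: "lift w y = lift w' y'"
  obtain k where k: "en k = w" using en_surj assms by blast
  have "cnt (inv w \<otimes> w') i = 0" if "y $ i \<noteq> 0" for i
  proof -
    have "apply_bcontfun (position w y) k $ i = apply_bcontfun (position w' y) k $ i"
      using eq by (auto simp: lift_def)
    then have "\<bar>y $ i\<bar> * real (cnt (inv w \<otimes> w') i) = 0"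
      using assms by (simp add: position_apply k algebra_simps)
    then show ?thesis using that by simp
  qed
  then show "y = y' \<and> inv w \<otimes> w' \<in> par (zeros y)"
    using eq assms by (auto simp: lift_def par_def zeros_def)
next
  assume *: "y = y' \<and> inv w \<otimes> w' \<in> par (zeros y)"
  have "apply_bcontfun (position w y) k $ i = apply_bcontfun (position w' y) k $ i" for k i
  proof (cases "y $ i = 0")
    case False
    have "w' = w \<otimes> (inv w \<otimes> w')" using assms by (simp add: m_assoc[symmetric])
    then have "cnt (inv (en k) \<otimes> w') i = cnt (inv (en k) \<otimes> w \<otimes> (inv w \<otimes> w')) i"
      using assms by (simp add: m_assoc)
    also have "\<dots> = cnt (inv (en k) \<otimes> w) i"
      using * False assms by (intro cnt_mult_par[of _ _ "zeros y"]) (auto simp: zeros_def)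
    finally show ?thesis using assms by (simp add: position_apply)
  qed (use assms in \<open>simp add: position_apply\<close>)
  then have "apply_bcontfun (position w y) k = apply_bcontfun (position w' y) k" for k
    unfolding vec_eq_iff by blast
  then have "position w y = position w' y" by (rule bcontfun_eqI)
  then show "lift w y = lift w' y'"
    using * by (simp add: lift_def)
qed

definition patch :: "'w \<Rightarrow> 'd set \<Rightarrow> (real^'d) set" where
  "patch w \<sigma> = {y. \<forall>i. i \<notin> \<sigma> \<longrightarrow> sg w i * y $ i > 0}"

text \<open>For a point lifted to the chamber of \<open>w'\<close> the inequality reads
  \<open>\<bar>y $ i\<bar> * cnt (inv w \<otimes> w') i < \<bar>y $ i\<bar>\<close>. It forces the
  count to be zero and yet, being strict, is an open condition. \<open>SOME\<close> picks an index
  of \<open>w\<close>.\<close>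

definition sheet :: "'w \<Rightarrow> 'd set \<Rightarrow> 'd pos set" where
  "sheet w \<sigma> = {e \<in> cover. fst e \<in> patch w \<sigma> \<and>
     (\<forall>i. i \<notin> \<sigma> \<longrightarrow> apply_bcontfun (snd e) (SOME k. en k = w) $ i + \<bar>fst e $ i\<bar> * real (cnt (inv w) i) < \<bar>fst e $ i\<bar>)}"

lemma clique_subset: "clique \<tau> \<Longrightarrow> \<sigma> \<subseteq> \<tau> \<Longrightarrow> clique \<sigma>"
  by (auto simp: clique_def)

lemma zeros_patch: "y \<in> patch w \<sigma> \<Longrightarrow> zeros y \<subseteq> \<sigma>"
  by (force simp: patch_def zeros_def)

lemma patch_subset: "clique \<sigma> \<Longrightarrow> patch w \<sigma> \<subseteq> flag_complement"
  using zeros_patch clique_subset by (auto simp: flag_complement_def)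

lemma open_patch: "open (patch w \<sigma>)"
proof -
  have "patch w \<sigma> = (\<Inter>i\<in>- \<sigma>. {y. sg w i * y $ i > 0})" by (auto simp: patch_def)
  moreover have "open {y::real^'d. sg w i * y $ i > 0}" for i
    by (intro open_Collect_less continuous_intros)
  ultimately show ?thesis by (auto intro: open_INT)
qed

lemma lift_in_cover: "w \<in> carrier G \<Longrightarrow> y \<in> chamber w \<Longrightarrow> lift w y \<in> cover"
  by (auto simp: cover_def)

lemma lift_in_sheet:
  assumes "w \<in> carrier G" "w' \<in> carrier G" "y \<in> chamber w'"
  shows "lift w' y \<in> sheet w \<sigma> \<longleftrightarrow> y \<in> patch w \<sigma> \<and> inv w \<otimes> w' \<in> par \<sigma>"
proof -
  have k: "en (SOME k. en k = w) = w" using en_surj[OF assms(1)] by (rule someI_ex)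
  have nz: "y $ i \<noteq> 0" if "y \<in> patch w \<sigma>" "i \<notin> \<sigma>" for i
    using that zeros_patch[of y w \<sigma>] by (auto simp: zeros_def)
  have "apply_bcontfun (position w' y) (SOME k. en k = w) $ i + \<bar>y $ i\<bar> * real (cnt (inv w) i)
      = \<bar>y $ i\<bar> * real (cnt (inv w \<otimes> w') i)" for i
    using assms by (simp add: position_apply k algebra_simps)
  then have "lift w' y \<in> sheet w \<sigma> \<longleftrightarrow>
      y \<in> patch w \<sigma> \<and> (\<forall>i. i \<notin> \<sigma> \<longrightarrow> \<bar>y $ i\<bar> * real (cnt (inv w \<otimes> w') i) < \<bar>y $ i\<bar>)"
    using lift_in_cover[OF assms(2,3)] by (simp add: sheet_def) (simp add: lift_def)
  also have "\<dots> \<longleftrightarrow> y \<in> patch w \<sigma> \<and> (\<forall>i. i \<notin> \<sigma> \<longrightarrow> cnt (inv w \<otimes> w') i = 0)"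
    using nz by auto
  finally show ?thesis using assms by (simp add: par_def)
qed

lemma openin_sheet: "openin (top_of_set cover) (sheet w \<sigma>)"
proof -
  let ?k = "SOME k. en k = w"
  let ?V = "{e. fst e \<in> patch w \<sigma>} \<inter> (\<Inter>i\<in>- \<sigma>. {e :: 'd pos.
      apply_bcontfun (snd e) ?k $ i + \<bar>fst e $ i\<bar> * real (cnt (inv w) i) < \<bar>fst e $ i\<bar>})"
  have ap: "continuous_on UNIV (\<lambda>e :: 'd pos. apply_bcontfun (snd e) ?k)"
    by (rule continuous_on_compose2[OF continuous_apply_bcontfun]) (auto intro: continuous_intros)
  have "open {e :: 'd pos.
      apply_bcontfun (snd e) ?k $ i + \<bar>fst e $ i\<bar> * real (cnt (inv w) i) < \<bar>fst e $ i\<bar>}" for i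
    by (intro open_Collect_less continuous_intros ap) 
  moreover have "open {e :: 'd pos. fst e \<in> patch w \<sigma>}"
    using open_vimage_fst[OF open_patch[of w \<sigma>]] by (simp add: vimage_def)
  ultimately have "open ?V" by (intro open_Int open_INT) auto
  moreover have "sheet w \<sigma> = cover \<inter> ?V" by (auto simp: sheet_def)
  ultimately show ?thesis by (auto simp: openin_open)
qed

lemma len_par: "clique \<sigma> \<Longrightarrow> h \<in> par \<sigma> \<Longrightarrow> len h \<le> CARD('d)"
  using sum_bounded_above[of UNIV "cnt h" 1] par_clique[of h \<sigma>] by (simp add: len_def)

lemma finite_par: "clique \<sigma> \<Longrightarrow> finite (par \<sigma>)"
  using len_par par_subset by (intro finite_subset[OF _ finite_len_le[of "CARD('d)"]]) auto

text \<open>Off the zeros of \<open>y\<close> the two elements have equal signs, so their quotient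
  has even counts there; in \<open>par \<sigma>\<close> counts are at most one, hence these are
  zero.\<close>

lemma lift_eq_in_par:
  assumes "clique \<sigma>" "w \<in> carrier G" "w' \<in> carrier G" "inv w \<otimes> w' \<in> par \<sigma>"
    and "y \<in> chamber w" "y \<in> chamber w'"
  shows "lift w y = lift w' y"
proof -
  have "cnt (inv w \<otimes> w') i = 0" if "y $ i \<noteq> 0" for i
  proof -
    have "0 \<le> sg w i * y $ i" "0 \<le> sg w' i * y $ i" using assms(5,6) by (simp_all add: chamber_def)
    then have "sg w i = sg w' i"
      using that sg_cases[of w i] sg_cases[of w' i] by auto
    then have "sg (inv w \<otimes> w') i = 1" using assms by (simp add: sg_mult sg_inv)
    then have "cnt (inv w \<otimes> w') i \<noteq> 1" by (auto simp: sg_def)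
    then show ?thesis using par_clique[OF assms(4,1), of i] by linarith
  qed
  then show ?thesis using assms by (simp add: lift_eq par_def zeros_def)
qed

text \<open>Right multiplication by those \<open>s i\<close> for which \<open>y\<close> has the
  wrong sign turns the orthant of \<open>w\<close> into one containing \<open>y\<close>; on the
  patch only indices in \<sigma> can be wrong.\<close>

lemma chamber_exists:
  assumes "y \<in> patch w \<sigma>" "clique \<sigma>" "w \<in> carrier G"
  shows "\<exists>w'\<in>carrier G. inv w \<otimes> w' \<in> par \<sigma> \<and> y \<in> chamber w'"
proof -
  have "{i. sg w i * y $ i < 0} \<subseteq> \<sigma>" using assms(1) by (force simp: patch_def)
  then obtain h where h: "h \<in> par \<sigma>" "\<And>i. cnt h i = (if sg w i * y $ i < 0 then 1 else 0)"
    using par_exists by (metis (no_types, lifting) mem_Collect_eq)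
  have hc: "h \<in> carrier G" using h par_subset by blast
  have "sg (w \<otimes> h) i * y $ i \<ge> 0" for i
    using hc assms by (simp add: sg_mult sg_def[of h] h(2))
  then have "y \<in> chamber (w \<otimes> h)" using assms patch_subset by (auto simp: chamber_def)
  moreover have "inv w \<otimes> (w \<otimes> h) = h" using hc assms by (simp add: m_assoc[symmetric])
  ultimately show ?thesis using h hc assms by (intro bexI[of _ "w \<otimes> h"]) auto
qed

text \<open>Inverse of the projection on \<open>sheet w \<sigma>\<close>; by
  \<open>lift_eq_in_par\<close> all admissible choices of the chamber give the same point.\<close>

definition section_on :: "'w \<Rightarrow> 'd set \<Rightarrow> real^'d \<Rightarrow> 'd pos" where
  "section_on w \<sigma> y = lift (SOME w'. w' \<in> carrier G \<and> inv w \<otimes> w' \<in> par \<sigma> \<and> y \<in> chamber w') y"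

lemma section_on_eq:
  assumes "clique \<sigma>" "w \<in> carrier G" "w' \<in> carrier G" "inv w \<otimes> w' \<in> par \<sigma>" "y \<in> chamber w'"
  shows "section_on w \<sigma> y = lift w' y"
proof -
  define v where "v = (SOME w'. w' \<in> carrier G \<and> inv w \<otimes> w' \<in> par \<sigma> \<and> y \<in> chamber w')"
  have v: "v \<in> carrier G \<and> inv w \<otimes> v \<in> par \<sigma> \<and> y \<in> chamber v"
    unfolding v_def by (rule someI[of _ w']) (use assms in auto)
  have "inv v \<otimes> w' = inv (inv w \<otimes> v) \<otimes> (inv w \<otimes> w')"
    using v assms by (simp add: inv_mult_group m_assoc) (simp add: m_assoc[symmetric])
  then have "inv v \<otimes> w' \<in> par \<sigma>" using v assms par_mult par_inv by simp
  then show ?thesis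
    unfolding section_on_def v_def[symmetric] using lift_eq_in_par assms v by blast
qed

text \<open>The patch is covered by finitely many chambers, those of the coset of \<open>w\<close>
  modulo \<open>par \<sigma>\<close>. They are closed in it, and the section is a continuous
  \<open>lift\<close> on each, so it is continuous by pasting.\<close>

lemma homeomorphism_sheet:
  assumes "clique \<sigma>" "w \<in> carrier G"
  shows "homeomorphism (sheet w \<sigma>) (patch w \<sigma>) fst (section_on w \<sigma>)"
proof (rule homeomorphismI)
  show "continuous_on (sheet w \<sigma>) fst" by (intro continuous_intros)
  show "fst ` sheet w \<sigma> \<subseteq> patch w \<sigma>" by (auto simp: sheet_def)
  have ex: "\<exists>w'\<in>carrier G. inv w \<otimes> w' \<in> par \<sigma> \<and> y \<in> chamber w' \<and> section_on w \<sigma> y = lift w' y"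
    if "y \<in> patch w \<sigma>" for y
    using chamber_exists[OF that assms] section_on_eq[OF assms] by blast
  show "section_on w \<sigma> ` patch w \<sigma> \<subseteq> sheet w \<sigma>"
    using ex lift_in_sheet assms by fastforce
  show "fst (section_on w \<sigma> y) = y" if "y \<in> patch w \<sigma>" for y
    using ex[OF that] by auto
  show "section_on w \<sigma> (fst e) = e" if e: "e \<in> sheet w \<sigma>" for e
  proof -
    obtain w' y where w': "w' \<in> carrier G" "y \<in> chamber w'" "e = lift w' y"
      using e by (auto simp: sheet_def cover_def)
    then show ?thesis using e lift_in_sheet assms section_on_eq by simp
  qed
  let ?I = "(\<lambda>h. w \<otimes> h) ` par \<sigma>"
  have I: "w' \<in> carrier G \<and> inv w \<otimes> w' \<in> par \<sigma>" if "w' \<in> ?I" for w'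
    using that assms par_subset[of \<sigma>] by (auto simp: m_assoc[symmetric] subset_iff)
  have mem: "w' \<in> ?I" if "w' \<in> carrier G" "inv w \<otimes> w' \<in> par \<sigma>" for w'
    using that assms by (intro image_eqI[of _ _ "inv w \<otimes> w'"]) (auto simp: m_assoc[symmetric])
  show "continuous_on (patch w \<sigma>) (section_on w \<sigma>)"
  proof (rule continuous_on_pasting_closed)
    show "finite ?I" using finite_par assms by blast
    show "patch w \<sigma> \<subseteq> (\<Union>w'\<in>?I. patch w \<sigma> \<inter> chamber w')"
    proof
      fix y assume y: "y \<in> patch w \<sigma>"
      then obtain w' where w': "w' \<in> carrier G" "inv w \<otimes> w' \<in> par \<sigma>" "y \<in> chamber w'"
        using chamber_exists[OF y assms] by blast
      show "y \<in> (\<Union>w'\<in>?I. patch w \<sigma> \<inter> chamber w')"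
        by (rule UN_I[OF mem[OF w'(1,2)]]) (use y w' in simp)
    qed
    fix w' assume w': "w' \<in> ?I"
    have "patch w \<sigma> \<inter> chamber w' = patch w \<sigma> \<inter> (\<Inter>i. {y. 0 \<le> sg w' i * y $ i})"
      using patch_subset[OF assms(1)] by (auto simp: chamber_def)
    moreover have "closed {y::real^'d. 0 \<le> sg w' i * y $ i}" for i
      by (intro closed_Collect_le continuous_intros)
    ultimately show "closedin (top_of_set (patch w \<sigma>)) (patch w \<sigma> \<inter> chamber w')"
      by (simp add: closed_INT closedin_closed_Int)
    show "continuous_on (patch w \<sigma> \<inter> chamber w') (lift w')"
      using continuous_lift I[OF w'] by blast
    show "section_on w \<sigma> y = lift w' y" if "y \<in> patch w \<sigma> \<inter> chamber w'" for y
      using that section_on_eq[OF assms] I[OF w'] by blast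
  qed
qed

lemma sg_exists: "\<exists>w\<in>carrier G. \<forall>i. sg w i * y $ i \<ge> 0"
proof -
  obtain h where h: "h \<in> par UNIV" "\<And>i. cnt h i = (if y $ i < 0 then 1 else 0)"
    using par_exists[of "{i. y $ i < 0}" UNIV] by auto
  then show ?thesis using par_subset by (intro bexI[of _ h]) (auto simp: sg_def)
qed

lemma fst_cover: "fst ` cover = flag_complement"
proof
  show "fst ` cover \<subseteq> flag_complement" by (auto simp: cover_def chamber_def)
  show "flag_complement \<subseteq> fst ` cover"
  proof
    fix y assume "y \<in> flag_complement"
    moreover obtain w where "w \<in> carrier G" "\<forall>i. sg w i * y $ i \<ge> 0" using sg_exists by blast
    ultimately have "lift w y \<in> cover" by (intro lift_in_cover) (auto simp: chamber_def)
    then show "y \<in> fst ` cover" by (metis fst_lift image_eqI)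
  qed
qed

lemma covering_space_cover: "covering_space cover fst flag_complement"
proof
  show "continuous_on cover fst" by (intro continuous_intros)
  show "fst ` cover = flag_complement" by (rule fst_cover)
  fix x assume x: "x \<in> flag_complement"
  define \<sigma> where "\<sigma> = zeros x"
  have cl: "clique \<sigma>" using x by (simp add: \<sigma>_def flag_complement_def)
  obtain w0 where w0: "w0 \<in> carrier G" "\<forall>i. sg w0 i * x $ i \<ge> 0" using sg_exists by blast
  \<comment> \<open>Over the patch of \<open>w0\<close> lie the sheets of all \<open>w\<close> whose
    signs agree with those of \<open>w0\<close> off \<sigma>; elements of one coset of
    \<open>par \<sigma>\<close> name the same sheet.\<close>
  define \<V> where "\<V> = (\<lambda>w. sheet w \<sigma>) ` {w \<in> carrier G. \<forall>i. i \<notin> \<sigma> \<longrightarrow> sg w i = sg w0 i}"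
  have same: "patch w \<sigma> = patch w0 \<sigma>" if "\<forall>i. i \<notin> \<sigma> \<longrightarrow> sg w i = sg w0 i" for w
    using that by (auto simp: patch_def)
  have "x $ i \<noteq> 0" if "i \<notin> \<sigma>" for i using that by (simp add: \<sigma>_def zeros_def)
  then have "sg w0 i * x $ i > 0" if "i \<notin> \<sigma>" for i
    using w0(2)[rule_format, of i] sg_cases[of w0 i] that by (auto simp: less_le)
  then have "x \<in> patch w0 \<sigma>" by (simp add: patch_def)
  moreover have "openin (top_of_set flag_complement) (patch w0 \<sigma>)"
    using open_patch patch_subset[OF cl] by (rule open_subset[rotated])
  moreover have "\<Union>\<V> = cover \<inter> fst -` patch w0 \<sigma>"
  proof
    show "\<Union>\<V> \<subseteq> cover \<inter> fst -` patch w0 \<sigma>"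
      using same unfolding \<V>_def sheet_def by blast
    show "cover \<inter> fst -` patch w0 \<sigma> \<subseteq> \<Union>\<V>"
    proof
      fix e assume e: "e \<in> cover \<inter> fst -` patch w0 \<sigma>"
      then obtain w y where w: "w \<in> carrier G" "y \<in> chamber w" "e = lift w y" by (auto simp: cover_def)
      have y: "y \<in> patch w0 \<sigma>" using e w by simp
      have sg: "\<forall>i. i \<notin> \<sigma> \<longrightarrow> sg w i = sg w0 i"
      proof (intro allI impI)
        fix i assume "i \<notin> \<sigma>"
        then have "sg w0 i * y $ i > 0" "sg w i * y $ i \<ge> 0" using y w by (auto simp: patch_def chamber_def)
        then show "sg w i = sg w0 i" using sg_cases[of w i] sg_cases[of w0 i] by auto
      qed
      have "y \<in> patch w \<sigma>" using y same[OF sg] by simp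
      then have "e \<in> sheet w \<sigma>" using w lift_in_sheet[OF w(1,1,2)] by simp
      moreover have "sheet w \<sigma> \<in> \<V>" unfolding \<V>_def using sg w(1) by blast
      ultimately show "e \<in> \<Union>\<V>" by blast
    qed
  qed
  moreover have "\<forall>U\<in>\<V>. openin (top_of_set cover) U" using openin_sheet by (auto simp: \<V>_def)
  moreover have "pairwise disjnt \<V>"
  proof -
    \<comment> \<open>A common point puts \<open>w\<close> and \<open>w'\<close> into the same coset
      of \<open>par \<sigma>\<close>, and over a given patch a sheet depends only on that
      coset.\<close>
    have "sheet w \<sigma> = sheet w' \<sigma>" if w: "w \<in> carrier G" "w' \<in> carrier G" "patch w \<sigma> = patch w' \<sigma>"
      and e: "e \<in> sheet w \<sigma>" "e \<in> sheet w' \<sigma>" for w w' e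
    proof -
      obtain v y where v: "v \<in> carrier G" "y \<in> chamber v" "e = lift v y"
        using e by (auto simp: sheet_def cover_def)
      have "inv w \<otimes> v \<in> par \<sigma>" "inv w' \<otimes> v \<in> par \<sigma>" using v e w lift_in_sheet by auto
      then have p: "(inv w \<otimes> v) \<otimes> inv (inv w' \<otimes> v) \<in> par \<sigma>" using par_mult par_inv by blast
      have eq: "(inv w \<otimes> v) \<otimes> inv (inv w' \<otimes> v) = inv w \<otimes> w'"
        using v w by (simp add: inv_mult_group m_assoc) (simp add: m_assoc[symmetric])
      have p1: "inv w \<otimes> w' \<in> par \<sigma>" using p eq by simp
      have p2: "inv w' \<otimes> w \<in> par \<sigma>" using par_inv[OF p1] w by (simp add: inv_mult_group)
      have iff: "inv w \<otimes> u \<in> par \<sigma> \<longleftrightarrow> inv w' \<otimes> u \<in> par \<sigma>" if "u \<in> carrier G" for u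
      proof
        assume "inv w \<otimes> u \<in> par \<sigma>"
        then have "(inv w' \<otimes> w) \<otimes> (inv w \<otimes> u) \<in> par \<sigma>" using p2 par_mult by blast
        then show "inv w' \<otimes> u \<in> par \<sigma>" using w that by (simp add: m_assoc) (simp add: m_assoc[symmetric])
      next
        assume "inv w' \<otimes> u \<in> par \<sigma>"
        then have "(inv w \<otimes> w') \<otimes> (inv w' \<otimes> u) \<in> par \<sigma>" using p1 par_mult by blast
        then show "inv w \<otimes> u \<in> par \<sigma>" using w that by (simp add: m_assoc) (simp add: m_assoc[symmetric])
      qed
      have "f \<in> sheet w \<sigma> \<longleftrightarrow> f \<in> sheet w' \<sigma>" if "f \<in> cover" for f
        using that iff w lift_in_sheet by (auto simp: cover_def)
      then show ?thesis by (auto simp: sheet_def)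
    qed
    note same_sheet = this
    show ?thesis
      unfolding \<V>_def pairwise_def disjnt_def
    proof (clarify)
      fix w w' assume "w \<in> carrier G" "w' \<in> carrier G" "\<forall>i. i \<notin> \<sigma> \<longrightarrow> sg w i = sg w0 i"
        "\<forall>i. i \<notin> \<sigma> \<longrightarrow> sg w' i = sg w0 i" "sheet w \<sigma> \<noteq> sheet w' \<sigma>"
      then show "sheet w \<sigma> \<inter> sheet w' \<sigma> = {}"
        using same_sheet[of w w'] same[of w] same[of w'] by blast
    qed
  qed
  moreover have "\<forall>U\<in>\<V>. \<exists>q. homeomorphism U (patch w0 \<sigma>) fst q"
  proof
    fix U assume "U \<in> \<V>"
    then obtain w where w: "U = sheet w \<sigma>" "w \<in> carrier G" "\<forall>i. i \<notin> \<sigma> \<longrightarrow> sg w i = sg w0 i"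
      by (auto simp: \<V>_def)
    then have "homeomorphism U (patch w0 \<sigma>) fst (section_on w \<sigma>)"
      using homeomorphism_sheet[OF cl w(2)] same[OF w(3)] by simp
    then show "\<exists>q. homeomorphism U (patch w0 \<sigma>) fst q" by blast
  qed
  ultimately show "\<exists>T. x \<in> T \<and> openin (top_of_set flag_complement) T \<and>
      (\<exists>v. \<Union> v = cover \<inter> fst -` T \<and> (\<forall>u\<in>v. openin (top_of_set cover) u) \<and> pairwise disjnt v \<and>
           (\<forall>u\<in>v. \<exists>q. homeomorphism u T fst q))"
    by blast
qed

end

section \<open>Infinite concatenation of deformations\<close>

lemma continuous_on_Min_family:
  fixes f :: "'i \<Rightarrow> 'a::topological_space \<Rightarrow> real"
  assumes "finite I" "I \<noteq> {}" "\<And>i. i \<in> I \<Longrightarrow> continuous_on S (f i)"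
  shows "continuous_on S (\<lambda>x. Min ((\<lambda>i. f i x) ` I))"
  using assms by (induction rule: finite_ne_induct) (auto intro!: continuous_intros)

lemma continuous_map_locally:
  assumes "\<And>x. x \<in> topspace X \<Longrightarrow> \<exists>N. openin X N \<and> x \<in> N \<and> continuous_map (subtopology X N) Y f"
  shows "continuous_map X Y f"
proof -
  obtain N where N: "\<And>x. x \<in> topspace X \<Longrightarrow> openin X (N x) \<and> x \<in> N x \<and> continuous_map (subtopology X (N x)) Y f"
    using assms by metis
  show ?thesis
    by (rule pasting_lemma[where I = "topspace X" and T = N and f = "\<lambda>_. f"]) (use N in auto)
qed

lemma continuous_on_locally:
  fixes f :: "'a::topological_space \<Rightarrow> 'b::topological_space"
  assumes "\<And>x. x \<in> S \<Longrightarrow> \<exists>N. openin (top_of_set S) N \<and> x \<in> N \<and> continuous_on N f"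
  shows "continuous_on S f"
proof -
  have "continuous_map (top_of_set S) euclidean f"
  proof (rule continuous_map_locally)
    fix x assume "x \<in> topspace (top_of_set S)"
    then obtain N where N: "openin (top_of_set S) N" "x \<in> N" "continuous_on N f" using assms by auto
    moreover have "N \<subseteq> S" using N(1) openin_imp_subset by blast
    ultimately show "\<exists>N. openin (top_of_set S) N \<and> x \<in> N \<and> continuous_map (subtopology (top_of_set S) N) euclidean f"
      by (intro exI[of _ N]) (simp add: subtopology_subtopology Int_absorb1)
  qed
  then show ?thesis by simp
qed

text \<open>
  The deformation of \<open>V (Suc k)\<close> into \<open>V k\<close> is run during the time interval from
  \<open>1 / 2 ^ Suc k\<close> to \<open>1 / 2 ^ k\<close>, so that infinitely many of them can be concatenated.
\<close>
fun telescope :: "('a \<Rightarrow> real \<Rightarrow> 'a) \<Rightarrow> (nat \<Rightarrow> 'a \<Rightarrow> real \<Rightarrow> 'a) \<Rightarrow> nat \<Rightarrow> 'a \<Rightarrow> real \<Rightarrow> 'a" where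
  "telescope c r 0 e t = (if t \<le> 1 then e else c e (t - 1))"
| "telescope c r (Suc k) e t =
     (if t \<le> 1 / 2 ^ k then r k e (max 0 (2 ^ Suc k * t - 1)) else telescope c r k (r k e 1) t)"

text \<open>A point of \<open>V k\<close> stands still up to time \<open>1 / 2 ^ k\<close>
  (\<open>early\<close>), and flows built from later stages restrict to that of stage
  \<open>k\<close> (\<open>stable\<close>). Since every point has a neighbourhood inside some
  \<open>V k\<close>, only finitely many deformations act near it, which gives continuity even at
  time zero. The times from 1 to 2 contract \<open>V 0\<close>.\<close>

lemma contractible_telescope:
  fixes V :: "nat \<Rightarrow> 'a::real_normed_vector set" and r :: "nat \<Rightarrow> 'a \<Rightarrow> real \<Rightarrow> 'a"
  assumes sub: "\<And>k. V k \<subseteq> V (Suc k)"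
    and nbhd: "\<And>x. x \<in> (\<Union>k. V k) \<Longrightarrow> \<exists>k N. openin (top_of_set (\<Union>k. V k)) N \<and> x \<in> N \<and> N \<subseteq> V k"
    and cont: "\<And>k. continuous_on (V (Suc k) \<times> {0..1}) (\<lambda>z. r k (fst z) (snd z))"
    and img: "\<And>k e t. e \<in> V (Suc k) \<Longrightarrow> 0 \<le> t \<Longrightarrow> t \<le> 1 \<Longrightarrow> r k e t \<in> V (Suc k)"
    and r0: "\<And>k e. e \<in> V (Suc k) \<Longrightarrow> r k e 0 = e"
    and r1: "\<And>k e. e \<in> V (Suc k) \<Longrightarrow> r k e 1 \<in> V k"
    and fixed: "\<And>k e t. e \<in> V k \<Longrightarrow> 0 \<le> t \<Longrightarrow> t \<le> 1 \<Longrightarrow> r k e t = e"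
    and contr: "contractible (V 0)"
  shows "contractible (\<Union>k. V k)"
proof -
  let ?U = "\<Union>k. V k"
  obtain a h where h: "continuous_on ({0..1::real} \<times> V 0) h" "h \<in> ({0..1} \<times> V 0) \<rightarrow> V 0"
    "\<And>x. h (0, x) = x" "\<And>x. h (1, x) = a"
    using contr unfolding contractible_def homotopic_with_def by auto
  define c where "c e t = h (t, e)" for e t
  define H where "H = telescope c r"
  have H0: "H 0 e t = (if t \<le> 1 then e else c e (t - 1))" for e t by (simp add: H_def)
  have HS: "H (Suc k) e t =
     (if t \<le> 1 / 2 ^ k then r k e (max 0 (2 ^ Suc k * t - 1)) else H k (r k e 1) t)" for k e t
    by (simp add: H_def)
  have mono: "V k \<subseteq> V m" if "k \<le> m" for k m using that sub by (rule lift_Suc_mono_le[rotated])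
  \<comment> \<open>The clock of stage \<open>k\<close>: the affine map takes
    \<open>1 / 2 ^ Suc k\<close> to 0 and \<open>1 / 2 ^ k\<close> to 1, and \<open>max\<close>
    freezes all earlier times at 0.\<close>
  have time: "0 \<le> max 0 (2 ^ Suc k * t - 1) \<and> max 0 (2 ^ Suc k * t - 1) \<le> 1"
    if "t \<le> 1 / 2 ^ k" for k and t :: real
    using that by (auto simp: field_simps)
  have early: "H k e t = e" if "e \<in> V k" "0 \<le> t" "t \<le> 1 / 2 ^ k" for k e t
  proof (cases k)
    case 0
    then show ?thesis using that by (simp add: H0)
  next
    case (Suc m)
    have "1 / 2 ^ Suc m \<le> (1 / 2 ^ m :: real)" by (simp add: field_simps)
    then have "t \<le> 1 / 2 ^ m" using that Suc by simp
    moreover have "max 0 (2 ^ Suc m * t - 1) = 0" using that Suc by (simp add: field_simps)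
    ultimately show ?thesis using that Suc r0 by (simp add: HS)
  qed
  have Himg: "H k e t \<in> V k" if "e \<in> V k" "0 \<le> t" "t \<le> 2" for k e t
    using that
  proof (induction k arbitrary: e)
    case 0
    then show ?case using h(2) by (auto simp: H0 c_def)
  next
    case (Suc k)
    show ?case
    proof (cases "t \<le> 1 / 2 ^ k")
      case True
      then show ?thesis using Suc.prems img[of e k] time[OF True] by (simp add: HS del: power_Suc)
    next
      case False
      then show ?thesis using Suc.IH[OF r1[OF Suc.prems(1)]] Suc.prems sub[of k] by (auto simp: HS)
    qed
  qed
  have Hend: "H k e 2 = a" if "e \<in> V k" for k e
    using that
  proof (induction k arbitrary: e)
    case 0
    then show ?case by (simp add: H0 c_def h)
  next
    case (Suc k)
    have "1 / 2 ^ k \<le> (1 :: real)" by (simp add: field_simps)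
    then have "\<not> 2 \<le> (1 / 2 ^ k :: real)" by linarith
    then show ?case using Suc.IH[OF r1[OF Suc.prems]] by (simp add: HS)
  qed
  have extend: "H (Suc k) e t = H k e t" if "e \<in> V k" "0 \<le> t" for k e t
  proof (cases "t \<le> 1 / 2 ^ k")
    case True
    then show ?thesis using that fixed[of e k] time[OF True] early by (simp add: HS del: power_Suc)
  next
    case False
    then show ?thesis using that fixed[of e k 1] by (simp add: HS)
  qed
  have stable: "H m e t = H k e t" if "e \<in> V k" "0 \<le> t" "k \<le> m" for k m e t
    using that(3)
  proof (induction m rule: dec_induct)
    case (step m)
    then show ?case using mono[of k m] that extend[of e m t] by auto
  qed simp
  have Hcont: "continuous_on (V k \<times> {0..2}) (\<lambda>z. H k (fst z) (snd z))" for k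
  proof (induction k)
    case 0
    have "continuous_on {z \<in> V 0 \<times> {0..2}. 1 \<le> snd z} (\<lambda>z. h (snd z - 1, fst z))"
      by (rule continuous_on_compose2[OF h(1)]) (auto intro!: continuous_intros)
    then show ?case
      unfolding H0 c_def
      by (intro continuous_on_cases_le) (auto intro!: continuous_intros simp: h)
  next
    case (Suc k)
    have 1: "continuous_on {z \<in> V (Suc k) \<times> {0..2}. snd z \<le> 1 / 2 ^ k}
        (\<lambda>z. r k (fst z) (max 0 (2 ^ Suc k * snd z - 1)))"
    proof (rule continuous_on_compose2[OF cont[of k], where f = "\<lambda>z. (fst z, max 0 (2 ^ Suc k * snd z - 1))", simplified fst_conv snd_conv])
      show "continuous_on {z \<in> V (Suc k) \<times> {0..2}. snd z \<le> 1 / 2 ^ k} (\<lambda>z. (fst z, max 0 (2 ^ Suc k * snd z - 1 :: real)))"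
        by (intro continuous_intros)
      show "(\<lambda>z. (fst z, max 0 (2 ^ Suc k * snd z - 1 :: real))) ` {z \<in> V (Suc k) \<times> {0..2}. snd z \<le> 1 / 2 ^ k}
          \<subseteq> V (Suc k) \<times> {0..1}"
        using time by (auto simp del: power_Suc)
    qed
    have c1: "continuous_on {z \<in> V (Suc k) \<times> {0..2}. 1 / 2 ^ k \<le> snd z} (\<lambda>z. r k (fst z) 1)"
      by (rule continuous_on_compose2[OF cont[of k], where f = "\<lambda>z. (fst z, 1)", simplified fst_conv snd_conv])
        (auto intro!: continuous_intros)
    have 2: "continuous_on {z \<in> V (Suc k) \<times> {0..2}. 1 / 2 ^ k \<le> snd z} (\<lambda>z. H k (r k (fst z) 1) (snd z))"
      by (rule continuous_on_compose2[OF Suc, where f = "\<lambda>z. (r k (fst z) 1, snd z)", simplified fst_conv snd_conv])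
        (auto intro!: continuous_intros c1 r1)
    show ?case
      unfolding HS
    proof (rule continuous_on_cases_le[OF 1 2])
      fix z :: "'a \<times> real" assume z: "z \<in> V (Suc k) \<times> {0..2}" "snd z = 1 / 2 ^ k"
      then have "max 0 (2 ^ Suc k * snd z - 1) = 1" by simp
      then show "r k (fst z) (max 0 (2 ^ Suc k * snd z - 1)) = H k (r k (fst z) 1) (snd z)"
        using z early[of "r k (fst z) 1" k "snd z"] r1[of "fst z" k] by auto
    qed (intro continuous_intros)
  qed
  \<comment> \<open>\<open>LEAST\<close> only fixes some stage containing \<open>e\<close>; by
    \<open>stable\<close> every other such stage gives the same value.\<close>
  define K where "K e t = H (LEAST k. e \<in> V k) e t" for e t
  have K: "K e t = H k e t" if "e \<in> V k" "0 \<le> t" for k e t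
    unfolding K_def using stable[of e "LEAST k. e \<in> V k" t k] that
    by (metis LeastI Least_le)
  have Kcont: "continuous_on (?U \<times> {0..2}) (\<lambda>z. K (fst z) (snd z))"
  proof (rule continuous_on_locally)
    fix z :: "'a \<times> real" assume z: "z \<in> ?U \<times> {0..2}"
    then have "fst z \<in> ?U" by auto
    then obtain k N where N: "openin (top_of_set ?U) N" "fst z \<in> N" "N \<subseteq> V k"
      using nbhd[of "fst z"] by auto
    have "continuous_on (N \<times> {0..2}) (\<lambda>z. H k (fst z) (snd z))"
      using N by (intro continuous_on_subset[OF Hcont]) auto
    then have "continuous_on (N \<times> {0..2}) (\<lambda>z. K (fst z) (snd z))"
      by (rule continuous_on_eq) (use K N in auto)
    moreover have "openin (top_of_set (?U \<times> {0..2})) (N \<times> {0..2::real})"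
      using N(1) by (intro openin_Times) auto
    ultimately show "\<exists>M. openin (top_of_set (?U \<times> {0..2})) M \<and> z \<in> M \<and> continuous_on M (\<lambda>z. K (fst z) (snd z))"
      using N z by (intro exI[of _ "N \<times> {0..2}"]) auto
  qed
  have "continuous_on ({0..1} \<times> ?U) (\<lambda>z. K (snd z) (2 * fst z))"
    by (rule continuous_on_compose2[OF Kcont, where f = "\<lambda>z. (snd z, 2 * fst z)", simplified fst_conv snd_conv])
      (auto intro!: continuous_intros)
  moreover have "K e 0 = e" "K e 2 = a" "0 \<le> t \<Longrightarrow> t \<le> 2 \<Longrightarrow> K e t \<in> V k" if k: "e \<in> V k" for e t k
    using K[OF k] early[OF k] Hend[OF k] Himg[OF k] by simp_all
  ultimately have "homotopic_with_canon (\<lambda>x. True) ?U ?U id (\<lambda>x. a)"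
    by (subst homotopic_with)
      (auto intro!: exI[of _ "\<lambda>z. K (snd z) (2 * fst z)"] intro: UN_I)
  then show ?thesis unfolding contractible_def by blast
qed

section \<open>Contractibility of the cover by descending length\<close>

context countable_racg
begin

definition cover_le :: "nat \<Rightarrow> 'd pos set" where
  "cover_le k = (\<Union>w\<in>{w \<in> carrier G. len w \<le> k}. lift w ` chamber w)"

lemma lift_in_own_sheet:
  assumes "w \<in> carrier G" "y \<in> chamber w"
  shows "lift w y \<in> sheet w (zeros y)"
proof -
  have "0 < sg w i * y $ i" if "i \<notin> zeros y" for i
    using assms(2) that sg_cases[of w i] by (auto simp: chamber_def zeros_def less_le)
  then have "y \<in> patch w (zeros y)" by (simp add: patch_def)
  then show ?thesis using assms lift_in_sheet[OF assms(1,1,2)] by simp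
qed

lemma convex_chamber: "convex (chamber w)"
  using convex_orthant_downclosed[of clique "sg w"] clique_subset
  by (simp add: chamber_def flag_complement_def sg_def)

text \<open>Membership is a closed condition: the second component is the continuous function
  \<open>position w\<close> of the first, and the sign inequalities are weak.\<close>

lemma closedin_lift_chamber:
  assumes "w \<in> carrier G"
  shows "closedin (top_of_set cover) (lift w ` chamber w)"
proof -
  let ?C = "{e. snd e = position w (fst e)} \<inter> (\<Inter>i. {e :: 'd pos. 0 \<le> sg w i * fst e $ i})"
  have "closed {e :: 'd pos. snd e = position w (fst e)}"
    by (intro closed_Collect_eq continuous_intros continuous_on_compose2[OF continuous_position[OF assms], of UNIV]) auto
  moreover have "closed {e :: 'd pos. 0 \<le> sg w i * fst e $ i}" for i
    by (intro closed_Collect_le continuous_intros)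
  ultimately have "closed ?C" by (intro closed_Int closed_INT) auto
  moreover have "lift w ` chamber w = cover \<inter> ?C"
  proof
    show "lift w ` chamber w \<subseteq> cover \<inter> ?C"
      using assms by (auto simp: cover_def) (auto simp: lift_def chamber_def)
    show "cover \<inter> ?C \<subseteq> lift w ` chamber w"
    proof
      fix e assume e: "e \<in> cover \<inter> ?C"
      then have "fst e \<in> flag_complement" using fst_cover by blast
      then have "fst e \<in> chamber w" using e by (auto simp: chamber_def)
      moreover have "e = lift w (fst e)" using e by (simp add: lift_def prod_eq_iff)
      ultimately show "e \<in> lift w ` chamber w" by blast
    qed
  qed
  ultimately show ?thesis by (simp add: closedin_closed_Int)
qed

lemma closedin_cover_le: "closedin (top_of_set cover) (cover_le k)"
  unfolding cover_le_def
  by (rule closedin_Union) (use finite_len_le closedin_lift_chamber in auto)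

lemma cover_le_subset: "cover_le k \<subseteq> cover"
  by (auto simp: cover_le_def cover_def)

text \<open>If no wall of a descent of \<open>w\<close> passes through \<open>y\<close>, then
  \<open>w\<close> is the unique shortest element of its coset of \<open>par (zeros y)\<close>, so
  all other chambers at the point belong to longer elements.\<close>

lemma shorter_chamber:
  assumes "w \<in> carrier G" "w' \<in> carrier G" "y \<in> chamber w" "lift w y = lift w' y"
    and "len w' \<le> len w" "w' \<noteq> w"
  shows "\<exists>i\<in>des w. y $ i = 0"
proof (rule ccontr)
  assume "\<not> ?thesis"
  then have "des w \<inter> zeros y = {}" by (auto simp: zeros_def)
  moreover have "inv w \<otimes> w' \<in> par (zeros y)" using assms lift_eq by blast
  moreover have "clique (zeros y)" using assms by (simp add: chamber_def flag_complement_def)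
  ultimately have "len (w \<otimes> (inv w \<otimes> w')) = len w + len (inv w \<otimes> w')"
    using len_mult_par assms(1) by blast
  moreover have "w \<otimes> (inv w \<otimes> w') = w'" using assms by (simp add: m_assoc[symmetric])
  ultimately have "len (inv w \<otimes> w') = 0" using assms by simp
  then have "inv w \<otimes> w' = \<one>" using len_pos[of "inv w \<otimes> w'"] assms by fastforce
  then have "w' = w" using assms \<open>w \<otimes> (inv w \<otimes> w') = w'\<close> by simp
  then show False using assms by simp
qed

definition depth :: "'w \<Rightarrow> real^'d \<Rightarrow> real" where
  "depth w y = Min ((\<lambda>i. \<bar>y $ i\<bar>) ` des w)"

text \<open>
  Pushes a chamber onto the union of its walls towards shorter chambers; moving the other
  coordinates away from zero keeps the point inside the complement.
\<close>
definition shrink :: "'w \<Rightarrow> real^'d \<Rightarrow> real \<Rightarrow> real^'d" where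
  "shrink w y t = (\<chi> i. sg w i * (\<bar>y $ i\<bar> + (if i \<in> des w then - 1 else 1) * t * depth w y))"

lemma sg_abs: "y \<in> chamber w \<Longrightarrow> sg w i * \<bar>y $ i\<bar> = y $ i"
  using sg_cases[of w i] by (auto simp: chamber_def abs_if dest: spec[of _ i])

lemma shrink_stationary: "y \<in> chamber w \<Longrightarrow> t * depth w y = 0 \<Longrightarrow> shrink w y t = y"
  by (auto simp: shrink_def vec_eq_iff mult.assoc sg_abs)

lemma depth_nonneg: "des w \<noteq> {} \<Longrightarrow> 0 \<le> depth w y"
  by (simp add: depth_def)

lemma depth_le: "i \<in> des w \<Longrightarrow> depth w y \<le> \<bar>y $ i\<bar>"
  by (simp add: depth_def)

lemma depth_zero: "i \<in> des w \<Longrightarrow> y $ i = 0 \<Longrightarrow> depth w y = 0"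
  using depth_le[of i w y] depth_nonneg[of w y] by auto

text \<open>Once the point moves, all coordinates outside \<open>des w\<close> are nonzero, so the
  zero set lies in \<open>des w\<close>, which is a clique. Subtracting at most
  \<open>depth w y\<close> preserves the weak sign inequalities of the descent coordinates.\<close>

lemma shrink_in_chamber:
  assumes "w \<in> carrier G" "des w \<noteq> {}" "y \<in> chamber w" "0 \<le> t" "t \<le> 1"
  shows "shrink w y t \<in> chamber w"
proof (cases "t * depth w y = 0")
  case True
  then show ?thesis using shrink_stationary assms by simp
next
  case False
  then have pos: "0 < t * depth w y" using assms depth_nonneg[of w y] by (simp add: less_le)
  have le: "t * depth w y \<le> depth w y"
    using assms depth_nonneg[of w y] mult_right_mono[of t 1 "depth w y"] by simp
  have eq: "sg w i * shrink w y t $ i = \<bar>y $ i\<bar> + (if i \<in> des w then - 1 else 1) * t * depth w y" for i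
    by (simp add: shrink_def mult.assoc[symmetric])
  have "0 \<le> sg w i * shrink w y t $ i" for i
    using eq[of i] pos le depth_le[of i w y] by (auto split: if_splits)
  moreover have "zeros (shrink w y t) \<subseteq> des w"
  proof
    fix i assume "i \<in> zeros (shrink w y t)"
    then have "\<bar>y $ i\<bar> + (if i \<in> des w then - 1 else 1) * t * depth w y = 0"
      using eq[of i] by (simp add: zeros_def)
    then show "i \<in> des w" using pos by (auto split: if_splits)
  qed
  then have "clique (zeros (shrink w y t))"
    using des_clique[OF assms(1)] by (auto simp: clique_def)
  ultimately show ?thesis by (simp add: chamber_def flag_complement_def)
qed

lemma continuous_shrink:
  assumes "des w \<noteq> {}"
  shows "continuous_on S (\<lambda>z. shrink w (fst z) (snd z))"
proof -
  have "continuous_on S (\<lambda>z. depth w (fst z))"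
    unfolding depth_def using assms
    by (intro continuous_on_Min_family) (auto intro!: continuous_intros)
  then show ?thesis unfolding shrink_def by (intro continuous_intros) auto
qed

definition retr :: "nat \<Rightarrow> 'd pos \<Rightarrow> real \<Rightarrow> 'd pos" where
  "retr k e t = (if e \<in> cover_le k then e else
     (let w = SOME w. w \<in> carrier G \<and> len w = Suc k \<and> e \<in> lift w ` chamber w
      in lift w (shrink w (fst e) t)))"

lemma des_of_len: "w \<in> carrier G \<Longrightarrow> len w = Suc k \<Longrightarrow> des w \<noteq> {}"
  using des_nonempty[of w] by force

text \<open>Along the wall of a descent \<open>i\<close> the chamber of \<open>w\<close> is glued to
  that of the shorter element \<open>w \<otimes> s i\<close>.\<close>

lemma wall_in_cover_le:
  assumes "w \<in> carrier G" "len w = Suc k" "y \<in> chamber w" "i \<in> des w" "y $ i = 0"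
  shows "lift w y \<in> cover_le k"
proof -
  have ws: "w \<otimes> s i \<in> carrier G" using assms by simp
  have "sg (w \<otimes> s i) j = sg w j" if "i \<noteq> j" for j
    using that cnt_other[OF assms(1) that] by (simp add: sg_def)
  then have "y \<in> chamber (w \<otimes> s i)"
    using assms(3,5) unfolding chamber_def mem_Collect_eq by (metis mult_zero_right order_refl)
  moreover have "inv w \<otimes> (w \<otimes> s i) = s i" using assms by (simp add: m_assoc[symmetric])
  then have "lift w y = lift (w \<otimes> s i) y"
    using lift_eq[OF assms(1) ws] s_in_par[of i "zeros y"] assms(5) by (simp add: zeros_def)
  moreover have "len (w \<otimes> s i) \<le> k" using len_des[OF assms(1,4)] assms(2) by simp
  ultimately show ?thesis using ws unfolding cover_le_def by blast
qed

text \<open>The branches of \<open>retr\<close> agree where they meet: a point that also lies in a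
  shorter chamber has depth zero and does not move. Any other point lies in only one chamber of
  length \<open>Suc k\<close>, so the choice in the definition is forced.\<close>

lemma retr_lift:
  assumes "w \<in> carrier G" "len w = Suc k" "y \<in> chamber w"
  shows "retr k (lift w y) t = lift w (shrink w y t)"
proof (cases "lift w y \<in> cover_le k")
  case True
  then obtain w' where w': "w' \<in> carrier G" "len w' \<le> k" "lift w y = lift w' y"
    by (auto simp: cover_le_def) (metis fst_lift)
  have "\<exists>i\<in>des w. y $ i = 0"
    by (rule shorter_chamber[OF assms(1) w'(1) assms(3) w'(3)]) (use assms w' in auto)
  then have "depth w y = 0" using depth_zero by blast
  then show ?thesis using True shrink_stationary assms by (simp add: retr_def)
next
  case False
  define v where "v = (SOME v. v \<in> carrier G \<and> len v = Suc k \<and> lift w y \<in> lift v ` chamber v)"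
  have v: "v \<in> carrier G \<and> len v = Suc k \<and> lift w y \<in> lift v ` chamber v"
    unfolding v_def by (rule someI[of _ w]) (use assms in auto)
  then have "lift w y = lift v y" by (metis fst_lift imageE)
  moreover have "\<not> (\<exists>i\<in>des w. y $ i = 0)" using wall_in_cover_le[OF assms] False by blast
  ultimately have "v = w" using shorter_chamber[OF assms(1) _ assms(3), of v] v assms by force
  then show ?thesis using False unfolding retr_def v_def[symmetric] by (simp add: Let_def)
qed

lemma cover_le_Suc: "cover_le (Suc k) = cover_le k \<union> (\<Union>w\<in>{w \<in> carrier G. len w = Suc k}. lift w ` chamber w)"
  by (auto simp: cover_le_def le_Suc_eq)

lemma continuous_retr:
  "continuous_on (cover_le (Suc k) \<times> {0..1}) (\<lambda>z. retr k (fst z) (snd z))"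
proof (rule continuous_on_pasting_closed)
  let ?L = "{w \<in> carrier G. len w = Suc k}"
  let ?T = "\<lambda>j. (case j of None \<Rightarrow> cover_le k | Some w \<Rightarrow> lift w ` chamber w) \<times> {0..1::real}"
  let ?f = "\<lambda>j z. case j of None \<Rightarrow> fst z | Some w \<Rightarrow> lift w (shrink w (fst (fst z)) (snd z))"
  have "?L \<subseteq> {w \<in> carrier G. len w \<le> Suc k}" by auto
  then have "finite ?L" using finite_len_le finite_subset by blast
  then show "finite (insert None (Some ` ?L))" by simp
  show "cover_le (Suc k) \<times> {0..1} \<subseteq> \<Union> (?T ` insert None (Some ` ?L))"
    unfolding cover_le_Suc by auto
  fix j assume j: "j \<in> insert None (Some ` ?L)"
  have "closedin (top_of_set cover) (case j of None \<Rightarrow> cover_le k | Some w \<Rightarrow> lift w ` chamber w)"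
    using j closedin_cover_le closedin_lift_chamber by auto
  moreover have "(case j of None \<Rightarrow> cover_le k | Some w \<Rightarrow> lift w ` chamber w) \<subseteq> cover_le (Suc k)"
    using j unfolding cover_le_Suc by auto
  ultimately have "closedin (top_of_set (cover_le (Suc k))) (case j of None \<Rightarrow> cover_le k | Some w \<Rightarrow> lift w ` chamber w)"
    using closedin_subset_trans cover_le_subset by blast
  then show "closedin (top_of_set (cover_le (Suc k) \<times> {0..1})) (?T j)"
    by (intro closedin_Times) auto
  show "continuous_on (?T j) (?f j)"
  proof (cases j)
    case None
    then show ?thesis by (auto intro!: continuous_intros)
  next
    case (Some w)
    then have w: "w \<in> carrier G" "len w = Suc k" using j by auto
    have "continuous_on X (\<lambda>z. shrink w (fst (fst z)) (snd z))" for X :: "('d pos \<times> real) set"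
      by (rule continuous_on_compose2[OF continuous_shrink[OF des_of_len[OF w], of UNIV],
            where f = "\<lambda>z. (fst (fst z), snd z)", simplified fst_conv snd_conv])
        (auto intro!: continuous_intros)
    then show ?thesis unfolding Some option.case
      by (intro continuous_on_compose2[OF continuous_lift[OF w(1), of UNIV]]) auto
  qed
  show "retr k (fst z) (snd z) = ?f j z" if "z \<in> ?T j" for z
  proof (cases j)
    case None
    then show ?thesis using that by (auto simp: retr_def)
  next
    case (Some w)
    then have w: "w \<in> carrier G" "len w = Suc k" using j by auto
    then show ?thesis using that Some retr_lift[OF w] by auto
  qed
qed

lemma cover_Union: "cover = (\<Union>k. cover_le k)"
  by (auto simp: cover_def cover_le_def)

lemma contractible_cover: "contractible cover"
  unfolding cover_Union
proof (rule contractible_telescope[where r = retr])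
  show "cover_le k \<subseteq> cover_le (Suc k)" for k unfolding cover_le_Suc by blast
  show "continuous_on (cover_le (Suc k) \<times> {0..1}) (\<lambda>z. retr k (fst z) (snd z))" for k
    by (rule continuous_retr)
  show "retr k e t = e" if "e \<in> cover_le k" for k e t using that by (simp add: retr_def)
  have cases: "e \<in> cover_le k \<or> (\<exists>w y. w \<in> carrier G \<and> len w = Suc k \<and> y \<in> chamber w \<and> e = lift w y)"
    if "e \<in> cover_le (Suc k)" for e k
    using that unfolding cover_le_Suc by blast
  fix k e t
  show "retr k e 0 = e" if e: "e \<in> cover_le (Suc k)"
    using cases[OF e]
  proof (elim disjE exE conjE)
    assume "e \<in> cover_le k"
    then show ?thesis by (simp add: retr_def)
  next
    fix w y assume "w \<in> carrier G" "len w = Suc k" "y \<in> chamber w" "e = lift w y"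
    then show ?thesis using shrink_stationary[of y w 0] by (simp add: retr_lift)
  qed
  show "retr k e t \<in> cover_le (Suc k)" if e: "e \<in> cover_le (Suc k)" and t: "0 \<le> t" "t \<le> 1"
    using cases[OF e]
  proof (elim disjE exE conjE)
    assume "e \<in> cover_le k"
    then show ?thesis using e by (simp add: retr_def)
  next
    fix w y assume w: "w \<in> carrier G" "len w = Suc k" "y \<in> chamber w" "e = lift w y"
    then have "shrink w y t \<in> chamber w"
      using shrink_in_chamber[OF w(1) des_of_len[OF w(1,2)] w(3) t] by simp
    then show ?thesis using w retr_lift[OF w(1-3)] unfolding cover_le_Suc by auto
  qed
  show "retr k e 1 \<in> cover_le k" if e: "e \<in> cover_le (Suc k)"
    using cases[OF e]
  proof (elim disjE exE conjE)
    assume "e \<in> cover_le k"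
    then show ?thesis by (simp add: retr_def)
  next
    fix w y assume w: "w \<in> carrier G" "len w = Suc k" "y \<in> chamber w" "e = lift w y"
    have ne: "des w \<noteq> {}" using des_of_len w by blast
    have ch: "shrink w y 1 \<in> chamber w" using shrink_in_chamber ne w by simp
    \<comment> \<open>At time 1 a coordinate realising the minimum becomes zero, which puts the
      point on the wall of a descent.\<close>
    have "depth w y \<in> (\<lambda>i. \<bar>y $ i\<bar>) ` des w" unfolding depth_def using ne by (intro Min_in) auto
    then obtain i where "i \<in> des w" "depth w y = \<bar>y $ i\<bar>" by blast
    then have "lift w (shrink w y 1) \<in> cover_le k"
      by (intro wall_in_cover_le[OF w(1,2) ch]) (auto simp: shrink_def)
    then show ?thesis using w retr_lift[OF w(1-3)] by simp
  qed
next
  show "contractible (cover_le 0)"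
  proof -
    have "{w \<in> carrier G. len w \<le> 0} = {\<one>}" using len_pos by force
    then have "cover_le 0 = lift \<one> ` chamber \<one>" by (simp add: cover_le_def)
    moreover have "homeomorphism (chamber \<one>) (lift \<one> ` chamber \<one>) (lift \<one>) fst"
      by (intro homeomorphismI continuous_lift continuous_intros) auto
    then have "chamber \<one> homeomorphic lift \<one> ` chamber \<one>" unfolding homeomorphic_def by blast
    ultimately show ?thesis
      using homeomorphic_contractible_eq convex_imp_contractible[OF convex_chamber] by metis
  qed
next
  fix e assume "e \<in> (\<Union>k. cover_le k)"
  then obtain w y where w: "w \<in> carrier G" "y \<in> chamber w" "e = lift w y"
    by (auto simp: cover_le_def)
  define \<sigma> where "\<sigma> = zeros y"
  have cl: "clique \<sigma>" using w by (simp add: \<sigma>_def chamber_def flag_complement_def)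
  have "e \<in> sheet w \<sigma>" using lift_in_own_sheet[OF w(1,2)] w(3) by (simp add: \<sigma>_def)
  \<comment> \<open>A sheet meets only chambers of \<open>w \<otimes> h\<close> with
    \<open>h\<close> in \<open>par \<sigma>\<close>, and such \<open>h\<close> have length at most
    the number of generators; so it is an open set inside one stage.\<close>
  moreover have "sheet w \<sigma> \<subseteq> cover_le (len w + CARD('d))"
  proof
    fix f assume f: "f \<in> sheet w \<sigma>"
    then obtain v x where v: "v \<in> carrier G" "x \<in> chamber v" "f = lift v x"
      by (auto simp: sheet_def cover_def)
    then have "inv w \<otimes> v \<in> par \<sigma>" using f lift_in_sheet[OF w(1) v(1,2)] by simp
    then have "len (inv w \<otimes> v) \<le> CARD('d)" using len_par cl by blast
    moreover have "v = w \<otimes> (inv w \<otimes> v)" using v w by (simp add: m_assoc[symmetric])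
    then have "len v \<le> len w + len (inv w \<otimes> v)" using len_mult[of w "inv w \<otimes> v"] v w by simp
    ultimately show "f \<in> cover_le (len w + CARD('d))" using v by (auto simp: cover_le_def)
  qed
  ultimately show "\<exists>k N. openin (top_of_set (\<Union>k. cover_le k)) N \<and> e \<in> N \<and> N \<subseteq> cover_le k"
    using openin_sheet[of w \<sigma>] unfolding cover_Union by blast
qed

end

section \<open>Removing coordinate subspaces of codimension at least three\<close>

lemma closed_coordinate_subspace: "closed (coordinate_subspace P :: (real^'d) set)"
  unfolding coordinate_subspace_def Collect_ball_eq
  by (intro closed_INT ballI closed_Collect_eq continuous_on_component continuous_on_id continuous_on_const)

text \<open>
  The bad translations depend differentiably on the two parameters of the plane and on a point of
  the subspace, hence on one parameter fewer than the dimension, so they form a null set.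
\<close>
lemma negligible_bad_translations:
  fixes g :: "complex \<Rightarrow> real^'d"
  assumes g: "polynomial_function g" and P: "card P \<ge> 3"
  shows "\<exists>N. negligible N \<and> (\<forall>z c. g z + c \<in> coordinate_subspace P \<longrightarrow> c \<in> N)"
proof -
  obtain i1 i2 i3 where i: "i1 \<in> P" "i2 \<in> P" "i3 \<in> P" "i1 \<noteq> i2" "i1 \<noteq> i3" "i2 \<noteq> i3"
  proof -
    obtain T where T: "T \<subseteq> P" "card T = 3" using obtain_subset_with_card_n[OF P] by metis
    obtain x y z where "T = {x, y, z}" "x \<noteq> y" "x \<noteq> z" "y \<noteq> z"
      using T(2) unfolding card_3_iff by metis
    then show ?thesis using that[of x y z] T(1) by simp
  qed
  \<comment> \<open>The coordinates \<open>i1\<close>, \<open>i2\<close>, \<open>i3\<close> vanish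
    on \<open>coordinate_subspace P\<close>, so in a parameter vector they are free: the first two
    store the plane parameter, which \<open>l\<close> reads off, the third is set to zero, and
    \<open>k\<close> erases all three.\<close>
  define l where "l y = (of_real (y $ i1) + of_real (y $ i2) * \<i> :: complex)" for y :: "real^'d"
  define k where "k y = (\<chi> i. if i \<in> {i1, i2, i3} then 0 else y $ i)" for y :: "real^'d"
  have "linear l" unfolding l_def by (rule linearI) (auto simp: complex_eq_iff)
  then have "l differentiable_on UNIV" by (rule linear_imp_differentiable_on)
  then have "(\<lambda>y. g (l y)) differentiable_on UNIV"
    by (rule differentiable_on_compose[OF _ differentiable_on_polynomial_function[OF g]])
  moreover have "linear k" unfolding k_def by (rule linearI) (auto simp: vec_eq_iff)
  then have "k differentiable_on UNIV" by (rule linear_imp_differentiable_on)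
  ultimately have "(\<lambda>y. k y - g (l y)) differentiable_on UNIV" by (intro differentiable_on_diff)
  then have "(\<lambda>y. k y - g (l y)) differentiable_on {y. y $ i3 = 0}"
    by (rule differentiable_on_subset) simp
  then have "negligible ((\<lambda>y. k y - g (l y)) ` {y. y $ i3 = 0})"
    by (intro negligible_differentiable_image_negligible negligible_standard_hyperplane_cart) simp_all
  moreover have "c \<in> (\<lambda>y. k y - g (l y)) ` {y. y $ i3 = 0}" if c: "g z + c \<in> coordinate_subspace P" for z c
  proof -
    define y :: "real^'d" where
      "y = (\<chi> i. if i = i1 then Re z else if i = i2 then Im z else if i = i3 then 0 else (g z + c) $ i)"
    have "l y = z" using i by (simp add: l_def y_def complex_eq_iff)
    moreover have "k y = g z + c" using i c by (auto simp: k_def y_def vec_eq_iff coordinate_subspace_def)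
    moreover have "y $ i3 = 0" using i by (simp add: y_def)
    ultimately show ?thesis by (intro image_eqI[of _ _ y]) auto
  qed
  ultimately show ?thesis by blast
qed

text \<open>A null-homotopy is an extension to the disc. A polynomial approximation of it,
  translated by a small vector outside the bad null sets, misses the subspaces altogether, and on
  the circle it is close enough to \<open>f\<close> for a straight-line homotopy.\<close>

lemma nullhomotopic_circle_avoid_codim3:
  fixes f :: "complex \<Rightarrow> real^'d" and S :: "(real^'d) set"
  assumes S: "open S" and \<P>: "\<And>P. P \<in> \<P> \<Longrightarrow> card P \<ge> 3"
    and f: "continuous_on (sphere 0 1) f" "f ` sphere 0 1 \<subseteq> S - (\<Union>P\<in>\<P>. coordinate_subspace P)"
    and null: "\<exists>c. homotopic_with_canon (\<lambda>x. True) (sphere 0 1) S f (\<lambda>x. c)"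
  shows "\<exists>c. homotopic_with_canon (\<lambda>x. True) (sphere 0 1) (S - (\<Union>P\<in>\<P>. coordinate_subspace P)) f (\<lambda>x. c)"
proof -
  define A where "A = (\<Union>P\<in>\<P>. coordinate_subspace P :: (real^'d) set)"
  have "closed A" unfolding A_def by (intro closed_UN) (auto simp: closed_coordinate_subspace)
  then have SA: "open (S - A)" using S by (rule open_Diff[rotated])
  obtain F where F: "continuous_on (cball 0 1) F" "F ` cball 0 1 \<subseteq> S" "\<forall>x\<in>sphere 0 1. F x = f x"
    using null nullhomotopic_from_sphere_extension[of "0::complex" 1 S f] by auto
  obtain e1 where e1: "e1 > 0" "(\<Union>x\<in>F ` cball 0 1. ball x e1) \<subseteq> S"
    using compact_subset_open_imp_ball_epsilon_subset[OF compact_continuous_image[OF F(1) compact_cball] S F(2)] .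
  obtain e2 where e2: "e2 > 0" "(\<Union>x\<in>f ` sphere 0 1. ball x e2) \<subseteq> S - A"
    using compact_subset_open_imp_ball_epsilon_subset[OF compact_continuous_image[OF f(1) compact_sphere] SA]
      f(2) unfolding A_def by blast
  \<comment> \<open>\<open>e1\<close> keeps the perturbed disc in \<open>S\<close>,
    \<open>e2\<close> keeps the segments over the circle off the subspaces. One half of
    \<open>e\<close> is spent on the approximation, the other on the translation.\<close>
  define e where "e = min e1 e2"
  have e: "e > 0" using e1 e2 by (simp add: e_def)
  obtain g where g: "polynomial_function g" "\<forall>x\<in>cball 0 1. norm (F x - g x) < e / 2"
    using Stone_Weierstrass_polynomial_function[OF compact_cball F(1), of "e / 2"] e by auto
  have "\<exists>N. negligible N \<and> (\<forall>z c. g z + c \<in> coordinate_subspace P \<longrightarrow> c \<in> N)" if "P \<in> \<P>" for P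
    using negligible_bad_translations[OF g(1) \<P>[OF that]] .
  then obtain N where N: "\<And>P. P \<in> \<P> \<Longrightarrow> negligible (N P)"
    "\<And>P z c. P \<in> \<P> \<Longrightarrow> g z + c \<in> coordinate_subspace P \<Longrightarrow> c \<in> N P"
    by metis
  have "negligible (\<Union>(N ` \<P>))" using N(1) by (intro negligible_Union) auto
  then have "\<not> ball 0 (e / 2) \<subseteq> \<Union>(N ` \<P>)"
    using open_not_negligible[of "ball (0::real^'d) (e / 2)"] negligible_subset e by auto
  then obtain c where "c \<in> ball 0 (e / 2)" and c': "c \<notin> \<Union>(N ` \<P>)" by blast
  then have c: "norm c < e / 2" by simp
  define h where "h z = g z + c" for z
  have hA: "h z \<notin> A" for z using c' N(2) by (auto simp: A_def h_def)
  have near: "dist (F z) (h z) < e" if "z \<in> cball 0 1" for z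
  proof -
    have "dist (F z) (h z) = norm ((F z - g z) - c)" by (simp add: h_def dist_norm algebra_simps)
    also have "\<dots> \<le> norm (F z - g z) + norm c" by (rule norm_triangle_ineq4)
    also have "\<dots> < e" using g(2) that c by force
    finally show ?thesis .
  qed
  have hc: "continuous_on T h" for T
    unfolding h_def using continuous_on_polymonial_function[OF g(1)] by (intro continuous_intros)
  have "h ` cball 0 1 \<subseteq> S - A"
  proof
    fix x assume "x \<in> h ` cball 0 1"
    then obtain z where z: "z \<in> cball 0 1" "x = h z" by blast
    then have "x \<in> ball (F z) e1" using near[OF z(1)] by (simp add: e_def)
    then show "x \<in> S - A" using e1(2) z hA by blast
  qed
  then obtain b where b: "homotopic_with_canon (\<lambda>x. True) (sphere 0 1) (S - A) h (\<lambda>x. b)"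
    using nullhomotopic_from_sphere_extension[of "0::complex" 1 "S - A" h] hc by blast
  have "homotopic_with_canon (\<lambda>x. True) (sphere 0 1) (S - A) f h"
  proof (rule homotopic_with_linear[OF f(1) hc])
    fix z :: complex assume z: "z \<in> sphere 0 1"
    then have "z \<in> cball 0 1" by simp
    then have "h z \<in> ball (f z) e2" using near[of z] F(3) z by (simp add: e_def)
    then have "closed_segment (f z) (h z) \<subseteq> ball (f z) e2"
      using e2(1) by (intro closed_segment_subset) auto
    then show "closed_segment (f z) (h z) \<subseteq> S - A" using e2(2) z by blast
  qed
  then show ?thesis using homotopic_with_trans[OF _ b] unfolding A_def by blast
qed

lemma homotopic_loops_avoid_codim3:
  fixes p :: "real \<Rightarrow> real^'d"
  assumes S: "open S" and \<P>: "\<And>P. P \<in> \<P> \<Longrightarrow> card P \<ge> 3"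
    and p: "path p" "pathfinish p = pathstart p" "path_image p \<subseteq> S - (\<Union>P\<in>\<P>. coordinate_subspace P)"
    and null: "homotopic_loops S p (linepath a a)"
  shows "\<exists>b. homotopic_loops (S - (\<Union>P\<in>\<P>. coordinate_subspace P)) p (linepath b b)"
proof -
  let ?S = "S - (\<Union>P\<in>\<P>. coordinate_subspace P)"
  define f where "f = p \<circ> (\<lambda>z. Arg2pi z / (2 * pi))"
  have const: "linepath c c \<circ> g = (\<lambda>_. c)" for c :: "real^'d" and g :: "complex \<Rightarrow> real"
    by (auto simp: linepath_refl)
  have "homotopic_loops ?S p p" using p homotopic_loops_refl by blast
  then have "homotopic_with_canon (\<lambda>x. True) (sphere 0 1) ?S f f"
    unfolding f_def by (rule homotopic_loops_imp_homotopic_circlemaps)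
  then have "continuous_on (sphere 0 1) f" "f ` sphere 0 1 \<subseteq> ?S"
    using homotopic_with_imp_continuous homotopic_with_imp_subset1 by blast+
  moreover have "homotopic_with_canon (\<lambda>x. True) (sphere 0 1) S f (\<lambda>x. a)"
    using homotopic_loops_imp_homotopic_circlemaps[OF null] unfolding const f_def by simp
  ultimately obtain c where "homotopic_with_canon (\<lambda>x. True) (sphere 0 1) ?S f (\<lambda>x. c)"
    using nullhomotopic_circle_avoid_codim3[OF S \<P>, of \<P> f] by blast
  from homotopic_circlemaps_imp_homotopic_loops[OF this]
  have *: "homotopic_loops ?S (f \<circ> exp \<circ> (\<lambda>t. 2 * of_real pi * of_real t * \<i>)) (linepath c c)"
    by (simp add: o_def linepath_refl)
  have "homotopic_loops ?S p (f \<circ> exp \<circ> (\<lambda>t. 2 * of_real pi * of_real t * \<i>))"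
  proof (rule homotopic_loops_eq[OF p(1,3,2)])
    fix t :: real assume t: "t \<in> {0..1}"
    show "p t = (f \<circ> exp \<circ> (\<lambda>t. 2 * of_real pi * of_real t * \<i>)) t"
    proof (cases "t = 1")
      \<comment> \<open>At the endpoint \<open>Arg2pi\<close> jumps back to 0, so agreement there
        rests on the loop being closed.\<close>
      case True
      have "Arg2pi 1 = 0" using Arg2pi_exp[of 0] by simp
      moreover have "exp (2 * of_real pi * of_real 1 * \<i>) = 1" using exp_two_pi_i by (simp add: mult.commute)
      ultimately show ?thesis using p(2) True by (simp add: f_def pathfinish_def pathstart_def)
    next
      case False
      have "Arg2pi (exp (2 * of_real pi * of_real t * \<i>)) = 2 * pi * t"
        using t False by (subst Arg2pi_exp) auto
      then show ?thesis by (simp add: f_def)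
    qed
  qed
  then show ?thesis using * homotopic_loops_trans by blast
qed

lemma homotopic_paths_imp_loop_null:
  assumes "homotopic_paths S p q"
  shows "homotopic_loops S (p +++ reversepath q) (linepath (pathstart p) (pathstart p))"
proof -
  have pq: "path p" "path_image p \<subseteq> S" "path q" "pathfinish p = pathfinish q" "pathstart p = pathstart q"
    using assms homotopic_paths_imp_path homotopic_paths_imp_subset homotopic_paths_imp_pathfinish
      homotopic_paths_imp_pathstart by blast+
  have "homotopic_paths S (reversepath q) (reversepath p)"
    using assms homotopic_paths_reversepath homotopic_paths_sym by blast
  then have "homotopic_paths S (p +++ reversepath q) (p +++ reversepath p)"
    using pq by (intro homotopic_paths_join) auto
  then have "homotopic_paths S (p +++ reversepath q) (linepath (pathstart p) (pathstart p))"
    using homotopic_paths_rinv[OF pq(1,2)] homotopic_paths_trans by blast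
  then show ?thesis using pq by (intro homotopic_paths_imp_homotopic_loops) auto
qed

lemma homotopic_paths_avoid_codim3:
  fixes p q :: "real \<Rightarrow> real^'d"
  assumes S: "open S" and \<P>: "\<And>P. P \<in> \<P> \<Longrightarrow> card P \<ge> 3"
    and p: "path_image p \<subseteq> S - (\<Union>P\<in>\<P>. coordinate_subspace P)"
    and q: "path_image q \<subseteq> S - (\<Union>P\<in>\<P>. coordinate_subspace P)"
    and pq: "homotopic_paths S p q"
  shows "homotopic_paths (S - (\<Union>P\<in>\<P>. coordinate_subspace P)) p q"
proof -
  have *: "path p" "path q" "pathfinish p = pathfinish q" "pathstart p = pathstart q"
    using pq homotopic_paths_imp_path homotopic_paths_imp_pathfinish
      homotopic_paths_imp_pathstart by blast+
  have "\<exists>b. homotopic_loops (S - (\<Union>P\<in>\<P>. coordinate_subspace P)) (p +++ reversepath q) (linepath b b)"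
    by (rule homotopic_loops_avoid_codim3[OF S \<P> _ _ _ homotopic_paths_imp_loop_null[OF pq]])
      (use * p q in \<open>auto simp: path_image_join\<close>)
  then show ?thesis using homotopic_paths_loop_parts *(2) by blast
qed

section \<open>Coordinate arrangements of simplicial complexes\<close>

definition minimal_nonface :: "('d set \<Rightarrow> bool) \<Rightarrow> 'd set \<Rightarrow> bool" where
  "minimal_nonface K P \<longleftrightarrow> \<not> K P \<and> (\<forall>Q. Q \<subset> P \<longrightarrow> K Q)"

lemma minimal_nonface_exists:
  fixes P :: "'d::finite set"
  assumes "\<not> K P"
  shows "\<exists>Q\<subseteq>P. minimal_nonface K Q"
proof -
  have "finite P" by simp
  then show ?thesis using assms
  proof (induction P rule: finite_psubset_induct)
    case (psubset P)
    show ?case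
    proof (cases "\<exists>Q. Q \<subset> P \<and> \<not> K Q")
      case True
      then obtain Q where Q: "Q \<subset> P" "\<not> K Q" by blast
      then obtain R where "R \<subseteq> Q" "minimal_nonface K R" using psubset.IH by blast
      then show ?thesis using Q(1) by blast
    next
      case False
      then show ?thesis using psubset.prems unfolding minimal_nonface_def by blast
    qed
  qed
qed

lemma coordinate_subspace_zeros: "y \<in> coordinate_subspace P \<longleftrightarrow> P \<subseteq> zeros y"
  by (auto simp: coordinate_subspace_def zeros_def)

lemma dim_coordinate_subspace:
  "dim (coordinate_subspace P :: (real^'d::finite) set) + card P = CARD('d)"
proof -
  have "(coordinate_subspace P :: (real^'d) set) = {x. \<forall>i\<in>P. x $ i = 0}"
    by (simp add: coordinate_subspace_def)
  also have "\<dots> = {x::real^'d. \<forall>i. i \<notin> - P \<longrightarrow> x $ i = 0}" by auto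
  finally have "dim (coordinate_subspace P :: (real^'d) set) = card (- P)"
    using dim_substandard_cart[of "- P", where 'a = real] by (simp add: dim_vec_eq)
  then show ?thesis
    using card_mono[of UNIV P] by (simp add: Compl_eq_Diff_UNIV card_Diff_subset)
qed

text \<open>Take a point \<open>z\<close> of \<open>V\<close> with fewest zeros. If some
  \<open>y\<close> were nonzero at a zero of \<open>z\<close>, then \<open>z + t y\<close> would
  have fewer zeros for all but finitely many \<open>t\<close>. This puts a subspace covered by
  coordinate subspaces inside a single one.\<close>

lemma subspace_generic_point:
  fixes V :: "(real^'d::finite) set"
  assumes V: "subspace V"
  shows "\<exists>z\<in>V. \<forall>y\<in>V. zeros z \<subseteq> zeros y"
proof -
  define z where "z = arg_min (\<lambda>y. card (zeros y)) (\<lambda>y. y \<in> V)"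
  have z: "z \<in> V" "\<And>y. y \<in> V \<Longrightarrow> card (zeros z) \<le> card (zeros y)"
    using arg_min_nat_lemma[of "\<lambda>y. y \<in> V" 0 "\<lambda>y. card (zeros y)"] subspace_0[OF V]
    by (auto simp: z_def)
  have "i \<in> zeros y" if y: "y \<in> V" and i: "i \<in> zeros z" for y i
  proof (rule ccontr)
    assume yi: "i \<notin> zeros y"
    \<comment> \<open>Excludes zero and the finitely many ratios at which a nonzero coordinate of
      \<open>z\<close> would be cancelled.\<close>
    obtain t :: real where t: "t \<notin> insert 0 (range (\<lambda>j. - z $ j / y $ j))"
      using ex_new_if_finite[OF infinite_UNIV_char_0, of "insert 0 (range (\<lambda>j. - z $ j / y $ j))"] by auto
    have "z $ j + t * y $ j \<noteq> 0" if "z $ j \<noteq> 0" for j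
    proof
      assume eq: "z $ j + t * y $ j = 0"
      then have "y $ j \<noteq> 0" using that by auto
      then have "t = - z $ j / y $ j" using eq by (simp add: field_simps)
      then show False using t by blast
    qed
    then have "zeros (z + t *\<^sub>R y) \<subseteq> zeros z" by (auto simp: zeros_def)
    moreover have "i \<notin> zeros (z + t *\<^sub>R y)" using i yi t by (auto simp: zeros_def)
    ultimately have "card (zeros (z + t *\<^sub>R y)) < card (zeros z)"
      using i by (intro psubset_card_mono) auto
    moreover have "z + t *\<^sub>R y \<in> V" using z(1) y V by (simp add: subspace_add subspace_scale)
    ultimately show False using z(2) by fastforce
  qed
  then show ?thesis using z(1) by blast
qed

lemma subspace_coordinate_subspace: "subspace (coordinate_subspace P)"
  by (auto simp: coordinate_subspace_def subspace_def)

context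
  fixes K :: "'d::finite set \<Rightarrow> bool"
  assumes K_subset: "\<And>P Q. K P \<Longrightarrow> Q \<subseteq> P \<Longrightarrow> K Q"
    and K_singleton: "\<And>i. K {i}"
begin

lemma complement_eq_faces:
  "- (\<Union>P\<in>{P. minimal_nonface K P}. coordinate_subspace P) = {y. K (zeros y)}"
proof -
  have "(\<exists>P. minimal_nonface K P \<and> P \<subseteq> zeros y) \<longleftrightarrow> \<not> K (zeros y)" for y :: "real^'d"
  proof
    assume "\<exists>P. minimal_nonface K P \<and> P \<subseteq> zeros y"
    then obtain P where "minimal_nonface K P" "P \<subseteq> zeros y" by blast
    then show "\<not> K (zeros y)" using K_subset[of "zeros y" P] by (auto simp: minimal_nonface_def)
  next
    assume "\<not> K (zeros y)"
    then show "\<exists>P. minimal_nonface K P \<and> P \<subseteq> zeros y" using minimal_nonface_exists by blast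
  qed
  then show ?thesis
    unfolding set_eq_iff Compl_iff UN_iff mem_Collect_eq coordinate_subspace_zeros Bex_def by simp
qed

lemma minimal_nonface_card:
  assumes "minimal_nonface K P" shows "card P \<ge> 2"
proof (rule ccontr)
  assume "\<not> ?thesis"
  then have "card P \<le> Suc 0" by simp
  then obtain i where "P \<subseteq> {i}" by (cases "P = {}") (auto simp: card_le_Suc0_iff_eq)
  then have "K P" using K_subset K_singleton by metis
  then show False using assms by (simp add: minimal_nonface_def)
qed

lemma face_pairs: "K \<sigma> \<Longrightarrow> i \<in> \<sigma> \<Longrightarrow> j \<in> \<sigma> \<Longrightarrow> K {i, j}"
  using K_subset[of \<sigma> "{i, j}"] by simp

lemma flag_face:
  assumes "\<And>P. minimal_nonface K P \<Longrightarrow> card P = 2"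
    and "\<And>i j. i \<in> \<sigma> \<Longrightarrow> j \<in> \<sigma> \<Longrightarrow> i \<noteq> j \<Longrightarrow> K {i, j}"
  shows "K \<sigma>"
proof (rule ccontr)
  assume "\<not> K \<sigma>"
  then obtain P where P: "P \<subseteq> \<sigma>" "minimal_nonface K P" using minimal_nonface_exists by blast
  have "card P = 2" using assms(1) P(2) .
  then obtain i j where "P = {i, j}" "i \<noteq> j" by (auto simp: card_2_iff)
  then show False using P assms(2)[of i j] by (auto simp: minimal_nonface_def)
qed

text \<open>The flag condition already accounts for the minimal nonfaces with two elements, so only
  subspaces of codimension at least three remain to be removed.\<close>

lemma complement_flag:
  "{y. K (zeros y)} = {y. \<forall>i\<in>zeros y. \<forall>j\<in>zeros y. i \<noteq> j \<longrightarrow> K {i, j}}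
     - (\<Union>P\<in>{P. minimal_nonface K P \<and> card P \<ge> 3}. coordinate_subspace P)" (is "?A = ?B - ?C")
proof (intro equalityI subsetI)
  fix y assume y: "y \<in> ?A"
  then have "\<not> P \<subseteq> zeros y" if "minimal_nonface K P" for P
    using that K_subset[of "zeros y" P] by (auto simp: minimal_nonface_def)
  then show "y \<in> ?B - ?C" using y face_pairs by (auto simp: coordinate_subspace_zeros)
next
  fix y assume y: "y \<in> ?B - ?C"
  show "y \<in> ?A"
  proof (rule ccontr)
    assume "y \<notin> ?A"
    then obtain P where P: "P \<subseteq> zeros y" "minimal_nonface K P" using minimal_nonface_exists[of K "zeros y"] by blast
    show False
    proof (cases "card P = 2")
      case True
      then obtain i j where "P = {i, j}" "i \<noteq> j" by (auto simp: card_2_iff)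
      then have "K P" using y P(1) by auto
      then show False using P(2) by (simp add: minimal_nonface_def)
    next
      case False
      then have "card P \<ge> 3" using minimal_nonface_card[OF P(2)] by simp
      then show False using y P by (auto simp: coordinate_subspace_zeros)
    qed
  qed
qed

text \<open>The subspaces on the left are arbitrary. For a minimal nonface \<open>P\<close> take a
  point whose zeros are exactly \<open>P\<close>: a subspace of codimension two through it lies in
  \<open>coordinate_subspace Q\<close> for a minimal nonface \<open>Q\<close>, so \<open>Q\<close>
  has two elements, and \<open>Q \<subseteq> P\<close> forces equality by minimality.\<close>

lemma union_codim2_iff:
  "(\<exists>\<V>. (\<forall>V\<in>\<V>. subspace V \<and> dim V + 2 = CARD('d)) \<and>
        (\<Union>P\<in>{P. minimal_nonface K P}. coordinate_subspace P :: (real^'d) set) = \<Union>\<V>)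
   \<longleftrightarrow> (\<forall>P. minimal_nonface K P \<longrightarrow> card P = 2)" (is "?L \<longleftrightarrow> ?R")
proof
  let ?A = "\<Union>P\<in>{P. minimal_nonface K P}. coordinate_subspace P :: (real^'d) set"
  assume ?R
  then show ?L
  proof (intro exI[of _ "coordinate_subspace ` {P. minimal_nonface K P}"] conjI ballI refl)
    fix V :: "(real^'d) set" assume "V \<in> coordinate_subspace ` {P. minimal_nonface K P}"
    then obtain P where P: "minimal_nonface K P" "V = coordinate_subspace P" by blast
    then have "card P = 2" using \<open>?R\<close> by blast
    then show "dim V + 2 = CARD('d)" using dim_coordinate_subspace[of P] P(2) by simp
    show "subspace V" using P(2) subspace_coordinate_subspace by simp
  qed simp
next
  let ?A = "\<Union>P\<in>{P. minimal_nonface K P}. coordinate_subspace P :: (real^'d) set"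
  assume ?L
  then obtain \<V> where \<V>: "\<And>V. V \<in> \<V> \<Longrightarrow> subspace V \<and> dim V + 2 = CARD('d)" "?A = \<Union>\<V>" by blast
  show ?R
  proof (intro allI impI)
    fix P assume P: "minimal_nonface K P"
    define x :: "real^'d" where "x = (\<chi> i. if i \<in> P then 0 else 1)"
    have zx: "zeros x = P" by (auto simp: x_def zeros_def)
    then have "x \<in> ?A" using P by (auto simp: coordinate_subspace_zeros)
    then obtain V where V: "V \<in> \<V>" "x \<in> V" using \<V>(2) by blast
    have sV: "subspace V" "dim V + 2 = CARD('d)" using \<V>(1)[OF V(1)] by auto
    obtain z where z: "z \<in> V" "\<And>y. y \<in> V \<Longrightarrow> zeros z \<subseteq> zeros y"
      using subspace_generic_point[OF sV(1)] by blast
    have "z \<in> \<Union>\<V>" using V(1) z(1) by blast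
    then have "z \<in> ?A" by (simp only: \<V>(2))
    then obtain Q where Q: "minimal_nonface K Q" "Q \<subseteq> zeros z"
      by (auto simp: coordinate_subspace_zeros)
    then have "V \<subseteq> coordinate_subspace Q" using z(2) Q(2) unfolding subset_iff[of V] coordinate_subspace_zeros by blast
    with Q(1) have "\<exists>Q. minimal_nonface K Q \<and> V \<subseteq> coordinate_subspace Q" by blast
    then obtain Q where Q: "minimal_nonface K Q" "V \<subseteq> coordinate_subspace Q" by blast
    have "dim V \<le> dim (coordinate_subspace Q :: (real^'d) set)" using Q(2) by (rule dim_subset)
    then have "card Q \<le> 2" using sV(2) dim_coordinate_subspace[of Q] by linarith
    then have "card Q = 2" using minimal_nonface_card[OF Q(1)] by simp
    moreover have "x \<in> coordinate_subspace Q" using Q(2) V(2) by blast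
    then have "Q \<subseteq> P" using zx by (simp add: coordinate_subspace_zeros)
    then have "Q = P" using P Q(1) unfolding minimal_nonface_def by blast
    ultimately show "card P = 2" by simp
  qed
qed

end

section \<open>The fundamental group\<close>

lemma path_class_mult:
  assumes "p \<in> loops_at S a" "q \<in> loops_at S a"
  shows "{r. homotopic_paths S p r} \<otimes>\<^bsub>fundamental_group S a\<^esub> {r. homotopic_paths S q r}
           = {r. homotopic_paths S (p +++ q) r}"
proof (intro equalityI subsetI)
  fix r assume "r \<in> {r. homotopic_paths S p r} \<otimes>\<^bsub>fundamental_group S a\<^esub> {r. homotopic_paths S q r}"
  then obtain p' q' where *: "homotopic_paths S p p'" "homotopic_paths S q q'" "homotopic_paths S (p' +++ q') r"
    by (auto simp: fundamental_group_def)
  have "homotopic_paths S (p +++ q) (p' +++ q')"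
    using * assms by (intro homotopic_paths_join) (auto simp: loops_at_def)
  then show "r \<in> {r. homotopic_paths S (p +++ q) r}" using *(3) homotopic_paths_trans by blast
next
  fix r assume "r \<in> {r. homotopic_paths S (p +++ q) r}"
  moreover have "homotopic_paths S p p" "homotopic_paths S q q"
    using assms by (auto simp: loops_at_def)
  ultimately show "r \<in> {r. homotopic_paths S p r} \<otimes>\<^bsub>fundamental_group S a\<^esub> {r. homotopic_paths S q r}"
    unfolding fundamental_group_def monoid.simps mem_Collect_eq by blast
qed

lemma path_class_eq:
  "{r. homotopic_paths S p r} = {r. homotopic_paths S q r} \<longleftrightarrow> homotopic_paths S p q"
  if "homotopic_paths S q q"
  using that homotopic_paths_sym homotopic_paths_trans by blast

locale racg_complex = countable_racg G s adj cnt des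
  for G :: "'w monoid" (structure) and s :: "'d::finite \<Rightarrow> 'w"
    and adj :: "'d \<Rightarrow> 'd \<Rightarrow> bool" and cnt des +
  fixes K :: "'d set \<Rightarrow> bool"
  assumes K_subset: "\<And>P Q. K P \<Longrightarrow> Q \<subseteq> P \<Longrightarrow> K Q"
    and K_singleton: "\<And>i. K {i}"
    and adj_iff: "\<And>i j. adj i j \<longleftrightarrow> K {i, j}"
begin

lemma sg_eq_1_iff: "sg w i = 1 \<longleftrightarrow> even (cnt w i)"
  by (simp add: sg_def minus_one_power_iff)

definition complement :: "(real^'d) set" where
  "complement = {y. K (zeros y)}"

definition cover_of :: "'d pos set" where
  "cover_of = {e \<in> cover. K (zeros (fst e))}"

lemma flag_complement_eq: "flag_complement = {y. \<forall>i\<in>zeros y. \<forall>j\<in>zeros y. i \<noteq> j \<longrightarrow> K {i, j}}"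
  by (auto simp: flag_complement_def clique_def adj_iff)

lemma complement_eq:
  "complement = flag_complement - (\<Union>P\<in>{P. minimal_nonface K P \<and> card P \<ge> 3}. coordinate_subspace P)"
  unfolding complement_def flag_complement_eq by (rule complement_flag[where K = K, OF K_subset K_singleton])

lemma complement_subset: "complement \<subseteq> flag_complement"
  unfolding complement_eq by blast

lemma open_flag_complement: "open flag_complement"
proof -
  have "flag_complement = - (\<Union>P\<in>{P. minimal_nonface clique P}. coordinate_subspace P)"
    unfolding flag_complement_def
    by (rule complement_eq_faces[symmetric]) (auto simp: clique_def)
  moreover have "closed (\<Union>P\<in>{P. minimal_nonface clique P}. coordinate_subspace P :: (real^'d) set)"
    by (intro closed_UN) (simp_all add: closed_coordinate_subspace)
  ultimately show ?thesis using open_Compl by metis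
qed

lemma fst_cover_of: "fst ` cover_of \<subseteq> complement"
  by (auto simp: cover_of_def complement_def)

text \<open>The paths are homotopic in the contractible \<open>cover\<close>; the homotopy is
  projected to \<open>flag_complement\<close> and then replaced by one off the subspaces of
  codimension at least three. This does the work of simple connectedness of
  \<open>cover_of\<close>.\<close>

lemma homotopic_projections:
  assumes p: "path p" "path_image p \<subseteq> cover_of" and q: "path q" "path_image q \<subseteq> cover_of"
    and pq: "pathstart p = pathstart q" "pathfinish p = pathfinish q"
  shows "homotopic_paths complement (fst \<circ> p) (fst \<circ> q)"
proof -
  have sub: "cover_of \<subseteq> cover" by (auto simp: cover_of_def)
  have "simply_connected cover" by (rule contractible_imp_simply_connected[OF contractible_cover])
  then have "homotopic_paths cover p q"
    using p q pq order_trans[OF p(2) sub] order_trans[OF q(2) sub]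
    by (intro simply_connected_eq_homotopic_paths[THEN iffD1, THEN conjunct2, rule_format]) simp_all
  moreover have "continuous_on cover (fst :: 'd pos \<Rightarrow> real^'d)" by (intro continuous_intros)
  moreover have "(fst :: 'd pos \<Rightarrow> real^'d) \<in> cover \<rightarrow> flag_complement" using fst_cover by blast
  ultimately have "homotopic_paths flag_complement (fst \<circ> p) (fst \<circ> q)"
    by (rule homotopic_paths_continuous_image)
  moreover have "path_image (fst \<circ> p) \<subseteq> complement" "path_image (fst \<circ> q) \<subseteq> complement"
    using p(2) q(2) fst_cover_of unfolding path_image_compose by blast+
  ultimately show ?thesis
    unfolding complement_eq
    by (intro homotopic_paths_avoid_codim3[OF open_flag_complement]) simp_all
qed

lemma convex_face_chamber: "convex {y \<in> complement. \<forall>i. 0 \<le> sg w i * y $ i}"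
  using convex_orthant_downclosed[of K "sg w"] K_subset by (simp add: complement_def sg_def)

lemma face_chamber_subset: "{y \<in> complement. \<forall>i. 0 \<le> sg w i * y $ i} \<subseteq> chamber w"
  using complement_subset by (auto simp: chamber_def)

lemma path_component_chamber:
  assumes "w \<in> carrier G" "x \<in> complement" "\<forall>i. 0 \<le> sg w i * x $ i" "y \<in> complement" "\<forall>i. 0 \<le> sg w i * y $ i"
  shows "path_component cover_of (lift w x) (lift w y)"
proof -
  let ?C = "{y \<in> complement. \<forall>i. 0 \<le> sg w i * y $ i}"
  have "path_connected (lift w ` ?C)"
    by (intro path_connected_continuous_image continuous_lift assms convex_imp_path_connected convex_face_chamber)
  moreover have "lift w ` ?C \<subseteq> cover_of"
    using face_chamber_subset[of w] lift_in_cover[OF assms(1)] by (auto simp: cover_of_def complement_def)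
  ultimately show ?thesis
    using assms by (intro path_component_of_subset[of "lift w ` ?C" cover_of])
      (auto intro!: path_connected_component[THEN iffD1, rule_format])
qed

text \<open>Neighbouring chambers \<open>w\<close> and \<open>w \<otimes> s i\<close> share a point
  whose only zero coordinate is \<open>i\<close>; it lies in \<open>cover_of\<close> because
  singletons are faces. Chains of generators connect all chambers.\<close>

lemma path_connected_cover_of: "path_connected cover_of"
proof -
  define c where "c w = (\<chi> i. sg w i)" for w
  have zc: "zeros (c w) = {}" for w by (simp add: zeros_def c_def sg_def)
  have K_empty: "K {}" using K_singleton[of undefined] by (rule K_subset) simp
  have cc: "c w \<in> complement" "\<forall>i. 0 \<le> sg w i * c w $ i" for w
    using zc K_empty by (simp_all add: complement_def c_def)
  have adjacent: "path_component cover_of (lift w (c w)) (lift (w \<otimes> s i) (c (w \<otimes> s i)))" if w: "w \<in> carrier G" for w i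
  proof -
    have ws: "w \<otimes> s i \<in> carrier G" using w by simp
    define m where "m = (\<chi> j. if j = i then 0 else sg w j)"
    have other: "sg (w \<otimes> s i) j = sg w j" if "i \<noteq> j" for j
      using cnt_other[OF w that] by (simp add: sg_def)
    have "zeros m = {i}" by (auto simp: zeros_def m_def sg_def)
    then have m: "m \<in> complement" using K_singleton by (simp add: complement_def)
    have m1: "\<forall>j. 0 \<le> sg w j * m $ j" by (simp add: m_def)
    have m2: "\<forall>j. 0 \<le> sg (w \<otimes> s i) j * m $ j" using other by (auto simp: m_def)
    have "inv w \<otimes> (w \<otimes> s i) = s i" using w by (simp add: m_assoc[symmetric])
    then have eq: "lift w m = lift (w \<otimes> s i) m"
      using lift_eq[OF w ws] s_in_par[of i "zeros m"] \<open>zeros m = {i}\<close> by simp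
    have "path_component cover_of (lift w (c w)) (lift w m)"
      using path_component_chamber[OF w cc m m1] .
    moreover have "path_component cover_of (lift (w \<otimes> s i) m) (lift (w \<otimes> s i) (c (w \<otimes> s i)))"
      using path_component_chamber[OF ws m m2 cc] .
    ultimately show ?thesis unfolding eq by (rule path_component_trans)
  qed
  have base: "path_component cover_of (lift \<one> (c \<one>)) (lift w (c w))" if "w \<in> carrier G" for w
    using that
  proof (induction rule: len_induct)
    case one
    show ?case using path_component_chamber[OF one_closed cc cc] .
  next
    case (step w i)
    then show ?case
      using path_component_trans[OF step(3) adjacent[OF step(1)]] by blast
  qed
  have "path_component cover_of (lift \<one> (c \<one>)) e" if e: "e \<in> cover_of" for e
  proof -
    obtain w y where w: "w \<in> carrier G" "y \<in> chamber w" "e = lift w y"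
      using e by (auto simp: cover_of_def cover_def)
    then have "y \<in> complement" using e by (simp add: cover_of_def complement_def)
    then have "path_component cover_of (lift w (c w)) e"
      using path_component_chamber[OF w(1) cc] w by (simp add: chamber_def)
    then show ?thesis by (rule path_component_trans[OF base[OF w(1)]])
  qed
  then show ?thesis
    unfolding path_connected_component by (blast intro: path_component_sym path_component_trans)
qed

text \<open>Left multiplication by \<open>g\<close> on labels of chambers, a deck transformation
  when all signs of \<open>g\<close> are 1. The choice of label does not matter, because left
  multiplication preserves the quotients \<open>inv w \<otimes> v\<close> in the gluing
  relation.\<close>

definition translate :: "'w \<Rightarrow> 'd pos \<Rightarrow> 'd pos" where
  "translate g e = lift (g \<otimes> (SOME w. w \<in> carrier G \<and> fst e \<in> chamber w \<and> e = lift w (fst e))) (fst e)"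

lemma fst_translate [simp]: "fst (translate g e) = fst e"
  by (simp add: translate_def)

lemma inv_mult_cancel: "g \<in> carrier G \<Longrightarrow> w \<in> carrier G \<Longrightarrow> v \<in> carrier G \<Longrightarrow> inv (g \<otimes> w) \<otimes> (g \<otimes> v) = inv w \<otimes> v"
  by (simp add: inv_mult_group m_assoc) (simp add: m_assoc[symmetric])

lemma translate_lift:
  assumes "g \<in> carrier G" "w \<in> carrier G" "y \<in> chamber w"
  shows "translate g (lift w y) = lift (g \<otimes> w) y"
proof -
  define v where "v = (SOME v. v \<in> carrier G \<and> y \<in> chamber v \<and> lift w y = lift v y)"
  have v: "v \<in> carrier G \<and> y \<in> chamber v \<and> lift w y = lift v y"
    unfolding v_def by (rule someI[of _ w]) (use assms in simp)
  then have "inv w \<otimes> v \<in> par (zeros y)" using lift_eq assms by blast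
  then have "lift (g \<otimes> w) y = lift (g \<otimes> v) y"
    using lift_eq[of "g \<otimes> w" "g \<otimes> v"] inv_mult_cancel[of g w v] v assms by simp
  then show ?thesis by (simp add: translate_def v_def)
qed

lemma chamber_translate:
  assumes "g \<in> carrier G" "w \<in> carrier G" "\<And>i. sg g i = 1"
  shows "chamber (g \<otimes> w) = chamber w" "patch (g \<otimes> w) \<sigma> = patch w \<sigma>"
  using assms by (simp_all add: chamber_def patch_def sg_mult)

lemma translate_in_cover_of:
  assumes "g \<in> carrier G" "\<And>i. sg g i = 1" "e \<in> cover_of"
  shows "translate g e \<in> cover_of"
proof -
  obtain w y where w: "w \<in> carrier G" "y \<in> chamber w" "e = lift w y"
    using assms(3) by (auto simp: cover_of_def cover_def)
  then show ?thesis
    using assms translate_lift[OF assms(1) w(1,2)] chamber_translate(1)[OF assms(1) w(1) assms(2)]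
      lift_in_cover[of "g \<otimes> w" y] by (simp add: cover_of_def)
qed

text \<open>On a sheet, translation is the projection followed by the section of the translated
  sheet, which lies over the same patch.\<close>

lemma continuous_translate:
  assumes g: "g \<in> carrier G" "\<And>i. sg g i = 1"
  shows "continuous_on cover (translate g)"
proof (rule continuous_on_locally)
  fix e assume "e \<in> cover"
  then obtain w y where w: "w \<in> carrier G" "y \<in> chamber w" "e = lift w y"
    by (auto simp: cover_def)
  define \<sigma> where "\<sigma> = zeros y"
  have cl: "clique \<sigma>" using w by (simp add: \<sigma>_def chamber_def flag_complement_def)
  have gw: "g \<otimes> w \<in> carrier G" using g w by simp
  have "continuous_on (patch (g \<otimes> w) \<sigma>) (section_on (g \<otimes> w) \<sigma>)"
    using homeomorphism_sheet[OF cl gw] homeomorphism_cont2 by blast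
  then have "continuous_on (sheet w \<sigma>) (\<lambda>f. section_on (g \<otimes> w) \<sigma> (fst f))"
    by (rule continuous_on_compose2)
      (auto intro!: continuous_intros simp: sheet_def chamber_translate(2)[OF g(1) w(1) g(2)])
  then have "continuous_on (sheet w \<sigma>) (translate g)"
  proof (rule continuous_on_eq)
    fix f assume f: "f \<in> sheet w \<sigma>"
    then obtain v x where v: "v \<in> carrier G" "x \<in> chamber v" "f = lift v x"
      by (auto simp: sheet_def cover_def)
    have "inv w \<otimes> v \<in> par \<sigma>" using f v lift_in_sheet[OF w(1) v(1,2)] by simp
    then show "section_on (g \<otimes> w) \<sigma> (fst f) = translate g f"
      using section_on_eq[OF cl gw, of "g \<otimes> v" x] g w v translate_lift[OF g(1) v(1,2)]
      by (simp add: inv_mult_cancel chamber_translate(1))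
  qed
  moreover have "e \<in> sheet w \<sigma>" using w lift_in_own_sheet by (simp add: \<sigma>_def)
  ultimately show "\<exists>N. openin (top_of_set cover) N \<and> e \<in> N \<and> continuous_on N (translate g)"
    using openin_sheet by blast
qed

text \<open>The points \<open>pt g\<close> over \<open>a\<close> are the translates of one base
  point by the commutator subgroup. The class attached to \<open>g\<close> is the projection of a
  path from \<open>pt \<one>\<close> to \<open>pt g\<close>; \<open>homotopic_projections\<close>
  makes it independent of the path.\<close>

theorem fundamental_group_complement:
  assumes a: "a \<in> complement"
  shows "fundamental_group complement a \<cong> commutator_subgroup G"
proof -
  obtain w0 where w0: "w0 \<in> carrier G" "\<forall>i. 0 \<le> sg w0 i * a $ i" using sg_exists by blast
  have aw0: "a \<in> chamber w0" using a w0 complement_subset by (auto simp: chamber_def)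
  let ?H = "derived G (carrier G)"
  interpret H: subgroup ?H G by (rule derived_is_subgroup) simp
  have Hc: "g \<in> carrier G" if "g \<in> ?H" for g using that by (rule H.mem_carrier)
  have Hs: "sg g i = 1" if "g \<in> ?H" for g i using that by (simp add: derived_iff sg_def)
  define pt where "pt g = lift (g \<otimes> w0) a" for g
  have pt_in: "pt g \<in> cover_of" if "g \<in> ?H" for g
    using lift_in_cover[of "g \<otimes> w0" a] chamber_translate(1)[OF Hc[OF that] w0(1) Hs[OF that]] aw0 a w0 Hc[OF that]
    by (simp add: pt_def cover_of_def complement_def)
  have pt_fst: "fst (pt g) = a" for g by (simp add: pt_def)
  have "\<exists>p. path p \<and> path_image p \<subseteq> cover_of \<and> pathstart p = pt \<one> \<and> pathfinish p = pt g" if "g \<in> ?H" for g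
    using path_connected_cover_of pt_in[OF that] pt_in[OF H.one_closed] unfolding path_connected_def by blast
  then obtain \<gamma> where \<gamma>: "path (\<gamma> g)" "path_image (\<gamma> g) \<subseteq> cover_of" "pathstart (\<gamma> g) = pt \<one>" "pathfinish (\<gamma> g) = pt g"
    if "g \<in> ?H" for g
    by metis
  define \<Theta> where "\<Theta> g = {r. homotopic_paths complement (fst \<circ> \<gamma> g) r}" for g
  have loop: "fst \<circ> p \<in> loops_at complement a"
    if "path p" "path_image p \<subseteq> cover_of" "fst (pathstart p) = a" "fst (pathfinish p) = a" for p :: "real \<Rightarrow> 'd pos"
  proof -
    have "path (fst \<circ> p)" using that(1) by (intro path_continuous_image continuous_intros)
    moreover have "path_image (fst \<circ> p) \<subseteq> complement"
      using that(2) fst_cover_of by (auto simp: path_image_compose)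
    ultimately show ?thesis using that by (simp add: loops_at_def pathstart_compose pathfinish_compose)
  qed
  have \<gamma>loop: "fst \<circ> \<gamma> g \<in> loops_at complement a" if "g \<in> ?H" for g
    using \<gamma>[OF that] by (intro loop) (simp_all add: pt_fst)
  have carr: "carrier (fundamental_group complement a)
      = (\<lambda>p. {r. homotopic_paths complement p r}) ` loops_at complement a"
    by (auto simp: fundamental_group_def quotient_def)
  have hom: "\<Theta> (g \<otimes> h) = \<Theta> g \<otimes>\<^bsub>fundamental_group complement a\<^esub> \<Theta> h" if gh: "g \<in> ?H" "h \<in> ?H" for g h
  proof -
    have g: "g \<in> carrier G" "\<And>i. sg g i = 1" using Hc Hs gh by auto
    let ?q = "translate g \<circ> \<gamma> h"
    have sub: "path_image (\<gamma> h) \<subseteq> cover" using \<gamma>(2)[OF gh(2)] by (auto simp: cover_of_def)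
    have q: "path ?q" using \<gamma>(1)[OF gh(2)] continuous_on_subset[OF continuous_translate[OF g] sub]
      by (intro path_continuous_image)
    have qi: "path_image ?q \<subseteq> cover_of"
      using \<gamma>(2)[OF gh(2)] translate_in_cover_of[OF g] by (auto simp: path_image_compose)
    have tr: "translate g (pt k) = pt (g \<otimes> k)" if "k \<in> ?H" for k
      using translate_lift[OF g(1), of "k \<otimes> w0" a] chamber_translate(1)[OF Hc[OF that] w0(1) Hs[OF that]]
        aw0 g w0 Hc[OF that] by (simp add: pt_def m_assoc)
    have qs: "pathstart ?q = pt g" using \<gamma>(3)[OF gh(2)] tr[OF H.one_closed] g by (simp add: pathstart_compose)
    have qf: "pathfinish ?q = pt (g \<otimes> h)" using \<gamma>(4)[OF gh(2)] tr[OF gh(2)] by (simp add: pathfinish_compose)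
    \<comment> \<open>The translate by \<open>g\<close> of the path for \<open>h\<close> starts at
      \<open>pt g\<close> and has the same projection as that path; the concatenation is thus
      another path from \<open>pt \<one>\<close> to \<open>pt (g \<otimes> h)\<close>.\<close>
    have "homotopic_paths complement (fst \<circ> (\<gamma> g +++ ?q)) (fst \<circ> \<gamma> (g \<otimes> h))"
      using \<gamma>[OF gh(1)] \<gamma>[OF H.m_closed[OF gh]] q qi qs qf
      by (intro homotopic_projections) (auto simp: path_image_join)
    moreover have "fst \<circ> (\<gamma> g +++ ?q) = (fst \<circ> \<gamma> g) +++ (fst \<circ> \<gamma> h)"
      by (rule ext) (simp add: joinpaths_def)
    ultimately have *: "homotopic_paths complement ((fst \<circ> \<gamma> g) +++ (fst \<circ> \<gamma> h)) (fst \<circ> \<gamma> (g \<otimes> h))"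
      by simp
    have "\<Theta> g \<otimes>\<^bsub>fundamental_group complement a\<^esub> \<Theta> h = {r. homotopic_paths complement ((fst \<circ> \<gamma> g) +++ (fst \<circ> \<gamma> h)) r}"
      unfolding \<Theta>_def using \<gamma>loop gh by (intro path_class_mult) auto
    also have "\<dots> = \<Theta> (g \<otimes> h)"
      unfolding \<Theta>_def using * homotopic_paths_sym homotopic_paths_trans by blast
    finally show ?thesis by simp
  qed
  have inj: "g = h" if gh: "g \<in> ?H" "h \<in> ?H" "\<Theta> g = \<Theta> h" for g h
  proof -
    have "homotopic_paths complement (fst \<circ> \<gamma> h) (fst \<circ> \<gamma> h)" using \<gamma>loop[OF gh(2)] by (simp add: loops_at_def)
    then have "homotopic_paths complement (fst \<circ> \<gamma> g) (fst \<circ> \<gamma> h)"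
      using gh(3) path_class_eq unfolding \<Theta>_def by blast
    then have hp: "homotopic_paths flag_complement (fst \<circ> \<gamma> g) (fst \<circ> \<gamma> h)"
      using complement_subset homotopic_paths_subset by blast
    have sub: "path_image (\<gamma> k) \<subseteq> cover" if "k \<in> ?H" for k using \<gamma>(2)[OF that] by (auto simp: cover_of_def)
    have "pathfinish (\<gamma> g) = pathfinish (\<gamma> h)"
    proof (rule covering_space_monodromy[OF covering_space_cover _ _ _ _ hp])
      show "path (fst \<circ> \<gamma> g)" "path (fst \<circ> \<gamma> h)"
        using homotopic_paths_imp_path[OF hp] by auto
      show "path_image (fst \<circ> \<gamma> g) \<subseteq> flag_complement" "path_image (fst \<circ> \<gamma> h) \<subseteq> flag_complement"
        using homotopic_paths_imp_subset[OF hp] by auto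
    qed (simp_all add: \<gamma>(1,3) gh(1,2) sub)
    then have "lift (g \<otimes> w0) a = lift (h \<otimes> w0) a" using \<gamma>(4) gh by (simp add: pt_def)
    then have par: "inv (g \<otimes> w0) \<otimes> (h \<otimes> w0) \<in> par (zeros a)" using lift_eq Hc gh w0 by simp
    \<comment> \<open>Two labels of one point differ by an element of \<open>par (zeros a)\<close>;
      here it has trivial signs and is therefore the unit.\<close>
    have "sg (inv (g \<otimes> w0) \<otimes> (h \<otimes> w0)) i = 1" for i
      using Hc gh w0 Hs by (simp add: sg_mult sg_inv)
    then have "even (cnt (inv (g \<otimes> w0) \<otimes> (h \<otimes> w0)) i)" for i
      by (simp add: sg_eq_1_iff)
    moreover have "clique (zeros a)" using aw0 by (simp add: chamber_def flag_complement_def)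
    ultimately have "inv (g \<otimes> w0) \<otimes> (h \<otimes> w0) = \<one>" using par_even_one par by blast
    then have "(g \<otimes> w0) \<otimes> \<one> = (g \<otimes> w0) \<otimes> (inv (g \<otimes> w0) \<otimes> (h \<otimes> w0))" by simp
    also have "\<dots> = h \<otimes> w0" using Hc[OF gh(1)] Hc[OF gh(2)] w0(1) by (simp add: m_assoc[symmetric])
    finally show ?thesis using Hc[OF gh(1)] Hc[OF gh(2)] w0(1) by simp
  qed
  have surj: "\<exists>g\<in>?H. \<Theta> g = {r. homotopic_paths complement p r}" if p: "p \<in> loops_at complement a" for p
  proof -
    have pp: "path p" "path_image p \<subseteq> complement" "pathstart p = a" "pathfinish p = a"
      using p by (auto simp: loops_at_def)
    have "pt \<one> \<in> cover" using pt_in[OF H.one_closed] by (simp add: cover_of_def)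
    then obtain q where q: "path q" "path_image q \<subseteq> cover" "pathstart q = pt \<one>"
      "\<And>t. t \<in> {0..1} \<Longrightarrow> fst (q t) = p t"
      using covering_space_lift_path_strong[OF covering_space_cover, of "pt \<one>" p] pp complement_subset pt_fst
      by (metis order_trans)
    have qi: "path_image q \<subseteq> cover_of"
    proof
      fix e assume "e \<in> path_image q"
      then obtain t where t: "t \<in> {0..1}" "e = q t" by (auto simp: path_image_def)
      then have "fst e \<in> complement" using q(4) pp(2) by (auto simp: path_image_def)
      then show "e \<in> cover_of" using \<open>e \<in> path_image q\<close> q(2) by (auto simp: cover_of_def complement_def)
    qed
    have qf: "fst (pathfinish q) = a" using q(4)[of 1] pp(4) by (simp add: pathfinish_def)
    have "pathfinish q \<in> cover" using q(2) by auto
    then obtain w1 where w1: "w1 \<in> carrier G" "a \<in> chamber w1" "pathfinish q = lift w1 a"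
      using qf by (auto simp: cover_def)
    \<comment> \<open>The end chamber may have other signs than \<open>w0\<close>, but only at zeros
      of \<open>a\<close>. The correction \<open>k\<close> in \<open>par (zeros a)\<close> changes
      the label, not the point, and makes the signs equal, so that \<open>g\<close> has even
      counts.\<close>
    have "{i. sg w1 i \<noteq> sg w0 i} \<subseteq> zeros a"
    proof
      fix i assume "i \<in> {i. sg w1 i \<noteq> sg w0 i}"
      moreover have "0 \<le> sg w0 i * a $ i" "0 \<le> sg w1 i * a $ i" using w0 w1 by (auto simp: chamber_def)
      ultimately show "i \<in> zeros a" using sg_cases[of w0 i] sg_cases[of w1 i] by (auto simp: zeros_def)
    qed
    then obtain k where k: "k \<in> par (zeros a)" "\<And>i. cnt k i = (if i \<in> {i. sg w1 i \<noteq> sg w0 i} then 1 else 0)"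
      using par_exists by blast
    have kc: "k \<in> carrier G" using k par_subset by blast
    have sgk: "sg w1 i * sg k i = sg w0 i" for i
      using k(2)[of i] sg_cases[of w0 i] sg_cases[of w1 i] by (auto simp: sg_def[of k])
    define g where "g = w1 \<otimes> k \<otimes> inv w0"
    have gc: "g \<in> carrier G" using w1 kc w0 by (simp add: g_def)
    have "sg g i = 1" for i using w1 kc w0 sgk[of i] by (simp add: g_def sg_mult sg_inv)
    then have "even (cnt g i)" for i by (simp add: sg_eq_1_iff)
    then have gH: "g \<in> ?H" using gc derived_iff by blast
    have "g \<otimes> w0 = w1 \<otimes> k" using w1 kc w0 by (simp add: g_def m_assoc)
    moreover have "inv w1 \<otimes> (w1 \<otimes> k) = k" using w1 kc by (simp add: m_assoc[symmetric])
    ultimately have fin: "pathfinish q = pt g"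
      unfolding w1(3) pt_def using lift_eq[of w1 "w1 \<otimes> k" a a] w1 kc k(1) by simp
    have "homotopic_paths complement (fst \<circ> q) (fst \<circ> \<gamma> g)"
      using q qi \<gamma>[OF gH] fin by (intro homotopic_projections) auto
    moreover have "homotopic_paths complement p (fst \<circ> q)"
      using pp q(4) by (intro homotopic_paths_eq) auto
    ultimately have "homotopic_paths complement p (fst \<circ> \<gamma> g)" using homotopic_paths_trans by blast
    then have "\<Theta> g = {r. homotopic_paths complement p r}"
      unfolding \<Theta>_def using homotopic_paths_sym homotopic_paths_trans by blast
    then show ?thesis using gH by blast
  qed
  have in_carr: "\<Theta> g \<in> carrier (fundamental_group complement a)" if "g \<in> ?H" for g
    unfolding carr \<Theta>_def using \<gamma>loop[OF that] by (rule imageI)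
  have "bij_betw \<Theta> ?H (carrier (fundamental_group complement a))"
    unfolding bij_betw_def
  proof
    show "inj_on \<Theta> ?H" using inj by (rule inj_onI)
    show "\<Theta> ` ?H = carrier (fundamental_group complement a)"
    proof
      show "\<Theta> ` ?H \<subseteq> carrier (fundamental_group complement a)" using in_carr by (rule image_subsetI)
      show "carrier (fundamental_group complement a) \<subseteq> \<Theta> ` ?H"
      proof
        fix A assume "A \<in> carrier (fundamental_group complement a)"
        then obtain p where p: "p \<in> loops_at complement a" "A = {r. homotopic_paths complement p r}"
          unfolding carr by (elim imageE)
        obtain g where "g \<in> ?H" "\<Theta> g = A" using surj[OF p(1)] unfolding p(2) by (elim bexE)
        then show "A \<in> \<Theta> ` ?H" by (intro image_eqI[OF HOL.sym])
      qed
    qed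
  qed
  moreover have "\<Theta> \<in> hom (commutator_subgroup G) (fundamental_group complement a)"
    by (rule homI) (simp_all add: commutator_subgroup_def in_carr hom)
  ultimately have "\<Theta> \<in> iso (commutator_subgroup G) (fundamental_group complement a)"
    by (simp add: iso_def commutator_subgroup_def)
  then have "commutator_subgroup G \<cong> fundamental_group complement a"
    unfolding is_iso_def by blast
  moreover have "group (commutator_subgroup G)"
    unfolding commutator_subgroup_def by (rule subgroup.subgroup_is_group[OF H.subgroup_axioms is_group])
  ultimately show ?thesis by (rule group.iso_sym[rotated])
qed

end

section \<open>Asphericity from a contractible cover\<close>

lemma covering_map_homeomorphic:
  assumes ij: "homeomorphic_maps X E i j" and p: "covering_map X p S"
  shows "covering_map E (p \<circ> j) S"
  unfolding covering_map_def
proof (intro conjI ballI)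
  have hi: "homeomorphic_map X E i" and hj: "homeomorphic_map E X j"
    using ij homeomorphic_maps_map homeomorphic_maps_sym by blast+
  have ji: "\<And>x. x \<in> topspace X \<Longrightarrow> j (i x) = x" and ii: "\<And>e. e \<in> topspace E \<Longrightarrow> i (j e) = e"
    using ij by (auto simp: homeomorphic_maps_def)
  have iX: "i ` topspace X = topspace E" using hi homeomorphic_imp_surjective_map by blast
  have jE: "j ` topspace E = topspace X" using hj homeomorphic_imp_surjective_map by blast
  have pc: "continuous_map X S p" "p ` topspace X = topspace S" using p by (simp_all add: covering_map_def)
  show "continuous_map E S (p \<circ> j)"
    by (rule continuous_map_compose[OF homeomorphic_imp_continuous_map[OF hj] pc(1)])
  have "(p \<circ> j) ` topspace E = p ` topspace X" unfolding image_comp[symmetric] jE ..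
  then show "(p \<circ> j) ` topspace E = topspace S" using pc(2) by simp
  fix x assume "x \<in> topspace S"
  then obtain T \<V> where T: "x \<in> T" "openin S T" and \<V>: "\<Union>\<V> = topspace X \<inter> p -` T"
    "\<And>U. U \<in> \<V> \<Longrightarrow> openin X U" "pairwise disjnt \<V>"
    "\<And>U. U \<in> \<V> \<Longrightarrow> homeomorphic_map (subtopology X U) (subtopology S T) p"
    using p unfolding covering_map_def by metis
  have sub: "U \<subseteq> topspace X" if "U \<in> \<V>" for U using \<V>(1) that by blast
  have "\<Union>((`) i ` \<V>) = i ` \<Union>\<V>" by blast
  also have "\<dots> = topspace E \<inter> (p \<circ> j) -` T"
    unfolding \<V>(1)
  proof (intro equalityI subsetI)
    fix e assume "e \<in> i ` (topspace X \<inter> p -` T)"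
    then show "e \<in> topspace E \<inter> (p \<circ> j) -` T" using iX ji by force
  next
    fix e assume e: "e \<in> topspace E \<inter> (p \<circ> j) -` T"
    then have "j e \<in> topspace X \<inter> p -` T" using jE by auto
    then show "e \<in> i ` (topspace X \<inter> p -` T)" using ii e by (intro image_eqI[of _ _ "j e"]) auto
  qed
  finally have un: "\<Union>((`) i ` \<V>) = topspace E \<inter> (p \<circ> j) -` T" .
  have op: "openin E (i ` U)" if "U \<in> \<V>" for U
    using homeomorphic_map_openness[OF hi sub[OF that]] \<V>(2)[OF that] by simp
  have disj: "pairwise disjnt ((`) i ` \<V>)"
    unfolding pairwise_def
  proof (intro ballI impI)
    fix A B assume "A \<in> (`) i ` \<V>" "B \<in> (`) i ` \<V>" "A \<noteq> B"
    then obtain U V where UV: "U \<in> \<V>" "V \<in> \<V>" "A = i ` U" "B = i ` V" "U \<noteq> V" by blast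
    then have "disjnt U V" using \<V>(3) by (auto simp: pairwise_def)
    moreover have "inj_on i (topspace X)" using ji by (rule inj_on_inverseI)
    ultimately show "disjnt A B"
      using UV sub[OF UV(1)] sub[OF UV(2)] unfolding disjnt_def
      by (simp add: inj_on_image_Int[symmetric])
  qed
  have hom: "homeomorphic_map (subtopology E (i ` U)) (subtopology S T) (p \<circ> j)" if U: "U \<in> \<V>" for U
  proof (rule homeomorphic_map_compose)
    show "homeomorphic_map (subtopology E (i ` U)) (subtopology X U) j"
    proof (rule homeomorphic_map_subtopologies_alt[OF hj])
      fix e assume e: "e \<in> topspace E"
      show "j e \<in> U \<longleftrightarrow> e \<in> i ` U"
      proof
        assume "j e \<in> U"
        then show "e \<in> i ` U" using ii[OF e] by (intro image_eqI[of _ _ "j e"]) simp_all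
      next
        assume "e \<in> i ` U"
        then obtain x where "x \<in> U" "e = i x" by blast
        then show "j e \<in> U" using ji[of x] sub[OF U] by auto
      qed
    qed
    show "homeomorphic_map (subtopology X U) (subtopology S T) p" using \<V>(4)[OF U] .
  qed
  show "\<exists>T. x \<in> T \<and> openin S T \<and> (\<exists>\<V>. \<Union>\<V> = topspace E \<inter> (p \<circ> j) -` T \<and> (\<forall>U\<in>\<V>. openin E U) \<and>
      pairwise disjnt \<V> \<and> (\<forall>U\<in>\<V>. homeomorphic_map (subtopology E U) (subtopology S T) (p \<circ> j)))"
    using T un op disj hom by (intro exI[of _ T] conjI exI[of _ "(`) i ` \<V>"]) auto
qed

lemma simply_connected_space_homeomorphic:
  assumes ij: "homeomorphic_maps X E i j" and X: "simply_connected_space X"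
  shows "simply_connected_space E"
  unfolding simply_connected_space_def
proof (intro allI impI)
  fix p q assume *: "pathin E p \<and> p 1 = p 0 \<and> pathin E q \<and> q 1 = q 0"
  have ci: "continuous_map X E i" and cj: "continuous_map E X j"
    and ii: "\<And>e. e \<in> topspace E \<Longrightarrow> i (j e) = e"
    using ij by (auto simp: homeomorphic_maps_def)
  have "pathin X (j \<circ> p)" "pathin X (j \<circ> q)"
    using * cj unfolding pathin_def by (auto intro: continuous_map_compose)
  then have "homotopic_with (\<lambda>r. r 1 = r 0) (top_of_set {0..1::real}) X (j \<circ> p) (j \<circ> q)"
    using X * unfolding simply_connected_space_def by simp
  then have "homotopic_with (\<lambda>r. r 1 = r 0) (top_of_set {0..1::real}) E (i \<circ> (j \<circ> p)) (i \<circ> (j \<circ> q))"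
    by (rule homotopic_with_compose_continuous_map_left[OF _ ci]) simp
  moreover have "p t \<in> topspace E" "q t \<in> topspace E" if "t \<in> {0..1}" for t
    using * that unfolding pathin_def by (auto dest!: continuous_map_image_subset_topspace)
  ultimately show "homotopic_with (\<lambda>r. r 1 = r 0) (top_of_set {0..1::real}) E p q"
    by (elim homotopic_with_eq) (auto simp: ii)
qed

text \<open>\<open>aspherical_space\<close> prescribes the type that carries the cover; the topology
  of \<open>C\<close> is transported along the injection \<open>i\<close> onto its image
  there.\<close>

lemma aspherical_space_if_contractible_cover:
  fixes C :: "'b::real_normed_vector set" and S :: "'a::topological_space set"
    and i :: "'b \<Rightarrow> (real \<Rightarrow> 'a) set"
  assumes p: "covering_space C p S" and C: "contractible C" "C \<noteq> {}" and i: "inj i"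
  shows "aspherical_space (top_of_set S)"
proof -
  define E where "E = pullback_topology (range i) (inv_into UNIV i) (top_of_set C)"
  have "topspace E = i ` C"
    using i by (auto simp: E_def topspace_pullback_topology)
  have ij: "homeomorphic_maps (top_of_set C) E i (inv_into UNIV i)"
    unfolding homeomorphic_maps_def
  proof (intro conjI ballI)
    show "continuous_map (top_of_set C) E i"
      unfolding E_def
      by (rule continuous_map_pullback') (use i in \<open>auto simp: o_def\<close>)
    have "continuous_map E (top_of_set C) (id \<circ> inv_into UNIV i)"
      unfolding E_def by (rule continuous_map_pullback) simp
    then show "continuous_map E (top_of_set C) (inv_into UNIV i)" by simp
  qed (use i \<open>topspace E = i ` C\<close> in auto)
  have sc: "simply_connected C" using C contractible_imp_simply_connected by blast
  have "covering_map (top_of_set C) p (top_of_set S)" using p by (simp add: covering_map_top_of_set)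
  then have "covering_map E (p \<circ> inv_into UNIV i) (top_of_set S)" by (rule covering_map_homeomorphic[OF ij])
  moreover have "simply_connected_space E"
    by (rule simply_connected_space_homeomorphic[OF ij]) (simp add: simply_connected_space_top_of_set sc)
  moreover have "contractible_space E"
    using homeomorphic_space_contractibility[of "top_of_set C" E] ij C
    unfolding homeomorphic_space_def contractible_space_top_of_set by blast
  moreover have "connected S"
    using connected_continuous_image[OF covering_space_imp_continuous[OF p]]
      simply_connected_imp_connected[OF sc] covering_space_imp_surjective[OF p] by metis
  ultimately show ?thesis unfolding aspherical_space_def by (auto simp: connected_space_subtopology)
qed

text \<open>Both components can be read off a single function: its value at \<open>- 1\<close> is
  the base point, and its values at natural numbers are those of the bounded function. The singleton
  brings it into the prescribed type.\<close>

lemma inj_pos_code: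
  "inj (\<lambda>e :: 'd::finite pos. {\<lambda>t :: real. if t = - 1 then fst e else apply_bcontfun (snd e) (nat \<lfloor>t\<rfloor>)})"
proof (rule injI)
  fix e e' :: "'d::finite pos"
  assume "{\<lambda>t :: real. if t = - 1 then fst e else apply_bcontfun (snd e) (nat \<lfloor>t\<rfloor>)} =
      {\<lambda>t. if t = - 1 then fst e' else apply_bcontfun (snd e') (nat \<lfloor>t\<rfloor>)}"
  then have eq: "(if t = - 1 then fst e else apply_bcontfun (snd e) (nat \<lfloor>t\<rfloor>)) =
      (if t = - 1 then fst e' else apply_bcontfun (snd e') (nat \<lfloor>t\<rfloor>))" for t :: real
    by (simp add: fun_eq_iff)
  have "fst e = fst e'" using eq[of "- 1"] by simp
  moreover have "apply_bcontfun (snd e) n = apply_bcontfun (snd e') n" for n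
    using eq[of "real n"] by simp
  then have "snd e = snd e'" by (rule bcontfun_eqI)
  ultimately show "e = e'" by (simp add: prod_eq_iff)
qed

lemma (in countable_racg) aspherical_flag_complement:
  assumes "contractible cover"
  shows "aspherical_space (top_of_set flag_complement)"
proof -
  have "chamber \<one> \<noteq> {}"
    by (auto simp: chamber_def flag_complement_def zeros_def clique_def intro!: exI[of _ "\<chi> i. 1"])
  then have "cover \<noteq> {}" using lift_in_cover[of \<one>] by blast
  then show ?thesis
    using aspherical_space_if_contractible_cover[OF covering_space_cover assms _ inj_pos_code] by blast
qed

section \<open>Lifting through abstract covering maps\<close>

definition evenly_covers :: "'e topology \<Rightarrow> ('e \<Rightarrow> 'a) \<Rightarrow> 'a topology \<Rightarrow> 'a set \<Rightarrow> 'e set set \<Rightarrow> bool" where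
  "evenly_covers E p X T \<V> \<longleftrightarrow> openin X T \<and> \<Union>\<V> = topspace E \<inter> p -` T \<and> pairwise disjnt \<V> \<and>
     (\<forall>U\<in>\<V>. openin E U \<and> (\<exists>q. homeomorphic_maps (subtopology E U) (subtopology X T) p q))"

lemma covering_map_evenly_covers:
  assumes "covering_map E p X" "x \<in> topspace X"
  obtains T \<V> where "x \<in> T" "evenly_covers E p X T \<V>"
proof -
  obtain T \<V> where "x \<in> T" "openin X T" "\<Union>\<V> = topspace E \<inter> p -` T" "\<forall>U\<in>\<V>. openin E U"
    "pairwise disjnt \<V>" "\<forall>U\<in>\<V>. homeomorphic_map (subtopology E U) (subtopology X T) p"
    using assms unfolding covering_map_def by metis
  then show ?thesis
    using that[of T \<V>] by (simp add: evenly_covers_def homeomorphic_map_maps)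
qed

lemma evenly_coversD:
  assumes "evenly_covers E p X T \<V>" "e \<in> topspace E" "p e \<in> T"
  obtains U q where "U \<in> \<V>" "e \<in> U" "openin E U" "homeomorphic_maps (subtopology E U) (subtopology X T) p q"
proof -
  have "e \<in> \<Union>\<V>" using assms by (simp add: evenly_covers_def)
  then show ?thesis using that assms(1) unfolding evenly_covers_def by blast
qed

lemma slice_inverse:
  assumes "homeomorphic_maps (subtopology E U) (subtopology X T) p q" "openin E U" "openin X T"
  shows "e \<in> U \<Longrightarrow> q (p e) = e" "x \<in> T \<Longrightarrow> p (q x) = x" "x \<in> T \<Longrightarrow> q x \<in> U"
proof -
  have U: "topspace (subtopology E U) = U" and T: "topspace (subtopology X T) = T"
    using assms openin_subset by (auto simp: topspace_subtopology)
  have c: "continuous_map (subtopology X T) (subtopology E U) q"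
    and qp: "\<forall>e\<in>U. q (p e) = e" and pq: "\<forall>x\<in>T. p (q x) = x"
    using assms(1) unfolding homeomorphic_maps_def U T by blast+
  show "e \<in> U \<Longrightarrow> q (p e) = e" using qp by blast
  show "x \<in> T \<Longrightarrow> p (q x) = x" using pq by blast
  show "x \<in> T \<Longrightarrow> q x \<in> U" using continuous_map_image_subset_topspace[OF c] unfolding U T by blast
qed

lemma continuous_map_slice_lift:
  assumes "homeomorphic_maps (subtopology E U) (subtopology X T) p q"
    and "continuous_map Y X f" "f ` topspace Y \<subseteq> T"
  shows "continuous_map Y E (q \<circ> f)"
proof -
  have "continuous_map Y (subtopology X T) f" using assms(2,3) by (auto simp: continuous_map_in_subtopology)
  moreover have "continuous_map (subtopology X T) (subtopology E U) q"
    using assms(1) by (simp add: homeomorphic_maps_def)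
  ultimately have "continuous_map Y (subtopology E U) (q \<circ> f)" by (rule continuous_map_compose)
  then show ?thesis by (rule continuous_map_into_fulltopology)
qed

text \<open>Agreement and disagreement are both open: over an evenly covered set two lifts either
  lie in the same slice, where the projection is injective, or in disjoint ones.\<close>

lemma covering_map_lift_unique:
  assumes cov: "covering_map E p X" and S: "connected S"
    and g1: "continuous_map (top_of_set S) E g1" and g2: "continuous_map (top_of_set S) E g2"
    and eq: "\<And>x. x \<in> S \<Longrightarrow> p (g1 x) = p (g2 x)"
    and a: "a \<in> S" "g1 a = g2 a" and x: "x \<in> S"
  shows "g1 x = g2 x"
proof (rule ccontr)
  assume ne: "g1 x \<noteq> g2 x"
  let ?A = "{y \<in> S. g1 y = g2 y}" and ?B = "{y \<in> S. g1 y \<noteq> g2 y}"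
  have in_E: "g1 y \<in> topspace E" "g2 y \<in> topspace E" if "y \<in> S" for y
    using continuous_map_image_subset_topspace[OF g1] continuous_map_image_subset_topspace[OF g2] that by auto
  have nbhd: "\<exists>N. openin (top_of_set S) N \<and> y \<in> N \<and>
      (g1 y = g2 y \<longrightarrow> N \<subseteq> ?A) \<and> (g1 y \<noteq> g2 y \<longrightarrow> N \<subseteq> ?B)" if y: "y \<in> S" for y
  proof -
    have "p (g1 y) \<in> topspace X"
      using cov in_E(1)[OF y] unfolding covering_map_def by blast
    then obtain T \<V> where T: "p (g1 y) \<in> T" "evenly_covers E p X T \<V>"
      using covering_map_evenly_covers[OF cov] by metis
    have oT: "openin X T" and disj: "pairwise disjnt \<V>" using T(2) by (auto simp: evenly_covers_def)
    obtain U q where U: "U \<in> \<V>" "g1 y \<in> U" "openin E U" "homeomorphic_maps (subtopology E U) (subtopology X T) p q"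
      using evenly_coversD[OF T(2) in_E(1)[OF y] T(1)] .
    have "p (g2 y) \<in> T" using T(1) eq[OF y] by simp
    then obtain V q' where V: "V \<in> \<V>" "g2 y \<in> V" "openin E V" "homeomorphic_maps (subtopology E V) (subtopology X T) p q'"
      using evenly_coversD[OF T(2) in_E(2)[OF y]] by metis
    define N where "N = {z \<in> S. g1 z \<in> U} \<inter> {z \<in> S. g2 z \<in> V}"
    have N: "openin (top_of_set S) N"
      unfolding N_def
      using openin_continuous_map_preimage[OF g1 U(3)] openin_continuous_map_preimage[OF g2 V(3)]
      by (intro openin_Int) simp_all
    have inj: "e = e'" if "e \<in> U" "e' \<in> U" "p e = p e'" for e e'
      using slice_inverse(1)[OF U(4,3) oT] that by metis
    show ?thesis
    proof (cases "g1 y = g2 y")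
      case True
      then have "U = V" using U(1,2) V(1,2) disj unfolding pairwise_def disjnt_iff by metis
      then have "N \<subseteq> ?A" using inj eq by (auto simp: N_def)
      then show ?thesis using N True U V y by (intro exI[of _ N]) (auto simp: N_def)
    next
      case False
      then have "U \<noteq> V" using inj[OF U(2)] V(2) eq[OF y] by metis
      then have "disjnt U V" using U(1) V(1) disj unfolding pairwise_def by metis
      then have "N \<subseteq> ?B" by (auto simp: N_def disjnt_iff)
      then show ?thesis using N False U V y by (intro exI[of _ N]) (auto simp: N_def)
    qed
  qed
  have "openin (top_of_set S) ?A" by (subst openin_subopen) (use nbhd in blast)
  moreover have "openin (top_of_set S) ?B" by (subst openin_subopen) (use nbhd in blast)
  moreover have "S \<subseteq> ?A \<union> ?B" "?A \<inter> ?B = {}" "?A \<noteq> {}" "?B \<noteq> {}" using a x ne by auto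
  ultimately show False using S unfolding connected_openin by blast
qed

text \<open>Each track lies in one evenly covered set and lifts by the inverse on the slice through
  \<open>g x\<close>. The clause on points with \<open>h (x, 1) = h (x, 0)\<close> preserves the
  value prescribed at a base point when steps are iterated.\<close>

lemma covering_map_lift_step:
  fixes h :: "'c::topological_space \<times> real \<Rightarrow> 'a"
  assumes cov: "covering_map E p X"
    and h: "continuous_map (top_of_set (S \<times> {0..1})) X h"
    and g: "continuous_map (top_of_set S) E g" "\<And>x. x \<in> S \<Longrightarrow> p (g x) = h (x, 0)"
    and loc: "\<And>x. x \<in> S \<Longrightarrow> \<exists>N T \<V>. openin (top_of_set S) N \<and> x \<in> N \<and> evenly_covers E p X T \<V> \<and> h ` (N \<times> {0..1}) \<subseteq> T"
  shows "\<exists>g'. continuous_map (top_of_set S) E g' \<and> (\<forall>x\<in>S. p (g' x) = h (x, 1)) \<and>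
              (\<forall>x\<in>S. h (x, 1) = h (x, 0) \<longrightarrow> g' x = g x)"
proof -
  \<comment> \<open>\<open>e\<close> is the end of a lift of the track of \<open>x\<close> that
    starts at \<open>g x\<close>. The evenly covered set may vary with \<open>x\<close>;
    \<open>R_unique\<close> shows, by unique lifting along the track, that all choices give the same
    \<open>e\<close>.\<close>
  define R where "R x e \<longleftrightarrow> (\<exists>T U q. openin X T \<and> openin E U \<and>
      homeomorphic_maps (subtopology E U) (subtopology X T) p q \<and>
      h ` ({x} \<times> {0..1}) \<subseteq> T \<and> g x \<in> U \<and> e = q (h (x, 1)))" for x e
  have line: "continuous_map (top_of_set {0..1}) X (\<lambda>t. h (x, t))" if "x \<in> S" for x
  proof -
    have "continuous_on {0..1} (Pair x)"
      using continuous_on_Pair[OF continuous_on_const continuous_on_id] by simp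
    then have "continuous_map (top_of_set {0..1}) (top_of_set (S \<times> {0..1})) (Pair x)"
      using that by auto
    from continuous_map_compose[OF this h] show ?thesis by (simp add: o_def)
  qed
  have R_unique: "e = e'" if x: "x \<in> S" and R: "R x e" "R x e'" for x e e'
  proof -
    obtain T U q where T: "openin X T" "openin E U" "homeomorphic_maps (subtopology E U) (subtopology X T) p q"
      "h ` ({x} \<times> {0..1}) \<subseteq> T" "g x \<in> U" "e = q (h (x, 1))" using R(1) unfolding R_def by blast
    obtain T' U' q' where T': "openin X T'" "openin E U'" "homeomorphic_maps (subtopology E U') (subtopology X T') p q'"
      "h ` ({x} \<times> {0..1}) \<subseteq> T'" "g x \<in> U'" "e' = q' (h (x, 1))" using R(2) unfolding R_def by blast
    have hT: "h (x, t) \<in> T" "h (x, t) \<in> T'" if "t \<in> {0..1}" for t using T(4) T'(4) that by auto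
    have "(q \<circ> (\<lambda>t. h (x, t))) 1 = (q' \<circ> (\<lambda>t. h (x, t))) 1"
    proof (rule covering_map_lift_unique[OF cov, of "{0..1}"])
      show "continuous_map (top_of_set {0..1}) E (q \<circ> (\<lambda>t. h (x, t)))"
        by (rule continuous_map_slice_lift[OF T(3) line[OF x]]) (use hT in auto)
      show "continuous_map (top_of_set {0..1}) E (q' \<circ> (\<lambda>t. h (x, t)))"
        by (rule continuous_map_slice_lift[OF T'(3) line[OF x]]) (use hT in auto)
      show "p ((q \<circ> (\<lambda>t. h (x, t))) t) = p ((q' \<circ> (\<lambda>t. h (x, t))) t)" if "t \<in> {0..1}" for t
        using slice_inverse(2)[OF T(3,2,1) hT(1)[OF that]] slice_inverse(2)[OF T'(3,2,1) hT(2)[OF that]] by simp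
      show "(q \<circ> (\<lambda>t. h (x, t))) 0 = (q' \<circ> (\<lambda>t. h (x, t))) 0"
        using slice_inverse(1)[OF T(3,2,1) T(5)] slice_inverse(1)[OF T'(3,2,1) T'(5)] g(2)[OF x] by simp
    qed auto
    then show ?thesis using T(6) T'(6) by simp
  qed
  have local: "\<exists>N T U q. openin (top_of_set S) N \<and> x \<in> N \<and> openin X T \<and> openin E U \<and>
      homeomorphic_maps (subtopology E U) (subtopology X T) p q \<and> (\<forall>y\<in>N. h ` ({y} \<times> {0..1}) \<subseteq> T \<and> g y \<in> U)"
    if x: "x \<in> S" for x
  proof -
    obtain N T \<V> where N: "openin (top_of_set S) N" "x \<in> N" "evenly_covers E p X T \<V>" "h ` (N \<times> {0..1}) \<subseteq> T"
      using loc[OF x] by blast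
    have "g x \<in> topspace E" using continuous_map_image_subset_topspace[OF g(1)] x by auto
    moreover have "p (g x) \<in> T" using g(2)[OF x] N(2,4) by auto
    ultimately obtain U q where U: "g x \<in> U" "openin E U" "homeomorphic_maps (subtopology E U) (subtopology X T) p q"
      using evenly_coversD[OF N(3)] by metis
    have "openin (top_of_set S) (N \<inter> {y \<in> S. g y \<in> U})"
      using N(1) openin_continuous_map_preimage[OF g(1) U(2)] by (intro openin_Int) simp_all
    moreover have "openin X T" using N(3) by (simp add: evenly_covers_def)
    ultimately show ?thesis
      using U N(2,4) x by (intro exI[of _ "N \<inter> {y \<in> S. g y \<in> U}"] exI[of _ T] exI[of _ U] exI[of _ q]) auto
  qed
  define g' where "g' x = (SOME e. R x e)" for x
  have g'_eq: "g' x = e" if "x \<in> S" "R x e" for x e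
    using R_unique[OF that(1) someI[of "R x", OF that(2)] that(2)] by (simp add: g'_def)
  have ex: "R x (g' x)" if x: "x \<in> S" for x
  proof -
    obtain N T U q where "x \<in> N" "openin X T" "openin E U"
      "homeomorphic_maps (subtopology E U) (subtopology X T) p q" "\<forall>y\<in>N. h ` ({y} \<times> {0..1}) \<subseteq> T \<and> g y \<in> U"
      using local[OF x] by blast
    then have "R x (q (h (x, 1)))" unfolding R_def by blast
    then show ?thesis unfolding g'_def by (rule someI)
  qed
  have "continuous_map (top_of_set S) E g'"
  proof (rule continuous_map_locally)
    fix x assume "x \<in> topspace (top_of_set S)"
    then have x: "x \<in> S" by simp
    obtain N T U q where N: "openin (top_of_set S) N" "x \<in> N" "openin X T" "openin E U"
      "homeomorphic_maps (subtopology E U) (subtopology X T) p q"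
      and NT: "\<forall>y\<in>N. h ` ({y} \<times> {0..1}) \<subseteq> T \<and> g y \<in> U"
      using local[OF x] by blast
    have NS: "N \<subseteq> S" using N(1) openin_imp_subset by blast
    have c: "continuous_map (subtopology (top_of_set S) N) X (\<lambda>y. h (y, 1))"
    proof -
      have "continuous_on N (\<lambda>y. (y, 1 :: real))" by (intro continuous_intros)
      moreover have "(\<lambda>y. (y, 1 :: real)) \<in> N \<rightarrow> S \<times> {0..1}" using NS by auto
      ultimately have "continuous_map (subtopology (top_of_set S) N) (top_of_set (S \<times> {0..1})) (\<lambda>y. (y, 1 :: real))"
        using NS by (simp add: subtopology_subtopology Int_absorb1)
      from continuous_map_compose[OF this h] show ?thesis by (simp add: o_def)
    qed
    have "continuous_map (subtopology (top_of_set S) N) E (q \<circ> (\<lambda>y. h (y, 1)))"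
      by (rule continuous_map_slice_lift[OF N(5) c]) (use NT in force)
    then have "continuous_map (subtopology (top_of_set S) N) E g'"
    proof (rule continuous_map_eq)
      fix y assume "y \<in> topspace (subtopology (top_of_set S) N)"
      then have y: "y \<in> N" "y \<in> S" by auto
      have "R y (q (h (y, 1)))" unfolding R_def using N bspec[OF NT y(1)] by blast
      then show "(q \<circ> (\<lambda>y. h (y, 1))) y = g' y" using g'_eq[OF y(2)] by simp
    qed
    then show "\<exists>N. openin (top_of_set S) N \<and> x \<in> N \<and> continuous_map (subtopology (top_of_set S) N) E g'"
      using N(1,2) by blast
  qed
  moreover have "p (g' x) = h (x, 1) \<and> (h (x, 1) = h (x, 0) \<longrightarrow> g' x = g x)" if x: "x \<in> S" for x
  proof -
    obtain T U q where T: "openin X T" "openin E U" "homeomorphic_maps (subtopology E U) (subtopology X T) p q"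
      "h ` ({x} \<times> {0..1}) \<subseteq> T" "g x \<in> U" "g' x = q (h (x, 1))" using ex[OF x] unfolding R_def by blast
    have "h (x, 1) \<in> T" using T(4) by auto
    then have "p (g' x) = h (x, 1)" using slice_inverse(2)[OF T(3,2,1)] T(6) by simp
    moreover have "q (h (x, 0)) = g x" using slice_inverse(1)[OF T(3,2,1,5)] g(2)[OF x] by simp
    ultimately show ?thesis using T(6) by simp
  qed
  ultimately show ?thesis by blast
qed

text \<open>Contract \<open>D\<close> radially to \<open>a\<close> and lift outwards from the
  constant map in \<open>N\<close> steps, each so short that its tracks stay locally in evenly
  covered sets.\<close>

lemma covering_map_lift_convex:
  fixes D :: "'c::euclidean_space set"
  assumes cov: "covering_map E p X" and D: "compact D" "convex D" "a \<in> D"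
    and f: "continuous_map (top_of_set D) X f" and e: "e \<in> topspace E" "p e = f a"
  shows "\<exists>g. continuous_map (top_of_set D) E g \<and> (\<forall>x\<in>D. p (g x) = f x) \<and> g a = e"
proof -
  have "\<exists>Q T \<V>. open Q \<and> y \<in> Q \<and> f ` (D \<inter> Q) \<subseteq> T \<and> evenly_covers E p X T \<V>" if y: "y \<in> D" for y
  proof -
    have "f y \<in> topspace X" using continuous_map_image_subset_topspace[OF f] y by auto
    then obtain T \<V> where T: "f y \<in> T" "evenly_covers E p X T \<V>"
      using covering_map_evenly_covers[OF cov] by metis
    then have "openin (top_of_set D) {z \<in> D. f z \<in> T}"
      using openin_continuous_map_preimage[OF f, of T] by (simp add: evenly_covers_def)
    then obtain Q where "open Q" "{z \<in> D. f z \<in> T} = D \<inter> Q" unfolding openin_open by blast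
    then show ?thesis using T y by blast
  qed
  then obtain Q T \<V> where Q: "\<And>y. y \<in> D \<Longrightarrow> open (Q y)" "\<And>y. y \<in> D \<Longrightarrow> y \<in> Q y"
    "\<And>y. y \<in> D \<Longrightarrow> f ` (D \<inter> Q y) \<subseteq> T y" "\<And>y. y \<in> D \<Longrightarrow> evenly_covers E p X (T y) (\<V> y)"
    by metis
  obtain \<delta> where \<delta>: "0 < \<delta>" "\<And>A. A \<subseteq> D \<Longrightarrow> diameter A < \<delta> \<Longrightarrow> \<exists>B\<in>Q ` D. A \<subseteq> B"
    using Lebesgue_number_lemma[OF D(1), of "Q ` D"] Q(1,2) D(3) by blast
  obtain M where M: "\<And>x. x \<in> D \<Longrightarrow> norm (x - a) \<le> M"
    using compact_imp_bounded[OF D(1)] bounded_any_center[of D a] by (auto simp: dist_norm norm_minus_commute)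
  have M0: "0 \<le> M" using M[OF D(3)] by simp
  \<comment> \<open>A step moves a point by at most \<open>M / N \<le> \<delta> / 4\<close>, and
    points of a ball of radius \<open>\<delta> / 8\<close> are less than \<open>\<delta> / 4\<close>
    apart; so the tracks near a point fill a set of diameter at most \<open>\<delta> / 2\<close>,
    below the Lebesgue number.\<close>
  obtain N :: nat where N: "4 * M / \<delta> < N" using reals_Archimedean2 by blast
  have N0: "0 < N" using N M0 \<delta>(1) by (cases "N = 0") (auto simp: field_simps not_less)
  have MN: "M / N \<le> \<delta> / 4" using N N0 \<delta>(1) by (simp add: field_simps)
  define pt where "pt u x = a + u *\<^sub>R (x - a)" for u x
  have pt_D: "pt u x \<in> D" if "x \<in> D" "0 \<le> u" "u \<le> 1" for u x
  proof -
    have "pt u x = (1 - u) *\<^sub>R a + u *\<^sub>R x" by (simp add: pt_def algebra_simps)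
    then show ?thesis using D(2,3) that by (simp add: convexD)
  qed
  have "\<exists>g. continuous_map (top_of_set D) E g \<and> (\<forall>x\<in>D. p (g x) = f (pt (k / N) x)) \<and> g a = e" if "k \<le> N" for k
    using that
  proof (induction k)
    case 0
    have "continuous_map (top_of_set D) E (\<lambda>_. e)" using e by simp
    then show ?case using e(2) by (intro exI[of _ "\<lambda>_. e"]) (simp add: pt_def)
  next
    case (Suc k)
    then obtain g where g: "continuous_map (top_of_set D) E g" "\<forall>x\<in>D. p (g x) = f (pt (k / N) x)" "g a = e"
      by auto
    define h where "h z = f (pt ((k + snd z) / N) (fst z))" for z :: "'c \<times> real"
    have u01: "0 \<le> (k + t) / N \<and> (k + t) / N \<le> 1" if "t \<in> {0..1}" for t :: real
      using that Suc.prems N0 by (auto simp: field_simps)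
    have ch: "continuous_map (top_of_set (D \<times> {0..1})) X h"
    proof -
      have "continuous_map (top_of_set (D \<times> {0..1})) (top_of_set D) (\<lambda>z :: 'c \<times> real. pt ((k + snd z) / N) (fst z))"
        using pt_D u01 N0 by (auto simp: pt_def intro!: continuous_intros)
      from continuous_map_compose[OF this f] show ?thesis by (simp add: h_def[abs_def] o_def)
    qed
    have "\<exists>g'. continuous_map (top_of_set D) E g' \<and> (\<forall>x\<in>D. p (g' x) = h (x, 1)) \<and>
              (\<forall>x\<in>D. h (x, 1) = h (x, 0) \<longrightarrow> g' x = g x)"
    proof (rule covering_map_lift_step[OF cov ch g(1)])
      show "p (g x) = h (x, 0)" if "x \<in> D" for x using g(2) that by (simp add: h_def)
      fix x assume x: "x \<in> D"
      define A where "A = (\<lambda>z :: 'c \<times> real. pt ((k + snd z) / N) (fst z)) ` ((D \<inter> ball x (\<delta> / 8)) \<times> {0..1})"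
      have "A \<subseteq> D" using pt_D u01 by (auto simp: A_def)
      moreover have "diameter A \<le> \<delta> / 2"
      proof (rule diameter_le)
        fix y z assume "y \<in> A" "z \<in> A"
        then obtain y' z' :: 'c and t t' :: real where yz: "y' \<in> D" "dist x y' < \<delta> / 8" "t \<in> {0..1}" "y = pt ((k + t) / N) y'"
          "z' \<in> D" "dist x z' < \<delta> / 8" "t' \<in> {0..1}" "z = pt ((k + t') / N) z'"
          by (auto simp: A_def)
        have split: "(t - t') / N = (k + t) / N - (k + t') / N"
          by (simp add: add_divide_distrib diff_divide_distrib)
        have "(a + \<alpha> *\<^sub>R (y' - a)) - (a + \<beta> *\<^sub>R (z' - a)) = (\<alpha> - \<beta>) *\<^sub>R (y' - a) + \<beta> *\<^sub>R (y' - z')"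
          for \<alpha> \<beta> by (simp add: algebra_simps)
        then have "y - z = ((t - t') / N) *\<^sub>R (y' - a) + ((k + t') / N) *\<^sub>R (y' - z')"
          unfolding yz(4,8) pt_def split .
        then have "norm (y - z) \<le> norm (((t - t') / N) *\<^sub>R (y' - a)) + norm (((k + t') / N) *\<^sub>R (y' - z'))"
          by (metis norm_triangle_ineq)
        also have "norm (((t - t') / N) *\<^sub>R (y' - a)) = \<bar>t - t'\<bar> * norm (y' - a) / N" by simp
        also have "\<dots> \<le> 1 * M / N"
          using yz(3,7) M[OF yz(1)] by (intro divide_right_mono mult_mono) auto
        also have "norm (((k + t') / N) *\<^sub>R (y' - z')) = ((k + t') / N) * norm (y' - z')"
          by (simp only: norm_scaleR abs_of_nonneg[OF conjunct1[OF u01[OF yz(7)]]])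
        also have "\<dots> \<le> 1 * norm (y' - z')" using u01[OF yz(7)] by (intro mult_right_mono) auto
        also have "norm (y' - z') \<le> \<delta> / 4"
          using dist_triangle2[of y' z' x] yz(2,6) by (simp add: dist_norm[symmetric] dist_commute)
        finally show "norm (y - z) \<le> \<delta> / 2" using MN by linarith
      qed (use \<delta> in simp)
      ultimately obtain y where y: "y \<in> D" "A \<subseteq> Q y" using \<delta>(1) \<delta>(2)[of A] by force
      have "h ` ((D \<inter> ball x (\<delta> / 8)) \<times> {0..1}) = f ` A"
        by (simp add: h_def[abs_def] A_def image_image)
      also have "\<dots> \<subseteq> T y" using Q(3)[OF y(1)] y(2) \<open>A \<subseteq> D\<close> by blast
      finally have "h ` ((D \<inter> ball x (\<delta> / 8)) \<times> {0..1}) \<subseteq> T y" .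
      moreover have "openin (top_of_set D) (D \<inter> ball x (\<delta> / 8))" by blast
      ultimately show "\<exists>N T \<V>. openin (top_of_set D) N \<and> x \<in> N \<and> evenly_covers E p X T \<V> \<and> h ` (N \<times> {0..1}) \<subseteq> T"
        using Q(4)[OF y(1)] x \<delta>(1) by (intro exI[of _ "D \<inter> ball x (\<delta> / 8)"] exI[of _ "T y"] exI[of _ "\<V> y"]) auto
    qed
    then obtain g' where g': "continuous_map (top_of_set D) E g'" "\<forall>x\<in>D. p (g' x) = h (x, 1)"
      "\<forall>x\<in>D. h (x, 1) = h (x, 0) \<longrightarrow> g' x = g x" by blast
    have "g' a = e" using g'(3) D(3) g(3) by (simp add: h_def pt_def)
    then show ?case using g' by (intro exI[of _ g']) (simp add: h_def add.commute)
  qed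
  from this[of N] show ?thesis using N0 by (simp add: pt_def)
qed

section \<open>Non-flag complexes\<close>

definition coord_sphere :: "'d set \<Rightarrow> (real^'d) set" where
  "coord_sphere P = {x. norm x = 1 \<and> (\<forall>i. i \<notin> P \<longrightarrow> x $ i = 0)}"

definition coord_disc :: "'d set \<Rightarrow> (real^'d) set" where
  "coord_disc P = {x. norm x \<le> 1 \<and> (\<forall>i. i \<notin> P \<longrightarrow> x $ i = 0)}"

lemma coord_disc_eq: "coord_disc P = cball 0 1 \<inter> coordinate_subspace (- P)"
  by (auto simp: coord_disc_def coordinate_subspace_def)

lemma compact_convex_coord_disc: "compact (coord_disc P)" "convex (coord_disc P)"
proof -
  have s: "subspace (coordinate_subspace (- P) :: (real^'a) set)" by (rule subspace_coordinate_subspace)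
  show "compact (coord_disc P :: (real^'a) set)"
    unfolding coord_disc_eq by (intro compact_Int_closed compact_cball closed_subspace s)
  show "convex (coord_disc P :: (real^'a) set)"
    unfolding coord_disc_eq by (intro convex_Int convex_cball subspace_imp_convex s)
qed

lemma compact_coord_sphere: "compact (coord_sphere P)"
proof -
  have "coord_sphere P = sphere 0 1 \<inter> coordinate_subspace (- P)"
    by (auto simp: coord_sphere_def coordinate_subspace_def)
  then show ?thesis
    by (auto intro!: compact_Int_closed closed_subspace subspace_coordinate_subspace)
qed

lemma axis_in_coord_sphere: "i \<in> P \<Longrightarrow> axis i 1 \<in> coord_sphere P"
  by (auto simp: coord_sphere_def axis_def norm_axis_1[unfolded axis_def])

lemma connected_coord_sphere:
  assumes "card P \<ge> 2" shows "connected (coord_sphere P)"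
proof -
  let ?V = "coordinate_subspace (- P) :: (real^'a) set"
  have "card (- P) + card P = CARD('a)"
    using card_mono[of UNIV P] by (simp add: Compl_eq_Diff_UNIV card_Diff_subset)
  then have "dim ?V = card P" using dim_coordinate_subspace[of "- P"] by simp
  then have "aff_dim ?V \<noteq> 1" using assms by (simp add: aff_dim_subspace subspace_coordinate_subspace)
  then have "connected (?V - {0})"
    by (intro path_connected_imp_connected path_connected_punctured_convex subspace_imp_convex subspace_coordinate_subspace)
  moreover have "continuous_on (?V - {0}) (\<lambda>x. x /\<^sub>R norm x)" by (intro continuous_intros) auto
  ultimately have "connected ((\<lambda>x. x /\<^sub>R norm x) ` (?V - {0}))" using connected_continuous_image by blast
  moreover have "(\<lambda>x. x /\<^sub>R norm x) ` (?V - {0}) = coord_sphere P"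
  proof (intro equalityI subsetI)
    fix y assume "y \<in> (\<lambda>x. x /\<^sub>R norm x) ` (?V - {0})"
    then show "y \<in> coord_sphere P" by (auto simp: coord_sphere_def coordinate_subspace_def)
  next
    fix y :: "real^'a" assume y: "y \<in> coord_sphere P"
    then have "y \<in> ?V - {0}" by (auto simp: coord_sphere_def coordinate_subspace_def)
    moreover have "y = y /\<^sub>R norm y" using y by (simp add: coord_sphere_def)
    ultimately show "y \<in> (\<lambda>x. x /\<^sub>R norm x) ` (?V - {0})" by blast
  qed
  ultimately show ?thesis by simp
qed

text \<open>
  Both closed hemispheres are discs, over which maps lift; the two lifts can be made to agree at one
  point of the equator, hence on the whole equator because it is connected.
\<close>
lemma covering_map_lift_sphere:
  fixes f :: "real^'d \<Rightarrow> 'a"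
  assumes cov: "covering_map E p X" and P: "card P \<ge> 3"
    and f: "continuous_map (top_of_set (coord_sphere P)) X f"
  shows "\<exists>g. continuous_map (top_of_set (coord_sphere P)) E g \<and> (\<forall>x\<in>coord_sphere P. p (g x) = f x)"
proof -
  obtain b where b: "b \<in> P" using P by fastforce
  define Q where "Q = P - {b}"
  \<comment> \<open>Two elements in \<open>Q\<close> are what makes the equator connected; this is
    where three elements of \<open>P\<close> enter.\<close>
  have Q: "card Q \<ge> 2" "b \<notin> Q" "Q \<subseteq> P" using P b by (auto simp: Q_def)
  then obtain a where a: "a \<in> Q" by fastforce
  let ?S = "coord_sphere P" and ?D = "coord_disc Q" and ?Eq = "coord_sphere Q"
  \<comment> \<open>\<open>pr\<close> projects the sphere onto the equatorial disc;
    \<open>up 1\<close> and \<open>up (- 1)\<close> invert it on the two closed hemispheres.\<close>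
  define pr :: "real^'d \<Rightarrow> real^'d" where "pr x = x - (x $ b) *\<^sub>R axis b 1" for x
  define up :: "real \<Rightarrow> real^'d \<Rightarrow> real^'d" where "up c x = x + (c * sqrt (1 - norm x ^ 2)) *\<^sub>R axis b 1" for c x
  have orth: "norm (x + t *\<^sub>R axis b 1) ^ 2 = norm x ^ 2 + t ^ 2" if "x $ b = 0" for x :: "real^'d" and t
  proof -
    have "x \<bullet> axis b 1 = 0" using that by (simp add: inner_axis)
    then have "orthogonal x (t *\<^sub>R axis b 1)" by (simp add: orthogonal_def)
    then have "norm (x + t *\<^sub>R axis b 1) ^ 2 = norm x ^ 2 + norm (t *\<^sub>R axis b 1 :: real^'d) ^ 2"
      by (rule norm_add_Pythagorean)
    then show ?thesis by (simp add: norm_axis_1 power_mult_distrib)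
  qed
  have pr_up: "x = pr x + (x $ b) *\<^sub>R axis b 1" "pr x $ b = 0" for x
    by (simp_all add: pr_def axis_def)
  have pr_D: "pr x \<in> ?D \<and> x = up (if 0 \<le> x $ b then 1 else - 1) (pr x)" if x: "x \<in> ?S" for x
  proof -
    have n: "norm (pr x) ^ 2 + (x $ b) ^ 2 = 1"
      using orth[OF pr_up(2), of x "x $ b"] pr_up(1)[of x] x by (simp add: coord_sphere_def)
    then have "norm (pr x) ^ 2 \<le> 1" using zero_le_power2[of "x $ b"] by linarith
    then have "norm (pr x) \<le> 1" by (simp add: abs_square_le_1)
    moreover have "pr x $ i = 0" if "i \<notin> Q" for i
      using x that by (auto simp: pr_def axis_def Q_def coord_sphere_def)
    ultimately have "pr x \<in> ?D" by (simp add: coord_disc_def)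
    moreover have "sqrt (1 - norm (pr x) ^ 2) = \<bar>x $ b\<bar>"
      using n by (metis add_diff_cancel_left' real_sqrt_abs)
    then have "up (if 0 \<le> x $ b then 1 else - 1) (pr x) = x"
      using pr_up(1)[of x] by (simp add: up_def)
    ultimately show ?thesis by simp
  qed
  have up_S: "up c x \<in> ?S" if "x \<in> ?D" "c = 1 \<or> c = - 1" for c x
  proof -
    have xb: "x $ b = 0" using that(1) Q(2) by (simp add: coord_disc_def)
    have "norm x ^ 2 \<le> 1" using that(1) by (simp add: coord_disc_def power_le_one)
    then have "norm (up c x) ^ 2 = 1"
      using that(2) orth[OF xb, of "c * sqrt (1 - norm x ^ 2)"] by (auto simp: up_def power_mult_distrib)
    then have "norm (up c x) = 1" by (simp add: power2_eq_1_iff) (use norm_ge_zero[of "up c x"] in linarith)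
    moreover have "up c x $ i = 0" if "i \<notin> P" for i
      using that b \<open>x \<in> ?D\<close> Q(3) by (auto simp: up_def axis_def coord_disc_def)
    ultimately show ?thesis by (simp add: coord_sphere_def)
  qed
  have up_eq: "up c x = x" if "x \<in> ?Eq" for c x using that by (simp add: up_def coord_sphere_def)
  have S0_D: "?Eq \<subseteq> ?D" by (auto simp: coord_sphere_def coord_disc_def)
  have cont: "continuous_map (top_of_set ?D) X (\<lambda>x. f (up c x))" if c: "c = 1 \<or> c = - 1" for c
  proof -
    have "continuous_on ?D (up c)" unfolding up_def by (intro continuous_intros)
    then have "continuous_map (top_of_set ?D) (top_of_set ?S) (up c)" using up_S c by auto
    from continuous_map_compose[OF this f] show ?thesis by (simp add: o_def)
  qed
  define q :: "real^'d" where "q = axis a 1"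
  have q: "q \<in> ?Eq" "q \<in> ?D" using axis_in_coord_sphere[OF a] S0_D by (auto simp: q_def)
  have "q \<in> ?S" using q(1) Q(3) by (auto simp: coord_sphere_def)
  then have "f q \<in> topspace X" using continuous_map_image_subset_topspace[OF f] by auto
  moreover have "p ` topspace E = topspace X" using cov by (simp add: covering_map_def)
  ultimately obtain e where e: "e \<in> topspace E" "p e = f q" by (metis imageE)
  have lifts: "\<exists>g. continuous_map (top_of_set ?D) E g \<and> (\<forall>x\<in>?D. p (g x) = f (up c x)) \<and> g q = e"
    if c: "c = 1 \<or> c = - 1" for c
    by (rule covering_map_lift_convex[OF cov compact_convex_coord_disc q(2) cont[OF c] e(1)])
      (simp add: e(2) up_eq[OF q(1)])
  obtain g1 where g1: "continuous_map (top_of_set ?D) E g1" "\<forall>x\<in>?D. p (g1 x) = f (up 1 x)" "g1 q = e"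
    using lifts[of 1] by auto
  obtain g2 where g2: "continuous_map (top_of_set ?D) E g2" "\<forall>x\<in>?D. p (g2 x) = f (up (- 1) x)" "g2 q = e"
    using lifts[of "- 1"] by auto
  have restrict: "continuous_map (top_of_set ?Eq) E g" if "continuous_map (top_of_set ?D) E g" for g
    using continuous_map_from_subtopology[OF that, of ?Eq] S0_D
    by (simp add: subtopology_subtopology Int_absorb1)
  have equator: "g1 x = g2 x" if "x \<in> ?Eq" for x
  proof (rule covering_map_lift_unique[OF cov connected_coord_sphere[OF Q(1)] restrict[OF g1(1)] restrict[OF g2(1)] _ q(1) _ that])
    show "p (g1 y) = p (g2 y)" if "y \<in> ?Eq" for y
      using g1(2) g2(2) S0_D that up_eq[OF that] by auto
    show "g1 q = g2 q" using g1(3) g2(3) by simp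
  qed
  define g where "g x = (if 0 \<le> x $ b then g1 (pr x) else g2 (pr x))" for x
  have "p (g x) = f x" if "x \<in> ?S" for x
    using pr_D[OF that] g1(2) g2(2) by (auto simp: g_def split: if_splits)
  moreover have "continuous_map (top_of_set ?S) E g"
  proof (rule pasting_lemma_closed[where I = "UNIV :: bool set"
        and T = "\<lambda>c. if c then {x \<in> ?S. 0 \<le> x $ b} else {x \<in> ?S. x $ b \<le> 0}"
        and f = "\<lambda>c x. if c then g1 (pr x) else g2 (pr x)"])
    fix c :: bool
    have "closed {x::real^'d. 0 \<le> x $ b}" "closed {x::real^'d. x $ b \<le> 0}"
      by (intro closed_Collect_le continuous_intros)+
    moreover have "{x \<in> ?S. 0 \<le> x $ b} = ?S \<inter> {x. 0 \<le> x $ b}" "{x \<in> ?S. x $ b \<le> 0} = ?S \<inter> {x. x $ b \<le> 0}"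
      by auto
    ultimately show "closedin (top_of_set ?S) (if c then {x \<in> ?S. 0 \<le> x $ b} else {x \<in> ?S. x $ b \<le> 0})"
      by (simp add: closedin_closed_Int)
    have prc: "continuous_map (subtopology (top_of_set ?S) A) (top_of_set ?D) pr" for A
    proof -
      have "continuous_on (?S \<inter> A) pr" unfolding pr_def by (intro continuous_intros)
      then show ?thesis using pr_D by (auto simp: subtopology_subtopology)
    qed
    show "continuous_map (subtopology (top_of_set ?S) (if c then {x \<in> ?S. 0 \<le> x $ b} else {x \<in> ?S. x $ b \<le> 0})) E
        (\<lambda>x. if c then g1 (pr x) else g2 (pr x))"
      using continuous_map_compose[OF prc g1(1)] continuous_map_compose[OF prc g2(1)] by (cases c) (auto simp: o_def)
  next
    fix c c' :: bool and x
    assume x: "x \<in> topspace (top_of_set ?S) \<inter> (if c then {x \<in> ?S. 0 \<le> x $ b} else {x \<in> ?S. x $ b \<le> 0}) \<inter>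
        (if c' then {x \<in> ?S. 0 \<le> x $ b} else {x \<in> ?S. x $ b \<le> 0})"
    show "(if c then g1 (pr x) else g2 (pr x)) = (if c' then g1 (pr x) else g2 (pr x))"
    proof (cases "c = c'")
      case False
      then have "x $ b = 0" "x \<in> ?S" using x by (auto split: if_splits)
      then have "pr x = x" "x \<in> ?Eq" by (auto simp: pr_def coord_sphere_def Q_def)
      then show ?thesis using equator by simp
    qed simp
  next
    fix x assume "x \<in> topspace (top_of_set ?S)"
    then show "\<exists>c. c \<in> UNIV \<and> x \<in> (if c then {x \<in> ?S. 0 \<le> x $ b} else {x \<in> ?S. x $ b \<le> 0}) \<and>
        g x = (if c then g1 (pr x) else g2 (pr x))"
      by (intro exI[of _ "0 \<le> x $ b"]) (auto simp: g_def)
  qed simp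
  ultimately show ?thesis by blast
qed

text \<open>A null-homotopy would extend the inclusion to a map of the whole space that avoids
  \<open>coordinate_subspace P\<close>. Projecting to the coordinates in \<open>P\<close>,
  normalising and negating yields a map of the disc into its boundary sphere that is antipodal
  there. It has no fixed point, contrary to Brouwer's theorem.\<close>

lemma coord_sphere_essential:
  fixes P :: "'d::finite set"
  assumes P: "P \<noteq> {}"
  shows "\<not> (\<exists>c. homotopic_with_canon (\<lambda>_. True) (coord_sphere P) (- coordinate_subspace P) id (\<lambda>_. c))"
proof
  let ?S = "coord_sphere P" and ?W = "- coordinate_subspace P :: (real^'d) set"
  assume *: "\<exists>c. homotopic_with_canon (\<lambda>_. True) ?S ?W id (\<lambda>_. c)"
  have ne: "?S \<noteq> {}" using axis_in_coord_sphere P by blast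
  have SW: "id ` ?S \<subseteq> ?W"
  proof
    fix x assume "x \<in> id ` ?S"
    then have x: "norm x = 1" "\<forall>i. i \<notin> P \<longrightarrow> x $ i = 0" by (auto simp: coord_sphere_def)
    show "x \<in> ?W"
    proof
      assume "x \<in> coordinate_subspace P"
      then have "x = 0" using x(2) by (auto simp: coordinate_subspace_def vec_eq_iff)
      then show False using x(1) by simp
    qed
  qed
  have "ANR ?W" by (intro open_imp_ANR open_Compl closed_subspace subspace_coordinate_subspace)
  then obtain g where g: "continuous_on UNIV g" "range g \<subseteq> ?W" "\<forall>x\<in>?S. g x = id x"
    using nullhomotopic_into_ANR_extension[OF compact_imp_closed[OF compact_coord_sphere] continuous_on_id' _ SW ne] * by auto
  define r :: "real^'d \<Rightarrow> real^'d" where "r y = (\<chi> i. if i \<in> P then y $ i else 0)" for y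
  have rg: "r (g x) \<noteq> 0" for x
  proof
    assume "r (g x) = 0"
    then have r0: "r (g x) $ i = 0" for i by simp
    have "g x $ i = 0" if "i \<in> P" for i using r0[of i] that by (simp add: r_def)
    then have "g x \<in> coordinate_subspace P" by (simp add: coordinate_subspace_def)
    moreover have "g x \<in> ?W" using g(2) by (rule subsetD) simp
    ultimately show False by simp
  qed
  let ?k = "\<lambda>x. - (r (g x) /\<^sub>R norm (r (g x)))"
  have "linear r" unfolding r_def by (rule linearI) (auto simp: vec_eq_iff)
  then have "continuous_on UNIV (\<lambda>x. r (g x))"
    using continuous_on_compose2[OF linear_continuous_on g(1), of r UNIV]
    by (simp add: linear_conv_bounded_linear)
  then have c: "continuous_on UNIV ?k" using rg by (intro continuous_intros) auto
  have kS: "?k x \<in> ?S" for x using rg[of x] by (simp add: coord_sphere_def r_def)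
  have "\<exists>x\<in>coord_disc P. ?k x = x"
  proof (rule brouwer[OF compact_convex_coord_disc, of P ?k])
    show "coord_disc P \<noteq> ({} :: (real^'d) set)" by (auto simp: coord_disc_def intro!: exI[of _ 0])
    show "continuous_on (coord_disc P) ?k" using c continuous_on_subset by blast
    show "?k \<in> coord_disc P \<rightarrow> coord_disc P" using kS by (auto simp: coord_sphere_def coord_disc_def)
  qed blast
  then obtain x where x: "?k x = x" by blast
  then have xS: "x \<in> ?S" using kS[of x] by simp
  then have gx: "r (g x) = x" using g(3) by (auto simp: r_def vec_eq_iff coord_sphere_def)
  have "norm x = 1" using xS by (simp add: coord_sphere_def)
  then have "- x = x" using x unfolding gx by simp
  then have "x = 0" by (simp add: vec_eq_iff)
  then show False using \<open>norm x = 1\<close> by simp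
qed

text \<open>A contractible cover makes the lifted sphere null-homotopic in the complement, hence
  also in the larger set \<open>- coordinate_subspace P\<close>. There it is homotopic by straight
  lines to the inclusion of \<open>coord_sphere P\<close>, which is essential.\<close>

lemma not_aspherical_if_not_flag:
  fixes K :: "'d::finite set \<Rightarrow> bool"
  assumes K_subset: "\<And>P Q. K P \<Longrightarrow> Q \<subseteq> P \<Longrightarrow> K Q"
    and P: "minimal_nonface K P" "card P \<ge> 3"
  shows "\<not> aspherical_space (top_of_set {y :: real^'d. K (zeros y)})"
proof
  let ?C = "{y :: real^'d. K (zeros y)}" and ?S = "coord_sphere P"
  assume "aspherical_space (top_of_set ?C)"
  then obtain E :: "(real \<Rightarrow> real^'d) set topology" and p where
    cov: "covering_map E p (top_of_set ?C)" and E: "contractible_space E"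
    unfolding aspherical_space_def by blast
  \<comment> \<open>Setting the coordinates outside \<open>P\<close> to 1 makes the zero set a
    subset of \<open>P\<close>, proper because \<open>x\<close> is nonzero, and hence a
    face.\<close>
  define f :: "real^'d \<Rightarrow> real^'d" where "f x = (\<chi> i. if i \<in> P then x $ i else 1)" for x
  have fS: "f ` ?S \<subseteq> ?C"
  proof
    fix y assume "y \<in> f ` ?S"
    then obtain x where x: "x \<in> ?S" "y = f x" by blast
    have "zeros y \<subseteq> P" by (auto simp: x(2) f_def zeros_def split: if_splits)
    moreover have "zeros y \<noteq> P"
    proof
      assume eq: "zeros y = P"
      have "x $ i = 0" for i
      proof (cases "i \<in> P")
        case True
        then have "y $ i = 0" using eq by (auto simp: zeros_def)
        then show ?thesis using True by (simp add: x(2) f_def)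
      next
        case False
        then show ?thesis using x(1) by (simp add: coord_sphere_def)
      qed
      then have "x = 0" by (simp add: vec_eq_iff)
      then show False using x(1) by (simp add: coord_sphere_def)
    qed
    ultimately show "y \<in> ?C" using P(1) by (auto simp: minimal_nonface_def)
  qed
  have fc: "continuous_on ?S f"
    unfolding f_def
  proof (rule continuous_on_vec_lambda)
    show "continuous_on ?S (\<lambda>x. if i \<in> P then x $ i else 1)" for i
      by (cases "i \<in> P") (auto intro!: continuous_intros)
  qed
  then have "continuous_map (top_of_set ?S) (top_of_set ?C) f" using fS by auto
  then obtain g where g: "continuous_map (top_of_set ?S) E g" "\<forall>x\<in>?S. p (g x) = f x"
    using covering_map_lift_sphere[OF cov P(2)] by blast
  have pc: "continuous_map E (top_of_set ?C) p" using cov by (simp add: covering_map_def)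
  obtain c where "homotopic_with (\<lambda>_. True) (top_of_set ?S) (top_of_set ?C) (p \<circ> g) (\<lambda>_. c)"
    using nullhomotopic_through_contractible_space[OF g(1) pc E] .
  then have null: "homotopic_with_canon (\<lambda>_. True) ?S ?C f (\<lambda>_. c)"
    by (rule homotopic_with_eq) (use g(2) in auto)
  have "?C \<subseteq> - coordinate_subspace P"
    using P(1) K_subset by (auto simp: coordinate_subspace_zeros minimal_nonface_def)
  then have null': "homotopic_with_canon (\<lambda>_. True) ?S (- coordinate_subspace P) f (\<lambda>_. c)"
    using null homotopic_with_subset_right by blast
  have "homotopic_with_canon (\<lambda>_. True) ?S (- coordinate_subspace P) id f"
  proof (rule homotopic_with_linear[OF _ fc])
    show "continuous_on ?S id" by simp
    fix x assume x: "x \<in> ?S"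
    show "closed_segment (id x) (f x) \<subseteq> - coordinate_subspace P"
    proof
      fix y assume "y \<in> closed_segment (id x) (f x)"
      then obtain u where y: "y = (1 - u) *\<^sub>R x + u *\<^sub>R f x" by (auto simp: in_segment)
      have yP: "y $ i = x $ i" if "i \<in> P" for i using that by (simp add: y f_def algebra_simps)
      show "y \<in> - coordinate_subspace P"
      proof
        assume "y \<in> coordinate_subspace P"
        then have "x = 0" using yP x by (auto simp: coordinate_subspace_def coord_sphere_def vec_eq_iff)
        then show False using x by (simp add: coord_sphere_def)
      qed
    qed
  qed
  then have "\<exists>c. homotopic_with_canon (\<lambda>_. True) ?S (- coordinate_subspace P) id (\<lambda>_. c)"
    using null' homotopic_with_trans by blast
  moreover have "P \<noteq> {}" using P(2) by auto
  ultimately show False using coord_sphere_essential by blast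
qed

context racg_complex
begin

theorem aspherical_complement_iff:
  "aspherical_space (top_of_set complement) \<longleftrightarrow> (\<forall>P. minimal_nonface K P \<longrightarrow> card P = 2)"
proof
  assume asph: "aspherical_space (top_of_set complement)"
  show "\<forall>P. minimal_nonface K P \<longrightarrow> card P = 2"
  proof (intro allI impI)
    fix P assume P: "minimal_nonface K P"
    have "card P \<ge> 2" by (rule minimal_nonface_card[OF K_subset K_singleton P])
    moreover have "\<not> card P \<ge> 3"
    proof
      assume "card P \<ge> 3"
      with K_subset P have "\<not> aspherical_space (top_of_set {y :: real^'d. K (zeros y)})"
        by (rule not_aspherical_if_not_flag)
      then show False using asph by (simp add: complement_def)
    qed
    ultimately show "card P = 2" by simp
  qed
next
  assume flag: "\<forall>P. minimal_nonface K P \<longrightarrow> card P = 2"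
  have "K \<sigma>" if "clique \<sigma>" for \<sigma>
    by (rule flag_face[where K = K, OF K_subset K_singleton]) (use flag that in \<open>auto simp: clique_def adj_iff\<close>)
  then have "complement = flag_complement"
    using complement_subset by (auto simp: complement_def flag_complement_def)
  then show "aspherical_space (top_of_set complement)"
    using aspherical_flag_complement[OF contractible_cover] by simp
qed

end

theorem theorem1p3:
  fixes N :: "'v::euclidean_space set"
    and \<Delta> :: "'v set set"
    and \<rho> :: "'d::finite \<Rightarrow> 'v set"
    and v :: "'d \<Rightarrow> 'v"
  assumes "full_lattice N"
    and "smooth_complete_fan N \<Delta>"
    and "bij_betw \<rho> UNIV (fan_edges \<Delta>)"
    and "\<And>i. v i \<in> \<rho> i" and "\<And>i. primitive_vector N (v i)"
  shows "(\<forall>a \<in> arrangement_complement \<Delta> v.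
            fundamental_group (arrangement_complement \<Delta> v) a
              \<cong> commutator_subgroup (coxeter_group_of_fan \<Delta> v))
    \<and> (aspherical_space (top_of_set (arrangement_complement \<Delta> v))
        \<longleftrightarrow> (\<exists>\<V>. (\<forall>V\<in>\<V>. subspace V \<and> dim V + 2 = CARD('d)) \<and> arrangement \<Delta> v = \<Union>\<V>))"
proof -
  let ?K = "generates_cone \<Delta> v"
  let ?adj = "\<lambda>i j. ?K {i, j}"
  have sub: "?K Q" if "?K P" "Q \<subseteq> P" for P Q
    by (rule generates_cone_subset[OF assms(2-5) that])
  have single: "?K {i}" for i
    by (rule generates_cone_singleton[OF assms(2-5)])
  interpret W: coxeter_presentation ?adj
    by unfold_locales (simp add: insert_commute)
  interpret R: racg W.W W.gen ?adj W.letter_count W.descents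
    by (rule W.racg)
  interpret C: racg_complex W.W W.gen ?adj W.letter_count W.descents ?K
    by unfold_locales (use sub single W.countable_W in auto)
  have W: "coxeter_group_of_fan \<Delta> v = W.W"
    by (simp add: coxeter_group_of_fan_def W.rels_def)
  have prim: "primitive_collection \<Delta> v P \<longleftrightarrow> minimal_nonface ?K P" for P
    by (simp add: primitive_collection_def minimal_nonface_def)
  have arr: "arrangement \<Delta> v = (\<Union>P\<in>{P. minimal_nonface ?K P}. coordinate_subspace P)"
    by (simp add: arrangement_def prim)
  have compl: "arrangement_complement \<Delta> v = C.complement"
    unfolding arrangement_complement_def arr C.complement_def
    by (rule complement_eq_faces[where K = ?K, OF sub single])
  show ?thesis
    unfolding compl W
  proof (intro conjI ballI)
    show "fundamental_group C.complement a \<cong> commutator_subgroup W.W" if "a \<in> C.complement" for a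
      using that by (rule C.fundamental_group_complement)
    show "aspherical_space (top_of_set C.complement) \<longleftrightarrow>
        (\<exists>\<V>. (\<forall>V\<in>\<V>. subspace V \<and> dim V + 2 = CARD('d)) \<and> arrangement \<Delta> v = \<Union>\<V>)"
      unfolding C.aspherical_complement_iff arr
      by (rule union_codim2_iff[where K = ?K, OF sub single, symmetric])
  qed
qed

end
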